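(* Let $\omega$ be a non-quasianalytic weight function. Then the multiplication operator $M\colon\mathcal{O}_{M,\omega}(\mathbb{R}^N)\times\mathcal{S}_\omega(\mathbb{R}^N)\to\mathcal{S}_\omega(\mathbb{R}^N)$, $(f,g)\mapsto fg$, is separately continuous and hence a hypocontinuous bilinear mapping.
   Context: Weights. A non-quasianalytic weight function is a continuous increasing function $\omega:[0,\infty)\to[0,\infty)$ such that: ($\alpha$) there is $K\ge 1$ with $\omega(2t)\le K(1+\omega(t))$ for all $t\ge 0$; ($\beta$) $\int_1^\infty \frac{\omega(t)}{1+t^2}\,dt<\infty$; ($\gamma$) there are $a\in\mathbb{R}$, $b>0$ with $\omega(t)\ge a+b\log(1+t)$ for all $t\ge 0$; ($\delta$) $\varphi_\omega(t)=\omega(e^t)$ is convex. It is assumed (normalization) that $\omega$ vanishes on $[0,1]$. For $x\in\mathbb{R}^N$, $\omega(x):=\omega(|x|)$. The Young conjugate is $\varphi^*_\omega(s):=\sup_{t\ge 0}\{st-\varphi_\omega(t)\}$, $s\ge 0$ (the value $+\infty$ is allowed, with $\exp(-\infty)=0$). Spaces. $\mathcal{S}_\omega(\mathbb{R}^N)$ is the set of all $f\in L^1(\mathbb{R}^N)$ such that $f,\hat f\in C^\infty(\mathbb{R}^N)$ and $\|\exp(\lambda\omega)\partial^\alpha f\|_\infty<\infty$, $\|\exp(\lambda\omega)\partial^\alpha\hat f\|_\infty<\infty$ for all $\lambda>0$, $\alpha\in\mathbb{N}_0^N$; it is a Fréchet space with the norms $q_{m,n}(f):=\sup_{\alpha}\|\exp(n\omega)\partial^\alpha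 f\|_\infty\exp\left(-m\varphi^*_\omega\left(\frac{|\alpha|}{m}\right)\right)$, $m,n\in\mathbb{N}$. For $m,n\in\mathbb{N}$ let $\mathcal{O}^m_{n,\omega}(\mathbb{R}^N)$ be the space of all $f\in C^\infty(\mathbb{R}^N)$ with $r_{m,n}(f):=\sup_{\alpha\in\mathbb{N}_0^N}\sup_{x\in\mathbb{R}^N}|\partial^\alpha f(x)|\exp\left(-n\omega(x)-m\varphi^*_\omega\left(\frac{|\alpha|}{m}\right)\right)<\infty$, with norm $r_{m,n}$. Set $\mathcal{O}_{M,\omega}(\mathbb{R}^N):=\bigcap_{m}\bigcup_{n}\mathcal{O}^m_{n,\omega}(\mathbb{R}^N)$ with the topology of the projective limit over $m$ of the locally convex inductive limits $\mathrm{ind}_{n}\,\mathcal{O}^m_{n,\omega}(\mathbb{R}^N)$. Hypocontinuity. A bilinear map $b\colon E\times F\to G$ between topological vector spaces is hypocontinuous if for every bounded $A\subset E$ the set $\{b(x,\cdot):x\in A\}$ is equicontinuous in $\mathcal{L}(F,G)$, and for every bounded $B\subset F$ the set $\{b(\cdot,y):y\in B\}$ is equicontinuous in $\mathcal{L}(E,G)$. *)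

theory Defs
  imports "HOL-Analysis.Analysis" "HOL-Library.Function_Algebras"
begin

section \<open>Weights\<close>

text \<open>
  Only the values of \<open>\<omega>\<close> on \<open>{0..}\<close> matter below. The weight is increasing in the weak
  sense, since the last condition normalizes it to vanish on \<open>{0..1}\<close>.
\<close>

definition nonquasianalytic_weight :: "(real \<Rightarrow> real) \<Rightarrow> bool" where
  "nonquasianalytic_weight \<omega> \<longleftrightarrow>
     continuous_on {0..} \<omega> \<and> mono_on {0..} \<omega> \<and> (\<forall>t\<ge>0. 0 \<le> \<omega> t) \<and>
     (\<exists>K\<ge>1. \<forall>t\<ge>0. \<omega> (2 * t) \<le> K * (1 + \<omega> t)) \<and>
     set_integrable lborel {1..} (\<lambda>t. \<omega> t / (1 + t\<^sup>2)) \<and>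
     (\<exists>a b. b > 0 \<and> (\<forall>t\<ge>0. a + b * ln (1 + t) \<le> \<omega> t)) \<and>
     convex_on UNIV (\<lambda>t. \<omega> (exp t)) \<and>
     (\<forall>t\<in>{0..1}. \<omega> t = 0)"

definition young_conj :: "(real \<Rightarrow> real) \<Rightarrow> real \<Rightarrow> ereal" where
  "young_conj \<omega> s = (SUP t\<in>{0..}. ereal (s * t - \<omega> (exp t)))"

definition exp_ereal :: "ereal \<Rightarrow> ereal" where
  "exp_ereal x = (case x of ereal r \<Rightarrow> ereal (exp r) | PInfty \<Rightarrow> \<infinity> | MInfty \<Rightarrow> 0)"


section \<open>Partial derivatives, smoothness and the Fourier transform\<close>

definition pderiv_dir :: "'n::finite \<Rightarrow> (real ^ 'n \<Rightarrow> complex) \<Rightarrow> real ^ 'n \<Rightarrow> complex" where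
  "pderiv_dir i f x = frechet_derivative f (at x) (axis i 1)"

primrec times_cont_diff :: "nat \<Rightarrow> (real ^ 'n::finite \<Rightarrow> complex) \<Rightarrow> bool" where
  "times_cont_diff 0 f \<longleftrightarrow> continuous_on UNIV f"
| "times_cont_diff (Suc k) f \<longleftrightarrow>
     (\<forall>x. f differentiable at x) \<and> (\<forall>i. times_cont_diff k (pderiv_dir i f))"

definition smooth :: "(real ^ 'n::finite \<Rightarrow> complex) \<Rightarrow> bool" where
  "smooth f \<longleftrightarrow> (\<forall>k. times_cont_diff k f)"

text \<open>
  A multi-index is a function \<open>'n \<Rightarrow> nat\<close>. The index type carries no order, so the order of
  differentiation is fixed by an arbitrary enumeration of the coordinates; for smooth functions,
  the only ones to which \<open>mderiv\<close> is applied, it is irrelevant by Schwarz's theorem.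
\<close>

definition coords :: "'n::finite list" where
  "coords = (SOME is. distinct is \<and> set is = UNIV)"

definition mderiv :: "('n::finite \<Rightarrow> nat) \<Rightarrow> (real ^ 'n \<Rightarrow> complex) \<Rightarrow> real ^ 'n \<Rightarrow> complex" where
  "mderiv \<alpha> f = foldr (\<lambda>i. pderiv_dir i ^^ \<alpha> i) coords f"

definition msize :: "('n::finite \<Rightarrow> nat) \<Rightarrow> nat" where
  "msize \<alpha> = (\<Sum>i\<in>UNIV. \<alpha> i)"

definition fourier :: "(real ^ 'n::finite \<Rightarrow> complex) \<Rightarrow> real ^ 'n \<Rightarrow> complex" where
  "fourier f \<xi> = (LINT x|lborel. f x * exp (- (\<i> * of_real (x \<bullet> \<xi>))))"

lemma distinct_coords: "distinct (coords :: 'n::finite list)"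
  and set_coords: "set (coords :: 'n::finite list) = UNIV"
proof -
  have "\<exists>is :: 'n list. distinct is \<and> set is = UNIV"
    using finite_distinct_list[of "UNIV :: 'n set"] by auto
  then have "distinct (coords :: 'n list) \<and> set (coords :: 'n list) = UNIV"
    unfolding coords_def by (rule someI_ex)
  then show "distinct (coords :: 'n list)" "set (coords :: 'n list) = UNIV"
    by auto
qed


section \<open>Topological vector spaces of functions\<close>

text \<open>
  Every space below is a complex linear subspace of some \<open>'x \<Rightarrow> complex\<close>, with the pointwise
  operations, and a topology on it is a \<open>topology\<close> whose \<open>topspace\<close> is that subspace.
\<close>

definition cscale :: "complex \<Rightarrow> ('x \<Rightarrow> complex) \<Rightarrow> 'x \<Rightarrow> complex" where
  "cscale c f = (\<lambda>x. c * f x)"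

interpretation cfun: vector_space cscale
  by standard (auto simp: cscale_def plus_fun_def fun_eq_iff algebra_simps)

definition cfun_convex :: "('x \<Rightarrow> complex) set \<Rightarrow> bool" where
  "cfun_convex W \<longleftrightarrow>
     (\<forall>f\<in>W. \<forall>g\<in>W. \<forall>t\<in>{0..1}. cscale (of_real (1 - t)) f + cscale (of_real t) g \<in> W)"

definition lc_space :: "('x \<Rightarrow> complex) topology \<Rightarrow> bool" where
  "lc_space T \<longleftrightarrow>
     cfun.subspace (topspace T) \<and>
     continuous_map (prod_topology T T) T (\<lambda>(f, g). f + g) \<and>
     continuous_map (prod_topology euclidean T) T (\<lambda>(c, f). cscale c f) \<and>
     (\<forall>U. openin T U \<and> 0 \<in> U \<longrightarrow> (\<exists>W. openin T W \<and> 0 \<in> W \<and> cfun_convex W \<and> W \<subseteq> U))"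

text \<open>
  The topology on \<open>V\<close> defined by a family \<open>P\<close> of seminorms. These are extended-real valued because
  they are given as suprema; only their values on \<open>V\<close> are used.
\<close>

definition seminorm_topology ::
    "('x \<Rightarrow> complex) set \<Rightarrow> (('x \<Rightarrow> complex) \<Rightarrow> ereal) set \<Rightarrow> ('x \<Rightarrow> complex) topology" where
  "seminorm_topology V P =
     topology_generated_by
       (insert V {{g \<in> V. p (g - f) < ereal e} | p f e. p \<in> P \<and> f \<in> V \<and> e > 0})"

text \<open>
  The locally convex inductive limit of the spaces \<open>T n\<close>, \<open>n \<in> I\<close>, along inclusions: the finest
  locally convex topology on their union (which has to be a linear space, as for increasing \<open>T\<close>)
  making all inclusions continuous. It is the supremum of all locally convex topologies with that
  property, the supremum being again one of them.
\<close>

definition lc_inductive_limit ::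
    "nat set \<Rightarrow> (nat \<Rightarrow> ('x \<Rightarrow> complex) topology) \<Rightarrow> ('x \<Rightarrow> complex) topology" where
  "lc_inductive_limit I T =
     (let V = (\<Union>n\<in>I. topspace (T n)) in
      topology_generated_by
        (insert V {U. \<exists>X. lc_space X \<and> topspace X = V \<and>
                          (\<forall>n\<in>I. continuous_map (T n) X (\<lambda>f. f)) \<and> openin X U}))"

text \<open>
  The projective limit of the spaces \<open>T m\<close>, \<open>m \<in> I\<close>, along inclusions: the coarsest topology on
  their intersection making all inclusions into the \<open>T m\<close> continuous.
\<close>

definition projective_limit ::
    "nat set \<Rightarrow> (nat \<Rightarrow> ('x \<Rightarrow> complex) topology) \<Rightarrow> ('x \<Rightarrow> complex) topology" where
  "projective_limit I T =
     (let V = (\<Inter>m\<in>I. topspace (T m)) in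
      topology_generated_by (insert V {V \<inter> U | m U. m \<in> I \<and> openin (T m) U}))"

definition clinear_between ::
    "('x \<Rightarrow> complex) set \<Rightarrow> ('y \<Rightarrow> complex) set \<Rightarrow> (('x \<Rightarrow> complex) \<Rightarrow> 'y \<Rightarrow> complex) \<Rightarrow> bool" where
  "clinear_between V W h \<longleftrightarrow>
     h ` V \<subseteq> W \<and>
     (\<forall>f\<in>V. \<forall>g\<in>V. h (f + g) = h f + h g) \<and>
     (\<forall>c. \<forall>f\<in>V. h (cscale c f) = cscale c (h f))"

definition tvs_bounded :: "('x \<Rightarrow> complex) topology \<Rightarrow> ('x \<Rightarrow> complex) set \<Rightarrow> bool" where
  "tvs_bounded T B \<longleftrightarrow>
     B \<subseteq> topspace T \<and>
     (\<forall>U. openin T U \<and> 0 \<in> U \<longrightarrow> (\<exists>\<rho>>0. \<forall>c. norm c \<ge> \<rho> \<longrightarrow> B \<subseteq> cscale c ` U))"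

definition tvs_equicontinuous ::
    "('x \<Rightarrow> complex) topology \<Rightarrow> ('y \<Rightarrow> complex) topology \<Rightarrow>
     (('x \<Rightarrow> complex) \<Rightarrow> 'y \<Rightarrow> complex) set \<Rightarrow> bool" where
  "tvs_equicontinuous S T H \<longleftrightarrow>
     (\<forall>h\<in>H. clinear_between (topspace S) (topspace T) h \<and> continuous_map S T h) \<and>
     (\<forall>W. openin T W \<and> 0 \<in> W \<longrightarrow> (\<exists>U. openin S U \<and> 0 \<in> U \<and> (\<forall>h\<in>H. h ` U \<subseteq> W)))"

definition cbilinear_between ::
    "('x \<Rightarrow> complex) set \<Rightarrow> ('y \<Rightarrow> complex) set \<Rightarrow> ('z \<Rightarrow> complex) set \<Rightarrow>
     (('x \<Rightarrow> complex) \<Rightarrow> ('y \<Rightarrow> complex) \<Rightarrow> 'z \<Rightarrow> complex) \<Rightarrow> bool" where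
  "cbilinear_between E F G b \<longleftrightarrow>
     (\<forall>x\<in>E. clinear_between F G (\<lambda>y. b x y)) \<and> (\<forall>y\<in>F. clinear_between E G (\<lambda>x. b x y))"

definition separately_continuous ::
    "('x \<Rightarrow> complex) topology \<Rightarrow> ('y \<Rightarrow> complex) topology \<Rightarrow> ('z \<Rightarrow> complex) topology \<Rightarrow>
     (('x \<Rightarrow> complex) \<Rightarrow> ('y \<Rightarrow> complex) \<Rightarrow> 'z \<Rightarrow> complex) \<Rightarrow> bool" where
  "separately_continuous E F G b \<longleftrightarrow>
     (\<forall>x\<in>topspace E. continuous_map F G (\<lambda>y. b x y)) \<and>
     (\<forall>y\<in>topspace F. continuous_map E G (\<lambda>x. b x y))"

definition hypocontinuous ::
    "('x \<Rightarrow> complex) topology \<Rightarrow> ('y \<Rightarrow> complex) topology \<Rightarrow> ('z \<Rightarrow> complex) topology \<Rightarrow>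
     (('x \<Rightarrow> complex) \<Rightarrow> ('y \<Rightarrow> complex) \<Rightarrow> 'z \<Rightarrow> complex) \<Rightarrow> bool" where
  "hypocontinuous E F G b \<longleftrightarrow>
     (\<forall>A. tvs_bounded E A \<longrightarrow> tvs_equicontinuous F G ((\<lambda>x y. b x y) ` A)) \<and>
     (\<forall>B. tvs_bounded F B \<longrightarrow> tvs_equicontinuous E G ((\<lambda>y x. b x y) ` B))"


section \<open>The spaces \<open>S\<^sub>\<omega>\<close> and \<open>O\<^sub>M\<^sub>,\<^sub>\<omega>\<close>\<close>

definition S_space :: "(real \<Rightarrow> real) \<Rightarrow> (real ^ 'n::finite \<Rightarrow> complex) set" where
  "S_space \<omega> =
     {f. integrable lborel f \<and> smooth f \<and> smooth (fourier f) \<and>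
         (\<forall>l>0. \<forall>\<alpha>.
            bounded (range (\<lambda>x. exp (l * \<omega> (norm x)) *\<^sub>R mderiv \<alpha> f x)) \<and>
            bounded (range (\<lambda>x. exp (l * \<omega> (norm x)) *\<^sub>R mderiv \<alpha> (fourier f) x)))}"

definition q_norm ::
    "(real \<Rightarrow> real) \<Rightarrow> nat \<Rightarrow> nat \<Rightarrow> (real ^ 'n::finite \<Rightarrow> complex) \<Rightarrow> ereal" where
  "q_norm \<omega> m n f =
     (SUP \<alpha>. (SUP x. ereal (exp (real n * \<omega> (norm x)) * norm (mderiv \<alpha> f x))) *
             exp_ereal (- (ereal (real m) * young_conj \<omega> (real (msize \<alpha>) / real m))))"

definition S_topology :: "(real \<Rightarrow> real) \<Rightarrow> (real ^ 'n::finite \<Rightarrow> complex) topology" where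
  "S_topology \<omega> = seminorm_topology (S_space \<omega>) {q_norm \<omega> m n | m n. m \<ge> 1 \<and> n \<ge> 1}"

definition r_norm ::
    "(real \<Rightarrow> real) \<Rightarrow> nat \<Rightarrow> nat \<Rightarrow> (real ^ 'n::finite \<Rightarrow> complex) \<Rightarrow> ereal" where
  "r_norm \<omega> m n f =
     (SUP \<alpha>. SUP x. ereal (norm (mderiv \<alpha> f x)) *
        exp_ereal (- ereal (real n * \<omega> (norm x))
                   - ereal (real m) * young_conj \<omega> (real (msize \<alpha>) / real m)))"

definition O_step_space ::
    "(real \<Rightarrow> real) \<Rightarrow> nat \<Rightarrow> nat \<Rightarrow> (real ^ 'n::finite \<Rightarrow> complex) set" where
  "O_step_space \<omega> m n = {f. smooth f \<and> r_norm \<omega> m n f < \<infinity>}"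

definition O_step_topology ::
    "(real \<Rightarrow> real) \<Rightarrow> nat \<Rightarrow> nat \<Rightarrow> (real ^ 'n::finite \<Rightarrow> complex) topology" where
  "O_step_topology \<omega> m n = seminorm_topology (O_step_space \<omega> m n) {r_norm \<omega> m n}"

definition OM_space :: "(real \<Rightarrow> real) \<Rightarrow> (real ^ 'n::finite \<Rightarrow> complex) set" where
  "OM_space \<omega> = (\<Inter>m\<in>{1..}. \<Union>n\<in>{1..}. O_step_space \<omega> m n)"

definition OM_topology :: "(real \<Rightarrow> real) \<Rightarrow> (real ^ 'n::finite \<Rightarrow> complex) topology" where
  "OM_topology \<omega> =
     projective_limit {1..} (\<lambda>m. lc_inductive_limit {1..} (\<lambda>n. O_step_topology \<omega> m n))"

lemma topspace_seminorm_topology [simp]: "topspace (seminorm_topology V P) = V"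
  by (auto simp: seminorm_topology_def)

lemma topspace_lc_inductive_limit [simp]:
  "topspace (lc_inductive_limit I T) = (\<Union>n\<in>I. topspace (T n))"
proof -
  have "U \<subseteq> (\<Union>n\<in>I. topspace (T n))"
    if "topspace X = (\<Union>n\<in>I. topspace (T n))" "openin X U" for X U
    using that openin_subset by fastforce
  then show ?thesis
    unfolding lc_inductive_limit_def Let_def topology_generated_by_topspace by blast
qed

lemma topspace_projective_limit [simp]:
  "topspace (projective_limit I T) = (\<Inter>m\<in>I. topspace (T m))"
  by (auto simp: projective_limit_def Let_def)

lemma topspace_S_topology: "topspace (S_topology \<omega>) = S_space \<omega>"
  by (simp add: S_topology_def)

lemma topspace_OM_topology: "topspace (OM_topology \<omega>) = OM_space \<omega>"
  by (simp add: OM_topology_def OM_space_def O_step_topology_def)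

end

theory Submission
  imports Defs "HOL-Probability.Probability"
begin

text \<open>
  Put \<open>w m k = inf {exp (m \<omega> r) / r ^ k | r \<ge> 1}\<close>, which is \<open>exp (- m \<phi>* (k / m))\<close>. The Leibniz rule,
  \<open>w m (a + b) \<le> w m a * w m b\<close> and condition \<open>(\<alpha>)\<close> bound every \<open>q_norm\<close> of a product \<open>f * g\<close> by an
  \<open>r_norm\<close> of \<open>f\<close> times a \<open>q_norm\<close> of \<open>g\<close>. What makes this usable is that \<open>S_space \<omega>\<close> is exactly the
  set of smooth functions with finite \<open>q_norm\<close>s. Finiteness of these norms yields membership by
  Fourier analysis and the duality \<open>\<phi>** = \<phi>\<close>. Conversely, the decay of the Fourier transform bounds
  all derivatives without spatial weight, and a Landau-Kolmogorov inequality on half-lines pointing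
  away from the origin interpolates these bounds with the decay of the function itself.

  Hypocontinuity needs no barrelledness: a gliding-hump seminorm shows that a bounded subset of
  \<open>OM_space \<omega>\<close> is, for each \<open>m\<close>, bounded in a single step of the inductive limit.
\<close>

section \<open>Seminorms and the topologies they define\<close>

text \<open>The definition of \<open>S_space\<close> bounds each derivative separately and says
  nothing about the growth of the bounds with the order, whereas \<open>q_norm\<close> prescribes
  that growth. With the definition alone one would have to control the Fourier transform of a
  product; the description by \<open>q_norm\<close> removes the transform from the problem.

  The interpolation yields a geometric mean, so it halves the spatial weight as well as
  \<open>m\<close>. As all indices are available this costs nothing, provided that the constant
  grows at most like \<open>C ^ k\<close> in the order \<open>k\<close>: such a factor is absorbed
  by a larger \<open>m\<close>, a factorial in general is not. Hence the Landau-Kolmogorov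
  inequality is proved with an explicit geometric constant, and a factor of \<open>2\<close> per
  differentiation is good enough for the Leibniz rule.

  A further obstacle is that \<open>w m k\<close> can vanish, namely where the conjugate is
  infinite, as happens for logarithmic growth of \<omega>. A \<open>q_norm\<close> with small
  \<open>m\<close> then carries no information about derivatives of high order. Divisions by
  \<open>w\<close> therefore need a case distinction, or an \<open>m\<close> chosen after the
  order.\<close>

definition seminorm_on :: "('x \<Rightarrow> complex) set \<Rightarrow> (('x \<Rightarrow> complex) \<Rightarrow> real) \<Rightarrow> bool" where
  "seminorm_on V p \<longleftrightarrow> cfun.subspace V \<and>
     (\<forall>f\<in>V. \<forall>g\<in>V. p (f + g) \<le> p f + p g) \<and> (\<forall>c. \<forall>f\<in>V. p (cscale c f) = cmod c * p f)"

lemma seminorm_on_subspace: "seminorm_on V p \<Longrightarrow> cfun.subspace V"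
  and seminorm_on_add: "seminorm_on V p \<Longrightarrow> f \<in> V \<Longrightarrow> g \<in> V \<Longrightarrow> p (f + g) \<le> p f + p g"
  and seminorm_on_cscale: "seminorm_on V p \<Longrightarrow> f \<in> V \<Longrightarrow> p (cscale c f) = cmod c * p f"
  by (auto simp: seminorm_on_def)

lemma seminorm_on_0: "seminorm_on V p \<Longrightarrow> p 0 = 0"
  using seminorm_on_cscale[of V p 0 0] cfun.subspace_0[of V]
  by (simp add: seminorm_on_subspace cscale_def zero_fun_def)

lemma seminorm_on_nonneg:
  assumes "seminorm_on V p" "f \<in> V"
  shows "p f \<ge> 0"
proof -
  have m: "cscale (-1) f \<in> V" using assms seminorm_on_subspace cfun.subspace_scale by blast
  have "f + cscale (-1) f = 0" by (simp add: cscale_def fun_eq_iff)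
  then have "0 \<le> p f + p (cscale (-1) f)"
    using seminorm_on_add[OF assms m] seminorm_on_0[OF assms(1)] by simp
  then show ?thesis using seminorm_on_cscale[OF assms, of "-1"] by simp
qed

lemma seminorm_on_diff_triangle:
  assumes "seminorm_on V p" "f \<in> V" "g \<in> V" "h \<in> V"
  shows "p (f - h) \<le> p (f - g) + p (g - h)"
proof -
  have "f - g \<in> V" "g - h \<in> V" using assms seminorm_on_subspace cfun.subspace_diff by blast+
  from seminorm_on_add[OF assms(1) this] show ?thesis by simp
qed

text \<open>Serves for all seminorms below: \<open>q_norm\<close>, \<open>r_norm\<close>, and those
  built in \<open>equicontinuous_mult_right\<close> and \<open>bounded_OM_imp_r_bound\<close>. The
  second conclusion rests on the finiteness of the supremum and lets later estimates be made one
  functional at a time.\<close>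

lemma seminorm_on_SUP:
  fixes L :: "'i \<Rightarrow> ('x \<Rightarrow> complex) \<Rightarrow> complex"
  assumes V: "cfun.subspace V"
    and add: "\<And>i f g. f \<in> V \<Longrightarrow> g \<in> V \<Longrightarrow> L i (f + g) = L i f + L i g"
    and scale: "\<And>i c f. f \<in> V \<Longrightarrow> L i (cscale c f) = c * L i f"
    and bdd: "\<And>f. f \<in> V \<Longrightarrow> \<exists>C. \<forall>i. cmod (L i f) \<le> C"
  shows "seminorm_on V (\<lambda>f. SUP i. cmod (L i f))" (is "seminorm_on V ?p")
    and "f \<in> V \<Longrightarrow> (SUP i. cmod (L i f)) \<le> C \<longleftrightarrow> (\<forall>i. cmod (L i f) \<le> C)"
proof -
  have bdd_above: "bdd_above (range (\<lambda>i. cmod (L i f)))" if "f \<in> V" for f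
    using bdd[OF that] by (auto simp: bdd_above_def)
  have iff: "?p f \<le> C \<longleftrightarrow> (\<forall>i. cmod (L i f) \<le> C)" if "f \<in> V" for f C
    by (simp add: cSUP_le_iff[OF _ bdd_above[OF that]])
  then show "f \<in> V \<Longrightarrow> (SUP i. cmod (L i f)) \<le> C \<longleftrightarrow> (\<forall>i. cmod (L i f) \<le> C)" .
  have up: "cmod (L i f) \<le> ?p f" if "f \<in> V" for i f using iff[OF that] by blast
  have le: "?p (cscale c f) \<le> cmod c * ?p f" if "f \<in> V" for c f
    using cfun.subspace_scale[OF V that] that
    by (subst iff) (auto simp: scale norm_mult intro!: mult_left_mono up)
  show "seminorm_on V ?p"
    unfolding seminorm_on_def
  proof (intro conjI ballI allI V)
    fix f g assume fg: "f \<in> V" "g \<in> V"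
    show "?p (f + g) \<le> ?p f + ?p g"
      using fg cfun.subspace_add[OF V fg]
      by (subst iff) (auto simp: add intro!: norm_triangle_le add_mono up)
  next
    fix c f assume f: "f \<in> V"
    show "?p (cscale c f) = cmod c * ?p f"
    proof (cases "c = 0")
      case True
      show ?thesis unfolding True by (simp only: scale[OF f] mult_zero_left norm_zero) simp
    next
      case False
      have "cscale (1 / c) (cscale c f) = f" using False by (simp add: cscale_def)
      then have "?p f \<le> cmod (1 / c) * ?p (cscale c f)"
        using le[OF cfun.subspace_scale[OF V f], of "1 / c" c] by simp
      then have "cmod c * ?p f \<le> ?p (cscale c f)" using False by (simp add: norm_divide field_simps)
      then show ?thesis using le[OF f, of c] by simp
    qed
  qed
qed

lemma ereal_eqI_upper_bounds:
  assumes "0 \<le> q" "0 \<le> p" "\<And>C. C \<ge> 0 \<Longrightarrow> q \<le> ereal C \<longleftrightarrow> p \<le> C"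
  shows "q = ereal p"
proof (rule antisym)
  show "q \<le> ereal p" using assms by simp
  show "ereal p \<le> q" using assms by (cases q) auto
qed

text \<open>A nonnegative extended-real norm is determined by the real constants above it. Knowing
  which constants bound it thus identifies it with a real supremum of moduli of linear
  functionals.\<close>

lemma seminorm_on_of_upper_bounds:
  fixes L :: "'i \<Rightarrow> ('x \<Rightarrow> complex) \<Rightarrow> complex" and q :: "('x \<Rightarrow> complex) \<Rightarrow> ereal"
  assumes V: "cfun.subspace V"
    and add: "\<And>i f g. f \<in> V \<Longrightarrow> g \<in> V \<Longrightarrow> L i (f + g) = L i f + L i g"
    and scale: "\<And>i c f. f \<in> V \<Longrightarrow> L i (cscale c f) = c * L i f"
    and bdd: "\<And>f. f \<in> V \<Longrightarrow> \<exists>C. \<forall>i. cmod (L i f) \<le> C"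
    and q: "\<And>f. 0 \<le> q f" "\<And>f C. C \<ge> 0 \<Longrightarrow> q f \<le> ereal C \<longleftrightarrow> (\<forall>i. cmod (L i f) \<le> C)"
  shows "\<exists>p. seminorm_on V p \<and> (\<forall>f\<in>V. q f = ereal (p f))"
proof (intro exI conjI ballI)
  note sup = seminorm_on_SUP[OF V, where L = L]
  show p: "seminorm_on V (\<lambda>f. SUP i. cmod (L i f))"
    by (rule sup(1)) (rule add scale bdd; assumption)+
  fix f assume f: "f \<in> V"
  show "q f = ereal (SUP i. cmod (L i f))"
  proof (rule ereal_eqI_upper_bounds[OF q(1) seminorm_on_nonneg[OF p f]])
    show "q f \<le> ereal C \<longleftrightarrow> (SUP i. cmod (L i f)) \<le> C" if "C \<ge> 0" for C
      unfolding q(2)[OF that] by (rule sup(2)[symmetric, OF _ _ _ f]) (rule add scale bdd; assumption)+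
  qed
qed

text \<open>Finiteness on \<open>V\<close> permits subtracting values in triangle inequalities.
  Directedness makes single balls, instead of finite intersections of balls, a base of
  neighbourhoods.\<close>

definition seminorm_family :: "('x \<Rightarrow> complex) set \<Rightarrow> (('x \<Rightarrow> complex) \<Rightarrow> ereal) set \<Rightarrow> bool" where
  "seminorm_family V P \<longleftrightarrow> P \<noteq> {} \<and> cfun.subspace V \<and>
     (\<forall>q\<in>P. \<exists>p. seminorm_on V p \<and> (\<forall>f\<in>V. q f = ereal (p f))) \<and>
     (\<forall>q\<in>P. \<forall>q'\<in>P. \<exists>q''\<in>P. \<forall>f\<in>V. q f \<le> q'' f \<and> q' f \<le> q'' f)"

lemma seminorm_family_member:
  assumes "seminorm_family V P" "q \<in> P"
  obtains p where "seminorm_on V p" "\<forall>f\<in>V. q f = ereal (p f)"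
proof -
  have "\<forall>q\<in>P. \<exists>p. seminorm_on V p \<and> (\<forall>f\<in>V. q f = ereal (p f))"
    using assms(1) unfolding seminorm_family_def by (elim conjE)
  from bspec[OF this assms(2)] show ?thesis using that by blast
qed

lemma seminorm_family_directed:
  assumes "seminorm_family V P" "q \<in> P" "q' \<in> P"
  obtains q'' where "q'' \<in> P" "\<forall>f\<in>V. q f \<le> q'' f \<and> q' f \<le> q'' f"
proof -
  have "\<forall>q\<in>P. \<forall>q'\<in>P. \<exists>q''\<in>P. \<forall>f\<in>V. q f \<le> q'' f \<and> q' f \<le> q'' f"
    using assms(1) unfolding seminorm_family_def by (elim conjE)
  from bspec[OF bspec[OF this assms(2)] assms(3)] show ?thesis using that by blast
qed

lemma seminorm_family_singleton:
  "seminorm_on V p \<Longrightarrow> (\<And>f. f \<in> V \<Longrightarrow> q f = ereal (p f)) \<Longrightarrow> seminorm_family V {q}"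
  by (auto simp: seminorm_family_def seminorm_on_subspace)

lemma openin_seminorm_topology:
  assumes P: "seminorm_family V P"
  shows "openin (seminorm_topology V P) U \<longleftrightarrow>
    U \<subseteq> V \<and> (\<forall>f\<in>U. \<exists>q\<in>P. \<exists>e>0. {g \<in> V. q (g - f) < ereal e} \<subseteq> U)"
    (is "_ \<longleftrightarrow> ?open U")
proof
  have V: "cfun.subspace V" using P by (simp add: seminorm_family_def)
  let ?B = "insert V {{g \<in> V. p (g - f) < ereal e} | p f e. p \<in> P \<and> f \<in> V \<and> e > 0}"
  show "?open U" if "openin (seminorm_topology V P) U"
  proof -
    have "generate_topology_on ?B U"
      using that by (simp add: seminorm_topology_def openin_topology_generated_by_iff)
    then show ?thesis
    proof induction
      case (Int a b)
      have "\<exists>q\<in>P. \<exists>e>0. {g \<in> V. q (g - f) < ereal e} \<subseteq> a \<inter> b" if f: "f \<in> a \<inter> b" for f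
      proof -
        obtain q1 e1 where 1: "q1 \<in> P" "e1 > 0" "{g \<in> V. q1 (g - f) < ereal e1} \<subseteq> a"
          using Int f by blast
        obtain q2 e2 where 2: "q2 \<in> P" "e2 > 0" "{g \<in> V. q2 (g - f) < ereal e2} \<subseteq> b"
          using Int f by blast
        obtain q where q: "q \<in> P" "\<forall>f\<in>V. q1 f \<le> q f \<and> q2 f \<le> q f"
          by (rule seminorm_family_directed[OF P 1(1) 2(1)])
        have "f \<in> V" using Int f by blast
        have "g \<in> a \<inter> b" if g: "g \<in> V" "q (g - f) < ereal (min e1 e2)" for g
        proof -
          have "g - f \<in> V" using cfun.subspace_diff[OF V g(1) \<open>f \<in> V\<close>] .
          then have "q1 (g - f) < ereal e1" "q2 (g - f) < ereal e2"
            using bspec[OF q(2)] less_le_trans[OF g(2)] le_less_trans by fastforce+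
          then show ?thesis using 1(3) 2(3) g(1) by blast
        qed
        then have "{g \<in> V. q (g - f) < ereal (min e1 e2)} \<subseteq> a \<inter> b" by blast
        moreover have "min e1 e2 > 0" using 1(2) 2(2) by simp
        ultimately show ?thesis using q(1) by blast
      qed
      moreover have "a \<inter> b \<subseteq> V" using Int by (simp add: le_infI1)
      ultimately show ?case by (intro conjI ballI)
    next
      case (UN K)
      show ?case
      proof (intro conjI ballI)
        show "\<Union> K \<subseteq> V" using UN by blast
        fix f assume "f \<in> \<Union> K"
        then obtain k where k: "k \<in> K" "f \<in> k" by blast
        then obtain q e where "q \<in> P" "e > 0" "{g \<in> V. q (g - f) < ereal e} \<subseteq> k" using UN by blast
        then show "\<exists>q\<in>P. \<exists>e>0. {g \<in> V. q (g - f) < ereal e} \<subseteq> \<Union> K" using k(1) by blast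
      qed
    next
      case (Basis s)
      then consider "s = V" | p f e where "s = {g \<in> V. p (g - f) < ereal e}" "p \<in> P" "f \<in> V" "e > 0" by blast
      then show ?case
      proof cases
        case 1
        obtain q where "q \<in> P" using P by (auto simp: seminorm_family_def)
        then show ?thesis using 1 by (auto intro!: bexI[of _ q] exI[of _ "1::real"])
      next
        case (2 q f0 e)
        obtain p where p: "seminorm_on V p" "\<forall>f\<in>V. q f = ereal (p f)"
          by (rule seminorm_family_member[OF P 2(2)])
        have "\<exists>q\<in>P. \<exists>e>0. {g \<in> V. q (g - f) < ereal e} \<subseteq> s" if f: "f \<in> s" for f
        proof -
          have fV: "f \<in> V" "p (f - f0) < e" using f 2 p(2) cfun.subspace_diff[OF V] by auto
          have "g \<in> s" if g: "g \<in> V" "q (g - f) < ereal (e - p (f - f0))" for g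
          proof -
            have "p (g - f) < e - p (f - f0)" using g p(2) cfun.subspace_diff[OF V g(1) fV(1)] by simp
            then have "p (g - f0) < e"
              using seminorm_on_diff_triangle[OF p(1) g(1) fV(1) 2(3)] by simp
            then show ?thesis using 2 g p(2) cfun.subspace_diff[OF V g(1) 2(3)] by simp
          qed
          then have "{g \<in> V. q (g - f) < ereal (e - p (f - f0))} \<subseteq> s" by blast
          then show ?thesis using 2(2) fV(2) by (intro bexI[of _ q] exI[of _ "e - p (f - f0)"]) auto
        qed
        then show ?thesis using 2 by blast
      qed
    qed simp
  qed
  show "openin (seminorm_topology V P) U" if U: "?open U"
  proof (subst openin_subopen, intro ballI)
    fix f assume f: "f \<in> U"
    then obtain q e where q: "q \<in> P" "e > 0" "{g \<in> V. q (g - f) < ereal e} \<subseteq> U" using U by blast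
    have fV: "f \<in> V" using U f by blast
    obtain p where p: "seminorm_on V p" "\<forall>f\<in>V. q f = ereal (p f)"
      by (rule seminorm_family_member[OF P q(1)])
    have "q (f - f) = ereal 0" using bspec[OF p(2) cfun.subspace_0[OF V]] seminorm_on_0[OF p(1)] by simp
    then have "f \<in> {g \<in> V. q (g - f) < ereal e}" using q(2) fV by simp
    moreover have "openin (seminorm_topology V P) {g \<in> V. q (g - f) < ereal e}"
      unfolding seminorm_topology_def by (rule topology_generated_by_Basis) (use q fV in blast)
    ultimately show "\<exists>T. openin (seminorm_topology V P) T \<and> f \<in> T \<and> T \<subseteq> U" using q(3) by blast
  qed
qed

lemma openin_seminorm_topology_ball:
  "q \<in> P \<Longrightarrow> f \<in> V \<Longrightarrow> e > 0 \<Longrightarrow> openin (seminorm_topology V P) {g \<in> V. q (g - f) < ereal e}"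
  unfolding seminorm_topology_def by (rule topology_generated_by_Basis) blast

lemma openin_seminorm_topology_single:
  assumes p: "seminorm_on V p"
  shows "openin (seminorm_topology V {\<lambda>f. ereal (p f)}) U \<longleftrightarrow>
    U \<subseteq> V \<and> (\<forall>f\<in>U. \<exists>e>0. {g \<in> V. p (g - f) < e} \<subseteq> U)"
  by (subst openin_seminorm_topology[OF seminorm_family_singleton[OF p refl]]) simp

lemma openin_seminorm_ball:
  assumes p: "seminorm_on V p" and f: "f \<in> V"
  shows "openin (seminorm_topology V {\<lambda>f. ereal (p f)}) {g \<in> V. p (g - f) < e}"
  unfolding openin_seminorm_topology_single[OF p]
proof (intro conjI ballI)
  fix g assume g: "g \<in> {g \<in> V. p (g - f) < e}"
  have "{h \<in> V. p (h - g) < e - p (g - f)} \<subseteq> {g \<in> V. p (g - f) < e}"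
    using seminorm_on_diff_triangle[OF p _ _ f] g by fastforce
  then show "\<exists>d>0. {h \<in> V. p (h - g) < d} \<subseteq> {g \<in> V. p (g - f) < e}"
    using g by (intro exI[of _ "e - p (g - f)"]) auto
qed auto

text \<open>The inductive limit topology is generated by open sets of \<open>lc_space\<close>
  topologies; this makes the topology of a single seminorm eligible.\<close>

lemma lc_space_seminorm_topology:
  assumes p: "seminorm_on V p"
  shows "lc_space (seminorm_topology V {\<lambda>f. ereal (p f)})" (is "lc_space ?T")
proof -
  note V = seminorm_on_subspace[OF p]
  note op = openin_seminorm_topology_single[OF p]
  note ball = openin_seminorm_ball[OF p]
  note dV = cfun.subspace_diff[OF V] and sV = cfun.subspace_scale[OF V] and aV = cfun.subspace_add[OF V]
  have self: "p (f - f) = 0" for f using seminorm_on_0[OF p] by simp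
  have add: "continuous_map (prod_topology ?T ?T) ?T (\<lambda>(f, g). f + g)"
    unfolding continuous_map_def
  proof (intro conjI allI impI)
    show "(\<lambda>(f, g). f + g) \<in> topspace (prod_topology ?T ?T) \<rightarrow> topspace ?T"
      using aV by auto
    fix U assume U: "openin ?T U"
    show "openin (prod_topology ?T ?T) {x \<in> topspace (prod_topology ?T ?T). (case x of (f, g) \<Rightarrow> f + g) \<in> U}"
      unfolding openin_prod_topology_alt
    proof (intro allI impI)
      fix f g assume "(f, g) \<in> {x \<in> topspace (prod_topology ?T ?T). (case x of (f, g) \<Rightarrow> f + g) \<in> U}"
      then have fg: "f \<in> V" "g \<in> V" "f + g \<in> U" by auto
      then obtain e where e: "e > 0" "{h \<in> V. p (h - (f + g)) < e} \<subseteq> U" using U op by blast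
      have "f' + g' \<in> U" if "f' \<in> V" "g' \<in> V" "p (f' - f) < e / 2" "p (g' - g) < e / 2" for f' g'
      proof -
        have "f' + g' - (f + g) = (f' - f) + (g' - g)" by simp
        then have "p (f' + g' - (f + g)) \<le> p (f' - f) + p (g' - g)"
          using seminorm_on_add[OF p dV[OF that(1) fg(1)] dV[OF that(2) fg(2)]] by (simp only:)
        then show ?thesis using that e aV by auto
      qed
      then show "\<exists>A B. openin ?T A \<and> openin ?T B \<and> f \<in> A \<and> g \<in> B \<and>
          A \<times> B \<subseteq> {x \<in> topspace (prod_topology ?T ?T). (case x of (f, g) \<Rightarrow> f + g) \<in> U}"
        using ball[OF fg(1), of "e / 2"] ball[OF fg(2), of "e / 2"] fg e(1)
        by (intro exI[of _ "{h \<in> V. p (h - f) < e / 2}"] exI[of _ "{h \<in> V. p (h - g) < e / 2}"])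
           (auto simp: seminorm_on_0[OF p])
    qed
  qed
  have scale: "continuous_map (prod_topology euclidean ?T) ?T (\<lambda>(c, f). cscale c f)"
    unfolding continuous_map_def
  proof (intro conjI allI impI)
    show "(\<lambda>(c, f). cscale c f) \<in> topspace (prod_topology euclidean ?T) \<rightarrow> topspace ?T"
      using sV by auto
    fix U assume U: "openin ?T U"
    show "openin (prod_topology euclidean ?T) {x \<in> topspace (prod_topology euclidean ?T). (case x of (c, f) \<Rightarrow> cscale c f) \<in> U}"
      unfolding openin_prod_topology_alt
    proof (intro allI impI)
      fix c f assume "(c, f) \<in> {x \<in> topspace (prod_topology euclidean ?T). (case x of (c, f) \<Rightarrow> cscale c f) \<in> U}"
      then have f: "f \<in> V" "cscale c f \<in> U" by auto
      then obtain e where e: "e > 0" "{h \<in> V. p (h - cscale c f) < e} \<subseteq> U" using U op by blast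
      \<comment> \<open>\<open>d\<close> limits the change of the scalar, measured against
        \<open>p f\<close>, and \<open>d'\<close> below the change of the function, measured against
        scalars of modulus at most \<open>cmod c + d\<close>. Each accounts for half of
        \<open>e\<close>; the \<open>+ 1\<close> covers \<open>p f = 0\<close>.\<close>
      define d where "d = e / (2 * (p f + 1))"
      have pf: "p f \<ge> 0" by (rule seminorm_on_nonneg[OF p f(1)])
      then have d: "d > 0" "d * p f < e / 2" using e(1) by (auto simp: d_def field_simps)
      define d' where "d' = e / (2 * (cmod c + d))"
      have cd: "cmod c + d > 0" using d(1) by (simp add: add_nonneg_pos)
      then have d': "d' > 0" "(cmod c + d) * d' = e / 2" using e(1) by (auto simp: d'_def divide_simps)
      have "cscale c' f' \<in> U" if "f' \<in> V" "dist c c' < d" "p (f' - f) < d'" for c' f'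
      proof -
        have nc: "cmod (c' - c) < d" using that(2) by (simp add: dist_norm norm_minus_commute)
        then have nc': "cmod c' \<le> cmod c + d" using norm_triangle_sub[of c' c] by simp
        have f'f: "f' - f \<in> V" using dV that(1) f(1) .
        have "cscale c' f' - cscale c f = cscale c' (f' - f) + cscale (c' - c) f"
          by (simp add: cscale_def fun_eq_iff algebra_simps)
        then have "p (cscale c' f' - cscale c f) \<le> p (cscale c' (f' - f)) + p (cscale (c' - c) f)"
          using seminorm_on_add[OF p sV[OF f'f] sV[OF f(1)]] by simp
        also have "\<dots> = cmod c' * p (f' - f) + cmod (c' - c) * p f"
          using seminorm_on_cscale[OF p] f'f f(1) by simp
        also have "\<dots> \<le> (cmod c + d) * d' + d * p f"
          using nc nc' that(3) pf cd d(1) seminorm_on_nonneg[OF p f'f] by (intro add_mono mult_mono) auto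
        also have "\<dots> < e" using d d' by simp
        finally show ?thesis using e(2) sV[OF that(1)] by auto
      qed
      then show "\<exists>A B. openin euclidean A \<and> openin ?T B \<and> c \<in> A \<and> f \<in> B \<and>
          A \<times> B \<subseteq> {x \<in> topspace (prod_topology euclidean ?T). (case x of (c, f) \<Rightarrow> cscale c f) \<in> U}"
        using ball[OF f(1), of d'] f d(1) d'(1)
        by (intro exI[of _ "ball c d"] exI[of _ "{h \<in> V. p (h - f) < d'}"])
           (auto simp: seminorm_on_0[OF p])
    qed
  qed
  have convex: "\<exists>W. openin ?T W \<and> 0 \<in> W \<and> cfun_convex W \<and> W \<subseteq> U" if U: "openin ?T U" "0 \<in> U" for U
  proof -
    obtain e where e: "e > 0" "{h \<in> V. p (h - 0) < e} \<subseteq> U" using U op by blast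
    let ?W = "{h \<in> V. p (h - 0) < e}"
    have "cfun_convex ?W"
      unfolding cfun_convex_def
    proof (intro ballI)
      fix f g and t :: real assume f: "f \<in> ?W" and g: "g \<in> ?W" and t: "t \<in> {0..1}"
      have fg: "cscale (of_real (1 - t)) f \<in> V" "cscale (of_real t) g \<in> V" using f g sV by auto
      have "p (cscale (of_real (1 - t)) f + cscale (of_real t) g) \<le> (1 - t) * p f + t * p g"
        using seminorm_on_add[OF p fg] seminorm_on_cscale[OF p] f g t by (auto simp: norm_of_real simp del: of_real_diff)
      also have "\<dots> < e"
      \<comment> \<open>Strictness comes from the term with \<open>g\<close>, which disappears at
        \<open>t = 0\<close>; there it comes from \<open>f\<close>.\<close>
      proof (cases "t = 0")
        case False
        have "(1 - t) * p f \<le> (1 - t) * e" using f t by (intro mult_left_mono) auto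
        moreover have "t * p g < t * e" using g t False by (intro mult_strict_left_mono) auto
        ultimately show ?thesis by (simp add: algebra_simps)
      qed (use f in simp)
      finally show "cscale (of_real (1 - t)) f + cscale (of_real t) g \<in> ?W"
        using aV[OF fg] by simp
    qed
    moreover have "0 \<in> ?W" using cfun.subspace_0[OF V] e(1) seminorm_on_0[OF p] by simp
    ultimately show ?thesis using ball[OF cfun.subspace_0[OF V], of e] e(2) by blast
  qed
  show ?thesis
    unfolding lc_space_def
  proof (intro conjI allI impI add scale)
    show "cfun.subspace (topspace ?T)" using V by simp
    fix U assume "openin ?T U \<and> 0 \<in> U"
    then show "\<exists>W. openin ?T W \<and> 0 \<in> W \<and> cfun_convex W \<and> W \<subseteq> U"
      by (elim conjE) (rule convex)
  qed
qed

section \<open>Continuity and equicontinuity into seminormed spaces; open sets in the limits\<close>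

lemma continuous_map_into_seminorm_topology:
  assumes P: "seminorm_family V P" and F: "F ` topspace X \<subseteq> V"
    and cont: "\<And>q e x. q \<in> P \<Longrightarrow> e > 0 \<Longrightarrow> x \<in> topspace X \<Longrightarrow>
        \<exists>U. openin X U \<and> x \<in> U \<and> (\<forall>y\<in>U. q (F y - F x) < ereal e)"
  shows "continuous_map X (seminorm_topology V P) F"
  unfolding continuous_map_def
proof (intro conjI allI impI)
  show "F \<in> topspace X \<rightarrow> topspace (seminorm_topology V P)" using F by auto
  fix W assume W: "openin (seminorm_topology V P) W"
  show "openin X {x \<in> topspace X. F x \<in> W}"
  proof (subst openin_subopen, intro ballI)
    fix x assume x: "x \<in> {x \<in> topspace X. F x \<in> W}"
    then obtain q e where q: "q \<in> P" "e > 0" "{g \<in> V. q (g - F x) < ereal e} \<subseteq> W"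
      using W openin_seminorm_topology[OF P] by blast
    have "x \<in> topspace X" using x by simp
    from cont[OF q(1,2) this]
    obtain U where U: "openin X U" "x \<in> U" "\<forall>y\<in>U. q (F y - F x) < ereal e"
      by (elim exE conjE)
    have "U \<subseteq> {x \<in> topspace X. F x \<in> W}"
      using U q(3) F openin_subset[OF U(1)] by blast
    then show "\<exists>T. openin X T \<and> x \<in> T \<and> T \<subseteq> {x \<in> topspace X. F x \<in> W}" using U by blast
  qed
qed

text \<open>The estimate is required around every \<open>f\<close> and not only around 0, because
  the topology of \<open>X\<close> is not assumed to be translation invariant. At a general
  \<open>f\<close> it gives continuity of each \<open>h\<close>, at 0 the common
  neighbourhood.\<close>

lemma tvs_equicontinuousI:
  assumes P: "seminorm_family V P" and X: "cfun.subspace (topspace X)"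
    and lin: "\<And>h. h \<in> H \<Longrightarrow> clinear_between (topspace X) V h"
    and equi: "\<And>q e f. q \<in> P \<Longrightarrow> e > 0 \<Longrightarrow> f \<in> topspace X \<Longrightarrow>
        \<exists>U. openin X U \<and> f \<in> U \<and> (\<forall>g\<in>U. \<forall>h\<in>H. q (h g - h f) < ereal e)"
  shows "tvs_equicontinuous X (seminorm_topology V P) H"
  unfolding tvs_equicontinuous_def
proof (intro conjI ballI allI impI)
  fix h assume h: "h \<in> H"
  show "clinear_between (topspace X) (topspace (seminorm_topology V P)) h" using lin[OF h] by simp
  have "h ` topspace X \<subseteq> V" using lin[OF h] by (simp add: clinear_between_def)
  then show "continuous_map X (seminorm_topology V P) h"
  proof (rule continuous_map_into_seminorm_topology[OF P])
    fix q f and e :: real assume "q \<in> P" "e > 0" "f \<in> topspace X"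
    from equi[OF this] obtain U where "openin X U" "f \<in> U" "\<forall>g\<in>U. \<forall>h\<in>H. q (h g - h f) < ereal e"
      by (elim exE conjE)
    then show "\<exists>U. openin X U \<and> f \<in> U \<and> (\<forall>g\<in>U. q (h g - h f) < ereal e)"
      using h by (intro exI[of _ U]) simp
  qed
next
  fix W assume "openin (seminorm_topology V P) W \<and> 0 \<in> W"
  then obtain q e where q: "q \<in> P" "e > 0" "{g \<in> V. q (g - 0) < ereal e} \<subseteq> W"
    using openin_seminorm_topology[OF P] by blast
  obtain U where U: "openin X U" "0 \<in> U" "\<forall>g\<in>U. \<forall>h\<in>H. q (h g - h 0) < ereal e"
    using equi[OF q(1,2) cfun.subspace_0[OF X]] by (elim exE conjE)
  have "h g \<in> W" if h: "h \<in> H" and g: "g \<in> U" for h g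
  proof -
    have "h (cscale 0 0) = cscale 0 (h 0)"
      using lin[OF h] cfun.subspace_0[OF X] unfolding clinear_between_def by blast
    then have "h 0 = 0" by (simp add: cscale_def zero_fun_def)
    moreover have "h g \<in> V" using lin[OF h] g openin_subset[OF U(1)] by (auto simp: clinear_between_def)
    ultimately show ?thesis using q(3) U(3) h g by fastforce
  qed
  then show "\<exists>U. openin X U \<and> 0 \<in> U \<and> (\<forall>h\<in>H. h ` U \<subseteq> W)" using U by blast
qed

text \<open>The topology of \<open>p\<close> is locally convex and makes the inclusions of the steps
  continuous, so it is among the topologies whose supremum is the inductive limit topology.\<close>

lemma openin_inductive_limit_ball:
  assumes p: "seminorm_on V p" and V: "V = (\<Union>n\<in>I. topspace (T n))" and f: "f \<in> V"
    and cont: "\<And>n. n \<in> I \<Longrightarrow> continuous_map (T n) (seminorm_topology V {\<lambda>f. ereal (p f)}) (\<lambda>f. f)"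
  shows "openin (lc_inductive_limit I T) {g \<in> V. p (g - f) < e}"
  unfolding lc_inductive_limit_def Let_def
proof (rule topology_generated_by_Basis, rule insertI2, rule CollectI, intro exI conjI)
  show "lc_space (seminorm_topology V {\<lambda>f. ereal (p f)})" by (rule lc_space_seminorm_topology[OF p])
  show "openin (seminorm_topology V {\<lambda>f. ereal (p f)}) {g \<in> V. p (g - f) < e}"
    by (rule openin_seminorm_ball[OF p f])
qed (use cont V in auto)

lemma openin_projective_limit:
  assumes "m \<in> I" "openin (T m) U"
  shows "openin (projective_limit I T) ((\<Inter>m\<in>I. topspace (T m)) \<inter> U)"
  unfolding projective_limit_def Let_def
  by (rule topology_generated_by_Basis) (use assms in blast)


section \<open>The conjugate weight\<close>

text \<open>A real infimum in place of the exponential of an extended-real conjugate; it is 0 where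
  the conjugate is infinite.\<close>

definition conj_weight :: "(real \<Rightarrow> real) \<Rightarrow> nat \<Rightarrow> nat \<Rightarrow> real" where
  "conj_weight \<omega> m k = (INF r\<in>{1..}. exp (real m * \<omega> r) / r ^ k)"

locale weight =
  fixes \<omega> :: "real \<Rightarrow> real"
  assumes nonquasianalytic: "nonquasianalytic_weight \<omega>"
begin

abbreviation w :: "nat \<Rightarrow> nat \<Rightarrow> real" where "w \<equiv> conj_weight \<omega>"

lemma weight_nonneg: "t \<ge> 0 \<Longrightarrow> 0 \<le> \<omega> t"
  and weight_one: "\<omega> 1 = 0"
  and weight_mono: "0 \<le> s \<Longrightarrow> s \<le> t \<Longrightarrow> \<omega> s \<le> \<omega> t"
  and weight_doubling: "\<exists>K\<ge>1. \<forall>t\<ge>0. \<omega> (2 * t) \<le> K * (1 + \<omega> t)"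
  and weight_log: "\<exists>a b. b > 0 \<and> (\<forall>t\<ge>0. a + b * ln (1 + t) \<le> \<omega> t)"
  and weight_convex: "convex_on UNIV (\<lambda>t. \<omega> (exp t))"
  using nonquasianalytic by (auto simp: nonquasianalytic_weight_def mono_on_def)

lemma weight_mult_bdd_below: "bdd_below ((\<lambda>r. exp (real m * \<omega> r) / r ^ k) ` {1..})"
  by (rule bdd_belowI2[of _ 0]) auto

lemma conj_weight_le: "r \<ge> 1 \<Longrightarrow> w m k \<le> exp (real m * \<omega> r) / r ^ k"
  unfolding conj_weight_def by (rule cINF_lower[OF weight_mult_bdd_below]) auto

lemma conj_weight_greatest:
  "(\<And>r. r \<ge> 1 \<Longrightarrow> c \<le> exp (real m * \<omega> r) / r ^ k) \<Longrightarrow> c \<le> w m k"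
  unfolding conj_weight_def by (rule cINF_greatest) auto

lemma conj_weight_nonneg [simp]: "0 \<le> w m k"
  by (rule conj_weight_greatest) auto

lemma conj_weight_le_1: "w m k \<le> 1"
  using conj_weight_le[of 1 m k] by (simp add: weight_one)

lemma power_mult_conj_weight_le:
  assumes "r \<ge> 0"
  shows "r ^ k * w m k \<le> exp (real m * \<omega> r)"
proof (cases "r \<ge> 1")
  case True
  then show ?thesis using conj_weight_le[OF True, of m k] by (simp add: field_simps)
next
  case False
  have "r ^ k * w m k \<le> 1 * 1"
    by (rule mult_mono) (use False assms conj_weight_le_1 in \<open>auto intro: power_le_one\<close>)
  also have "\<dots> \<le> exp (real m * \<omega> r)"
    using weight_nonneg[OF assms] by simp
  finally show ?thesis by simp
qed

lemma conj_weight_mono: "m \<le> n \<Longrightarrow> w m k \<le> w n k"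
proof (rule conj_weight_greatest)
  fix r :: real assume "m \<le> n" "r \<ge> 1"
  have "w m k \<le> exp (real m * \<omega> r) / r ^ k" by (rule conj_weight_le) fact
  also have "\<dots> \<le> exp (real n * \<omega> r) / r ^ k"
    using \<open>m \<le> n\<close> \<open>r \<ge> 1\<close> weight_nonneg[of r] by (intro divide_right_mono) (auto intro: mult_right_mono)
  finally show "w m k \<le> exp (real n * \<omega> r) / r ^ k" .
qed

text \<open>Test the left infimum at the larger of two radii \<open>r\<close> and \<open>s\<close>:
  there the weight is at most \<open>\<omega> r + \<omega> s\<close>, and the power is at least
  \<open>r ^ a * s ^ b\<close>. The infima over \<open>r\<close> and over \<open>s\<close> are taken
  one after the other.\<close>

lemma conj_weight_add_le: "w m (a + b) \<le> w m a * w m b"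
proof -
  have *: "w m (a + b) \<le> (exp (real m * \<omega> r) / r ^ a) * (exp (real m * \<omega> s) / s ^ b)"
    if r: "r \<ge> 1" and s: "s \<ge> 1" for r s
  proof -
    define t where "t = max r s"
    have t: "t \<ge> r" "t \<ge> s" "t \<ge> 1" using r s by (auto simp: t_def)
    have "w m (a + b) \<le> exp (real m * \<omega> t) / (t ^ a * t ^ b)"
      using conj_weight_le[OF t(3), of m "a + b"] by (simp add: power_add)
    also have "\<dots> \<le> exp (real m * \<omega> t) / (r ^ a * s ^ b)"
      using r s t by (intro divide_left_mono mult_mono power_mono mult_pos_pos) auto
    also have "\<dots> \<le> (exp (real m * \<omega> r) * exp (real m * \<omega> s)) / (r ^ a * s ^ b)"
    proof (rule divide_right_mono)
      have "\<omega> t \<le> \<omega> r + \<omega> s"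
        using weight_nonneg[of r] weight_nonneg[of s] r s by (auto simp: t_def max_def)
      then show "exp (real m * \<omega> t) \<le> exp (real m * \<omega> r) * exp (real m * \<omega> s)"
        by (simp add: mult_left_mono flip: exp_add distrib_left)
    qed (use r s in auto)
    finally show ?thesis by (simp add: field_simps)
  qed
  have **: "w m (a + b) \<le> w m a * (exp (real m * \<omega> s) / s ^ b)" if s: "s \<ge> 1" for s
  proof -
    define c where "c = exp (real m * \<omega> s) / s ^ b"
    have c: "c > 0" using s by (simp add: c_def)
    have "w m (a + b) / c \<le> w m a"
    proof (rule conj_weight_greatest)
      fix r :: real assume r: "r \<ge> 1"
      show "w m (a + b) / c \<le> exp (real m * \<omega> r) / r ^ a"
        using *[OF r s] c unfolding c_def[symmetric] by (simp add: pos_divide_le_eq)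
    qed
    then show ?thesis using c unfolding c_def[symmetric] by (simp add: pos_divide_le_eq)
  qed
  show ?thesis
  proof (cases "w m a = 0")
    case True
    then show ?thesis using **[of 1] by simp
  next
    case False
    then have "w m a > 0" using conj_weight_nonneg[of m a] by linarith
    have "w m (a + b) / w m a \<le> w m b"
    proof (rule conj_weight_greatest)
      fix s :: real assume s: "s \<ge> 1"
      show "w m (a + b) / w m a \<le> exp (real m * \<omega> s) / s ^ b"
        using **[OF s] \<open>w m a > 0\<close> by (simp only: pos_divide_le_eq) (simp add: mult.commute)
    qed
    then show ?thesis using \<open>w m a > 0\<close> by (simp add: field_simps)
  qed
qed

text \<open>Squaring the quotient at a fixed radius doubles both indices. This matches the square
  root in the interpolation of derivatives of orders 0 and \<open>2 * k\<close>.\<close>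

lemma conj_weight_double: "(w m k)\<^sup>2 \<le> w (2 * m) (2 * k)"
proof (rule conj_weight_greatest)
  fix r :: real assume r: "r \<ge> 1"
  have "(w m k)\<^sup>2 \<le> (exp (real m * \<omega> r) / r ^ k)\<^sup>2"
    by (rule power_mono[OF conj_weight_le[OF r]]) simp
  also have "\<dots> = exp (real (2 * m) * \<omega> r) / r ^ (2 * k)"
    by (simp add: power_divide power_mult[symmetric] mult.commute flip: exp_of_nat_mult)
  finally show "(w m k)\<^sup>2 \<le> exp (real (2 * m) * \<omega> r) / r ^ (2 * k)" .
qed

text \<open>Evaluate the infimum at \<open>2 * r\<close> instead of \<open>r\<close>: the power
  gains \<open>2 ^ k\<close>, and condition (\<alpha>) replaces \<open>\<omega> (2 * r)\<close> by a
  multiple \<open>L\<close> of \<open>1 + \<omega> r\<close>. This gives \<open>m' = m * L\<close>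
  and \<open>D = exp (m * L)\<close>.\<close>

lemma conj_weight_absorb_2: "\<exists>m'\<ge>m. \<exists>D>0. \<forall>k. 2 ^ k * w m k \<le> D * w m' k"
proof -
  obtain K where K: "K \<ge> 1" "\<And>t. t \<ge> 0 \<Longrightarrow> \<omega> (2 * t) \<le> K * (1 + \<omega> t)"
    using weight_doubling by blast
  define L where "L = nat \<lceil>K\<rceil>"
  have L: "real L \<ge> K" "L \<ge> 1" using K(1) by (auto simp: L_def) linarith
  have "2 ^ k * w m k \<le> exp (real m * real L) * w (m * L) k" for k
  proof -
    have "2 ^ k * w m k / exp (real m * real L) \<le> w (m * L) k"
    proof (rule conj_weight_greatest)
      fix r :: real assume r: "r \<ge> 1"
      have "\<omega> (2 * r) \<le> real L * (1 + \<omega> r)"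
        using K(2)[of r] L(1) weight_nonneg[of r] r mult_right_mono[of K "real L" "1 + \<omega> r"] by linarith
      then have "exp (real m * \<omega> (2 * r)) \<le> exp (real m * (real L * (1 + \<omega> r)))"
        by (auto intro: mult_left_mono)
      also have "\<dots> = exp (real m * real L) * exp (real (m * L) * \<omega> r)"
        by (simp add: exp_add[symmetric] algebra_simps)
      finally have *: "exp (real m * \<omega> (2 * r)) \<le> exp (real m * real L) * exp (real (m * L) * \<omega> r)" .
      have "w m k \<le> exp (real m * \<omega> (2 * r)) / (2 * r) ^ k"
        using r by (intro conj_weight_le) auto
      also have "\<dots> \<le> exp (real m * real L) * exp (real (m * L) * \<omega> r) / (2 * r) ^ k"
        using * r by (intro divide_right_mono) auto
      finally show "2 ^ k * w m k / exp (real m * real L) \<le> exp (real (m * L) * \<omega> r) / r ^ k"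
        using r by (simp add: field_simps power_mult_distrib)
    qed
    then show ?thesis by (simp add: field_simps)
  qed
  moreover have "m \<le> m * L" using L by simp
  ultimately show ?thesis by (intro exI[of _ "m * L"] conjI exI[of _ "exp (real m * real L)"]) auto
qed

lemma conj_weight_absorb: "\<exists>m'\<ge>m. \<exists>D>0. \<forall>k. C ^ k * w m k \<le> D * w m' k" if "C \<ge> 0"
proof -
  have *: "\<exists>m'\<ge>m. \<exists>D>0. \<forall>k. (2 ^ j) ^ k * w m k \<le> D * w m' k" for j
  proof (induction j)
    case 0
    show ?case by (rule exI[of _ m]) (auto intro: exI[of _ 1])
  next
    case (Suc j)
    then obtain m' D where m': "m' \<ge> m" "D > 0" "\<And>k. (2 ^ j) ^ k * w m k \<le> D * w m' k" by blast
    obtain m'' D' where m'': "m'' \<ge> m'" "D' > 0" "\<And>k. 2 ^ k * w m' k \<le> D' * w m'' k"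
      using conj_weight_absorb_2[of m'] by blast
    have "(2 ^ Suc j) ^ k * w m k \<le> D * D' * w m'' k" for k
    proof -
      have "(2 ^ Suc j) ^ k * w m k = 2 ^ k * ((2 ^ j) ^ k * w m k)"
        by (simp add: power_mult_distrib)
      also have "\<dots> \<le> 2 ^ k * (D * w m' k)" using m'(3)[of k] by simp
      also have "\<dots> = D * (2 ^ k * w m' k)" by simp
      also have "\<dots> \<le> D * (D' * w m'' k)" using m''(3)[of k] m'(2) by simp
      finally show ?thesis by simp
    qed
    then show ?case using m' m'' by (intro exI[of _ m''] conjI exI[of _ "D * D'"]) auto
  qed
  obtain j :: nat where j: "C < 2 ^ j" using real_arch_pow[of 2 C] by auto
  obtain m' D where m': "m' \<ge> m" "D > 0" "\<And>k. (2 ^ j) ^ k * w m k \<le> D * w m' k" using * by blast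
  have "C ^ k * w m k \<le> D * w m' k" for k
    using mult_right_mono[OF power_mono[of C "2 ^ j" k], of "w m k"] j that m'(3)[of k] by simp
  then show ?thesis using m' by blast
qed

text \<open>By (\<gamma>), once \<open>m * b \<ge> k\<close> the numerator outgrows
  \<open>r ^ k\<close>. The required \<open>m\<close> depends on \<open>k\<close>, since the
  conjugate may be infinite for smaller \<open>m\<close>.\<close>

lemma conj_weight_pos: "\<exists>m\<ge>1. w m k > 0"
proof -
  obtain a b where b: "b > 0" "\<And>t. t \<ge> 0 \<Longrightarrow> a + b * ln (1 + t) \<le> \<omega> t"
    using weight_log by blast
  obtain m0 :: nat where "real m0 * b > real k" using reals_Archimedean3[OF b(1)] by blast
  then obtain m :: nat where m: "real m * b \<ge> real k" "m \<ge> 1"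
    using b(1) that[of "Suc m0"] by (auto simp: algebra_simps)
  have "exp (real m * a) \<le> w m k"
  proof (rule conj_weight_greatest)
    fix r :: real assume r: "r \<ge> 1"
    have "real k * ln r \<le> real m * b * ln (1 + r)"
      using m(1) r b(1) by (intro mult_mono) auto
    also have "\<dots> \<le> real m * (\<omega> r - a)"
      using b(2)[of r] r m(2) mult_left_mono[of "b * ln (1 + r)" "\<omega> r - a" "real m"] by (simp add: algebra_simps)
    finally have "exp (real m * a) * exp (real k * ln r) \<le> exp (real m * \<omega> r)"
      by (simp add: exp_add[symmetric] algebra_simps)
    moreover have "exp (real k * ln r) = r ^ k" using r by (simp add: exp_of_nat_mult)
    ultimately show "exp (real m * a) \<le> exp (real m * \<omega> r) / r ^ k" using r by (simp add: field_simps)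
  qed
  then show ?thesis using m(2) by (intro exI[of _ m]) (auto intro: less_le_trans[of 0 "exp (real m * a)"])
qed

text \<open>The form of (\<gamma>) by which polynomial factors, needed for integrability, are paid
  for with a larger weight index.\<close>

lemma power_le_exp_weight: "\<exists>n\<ge>1. \<exists>C>0. \<forall>t\<ge>0. (1 + t) ^ k \<le> C * exp (real n * \<omega> t)"
proof -
  obtain a b where b: "b > 0" "\<And>t. t \<ge> 0 \<Longrightarrow> a + b * ln (1 + t) \<le> \<omega> t"
    using weight_log by blast
  obtain m0 :: nat where "real m0 * b > real k" using reals_Archimedean3[OF b(1)] by blast
  then obtain m :: nat where m: "real m * b \<ge> real k" "m \<ge> 1"
    using b(1) that[of "Suc m0"] by (auto simp: algebra_simps)
  have "(1 + t) ^ k \<le> exp (- real m * a) * exp (real m * \<omega> t)" if t: "t \<ge> 0" for t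
  proof -
    have "(1 + t) ^ k = exp (real k * ln (1 + t))" using t by (simp add: exp_of_nat_mult)
    also have "real k * ln (1 + t) \<le> real m * b * ln (1 + t)" using m t by (intro mult_right_mono) auto
    also have "\<dots> \<le> real m * (\<omega> t - a)"
      using b(2)[OF t] mult_left_mono[of "b * ln (1 + t)" "\<omega> t - a" "real m"] by (simp add: algebra_simps)
    finally show ?thesis by (simp add: exp_add[symmetric] algebra_simps)
  qed
  then show ?thesis using m by (intro exI[of _ m] conjI exI[of _ "exp (- real m * a)"]) auto
qed

text \<open>The supporting line of \<open>t \<mapsto> \<omega> (exp t)\<close> at \<open>ln R\<close> yields the exponent \<open>k\<close>; the factor
  \<open>R\<close> pays for rounding it to an integer.\<close>

lemma exp_weight_le_conj_weight:
  assumes R: "R \<ge> 1"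
  shows "\<exists>k. exp (real m * \<omega> R) \<le> R * (R ^ k * w m k)"
proof -
  \<comment> \<open>The right derivative of the convex function at \<open>ln R\<close>, hence the
    slope of a supporting line. Evaluating that line one unit further left and using monotonicity
    shows \<open>s \<ge> 0\<close>.\<close>
  define s where "s = Inf ((\<lambda>t. (\<omega> (exp (ln R)) - \<omega> (exp t)) / (ln R - t)) ` ({ln R<..} \<inter> UNIV))"
  have s: "\<omega> (exp y) \<ge> \<omega> (exp (ln R)) + s * (y - ln R)" for y
    unfolding s_def by (rule convex_le_Inf_differential[OF weight_convex]) auto
  have "\<omega> (exp (ln R - 1)) \<le> \<omega> (exp (ln R))" by (rule weight_mono) auto
  with s[of "ln R - 1"] have "s \<ge> 0" by simp
  have supp: "\<omega> r \<ge> \<omega> R + s * ln (r / R)" if "r \<ge> 1" for r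
    using s[of "ln r"] R that by (simp add: ln_div)
  define k where "k = nat \<lfloor>real m * s\<rfloor>"
  define d where "d = real m * s - real k"
  have d: "0 \<le> d" "d \<le> 1" using \<open>s \<ge> 0\<close> unfolding d_def k_def by (auto simp: of_nat_nat) linarith
  have "exp (real m * \<omega> R) / (R * R ^ k) \<le> w m k"
  proof (rule conj_weight_greatest)
    fix r :: real assume r: "r \<ge> 1"
    have "real m * \<omega> R + (real k + d) * ln (r / R) \<le> real m * \<omega> r"
      using mult_left_mono[OF supp[OF r], of "real m"] by (simp add: d_def algebra_simps)
    moreover have "- ln R \<le> d * ln (r / R)"
    proof -
      have "d * ln R \<le> 1 * ln R" using d R by (intro mult_right_mono) auto
      moreover have "0 \<le> d * ln r" using d r by simp
      ultimately show ?thesis using R r by (simp add: ln_div algebra_simps)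
    qed
    ultimately have "real m * \<omega> R + real k * ln r \<le> real m * \<omega> r + ln R + real k * ln R"
      using R r by (simp add: ln_div algebra_simps)
    then have "exp (real m * \<omega> R) * exp (real k * ln r) \<le> exp (real m * \<omega> r) * exp (ln R) * exp (real k * ln R)"
      by (simp add: exp_add[symmetric])
    then have "exp (real m * \<omega> R) * r ^ k \<le> exp (real m * \<omega> r) * (R * R ^ k)"
      using R r by (simp add: exp_of_nat_mult)
    then show "exp (real m * \<omega> R) / (R * R ^ k) \<le> exp (real m * \<omega> r) / r ^ k"
      using R r by (simp add: field_simps)
  qed
  then have "exp (real m * \<omega> R) \<le> R * (R ^ k * w m k)" using R by (simp add: field_simps)
  then show ?thesis by blast
qed

text \<open>The substitution \<open>r = exp t\<close> turns the supremum into the infimum. If the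
  conjugate is infinite, \<open>ge\<close> excludes \<open>w m k > 0\<close>; the value minus
  infinity is excluded by \<open>t = 0\<close>.\<close>

lemma exp_ereal_young_conj:
  assumes m: "m \<ge> 1"
  shows "exp_ereal (- (ereal (real m) * young_conj \<omega> (real k / real m))) = ereal (w m k)"
proof -
  have eq: "exp (real m * \<omega> (exp t)) / exp t ^ k = exp (- real m * (real k / real m * t - \<omega> (exp t)))" for t
  proof -
    have "exp t ^ k = exp (real k * t)" by (simp add: exp_of_nat_mult)
    then show ?thesis using m by (simp add: exp_diff[symmetric] algebra_simps)
  qed
  have le: "ereal (real k / real m * t - \<omega> (exp t)) \<le> young_conj \<omega> (real k / real m)" if "t \<ge> 0" for t
    unfolding young_conj_def using that by (intro SUP_upper) auto
  have w_le: "w m k \<le> exp (- real m * (real k / real m * t - \<omega> (exp t)))" if "t \<ge> 0" for t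
    using conj_weight_le[of "exp t" m k] that by (simp only: eq) auto
  have ge: "young_conj \<omega> (real k / real m) \<le> ereal (- ln (w m k) / real m)" if "w m k > 0"
    unfolding young_conj_def
  proof (rule SUP_least)
    fix t :: real assume "t \<in> {0..}"
    then have "ln (w m k) \<le> ln (exp (- real m * (real k / real m * t - \<omega> (exp t))))"
      using w_le[of t] that by (subst ln_le_cancel_iff) auto
    then have "ln (w m k) \<le> - real m * (real k / real m * t - \<omega> (exp t))"
      by simp
    then show "ereal (real k / real m * t - \<omega> (exp t)) \<le> ereal (- ln (w m k) / real m)"
      using m by (simp add: field_simps)
  qed
  show ?thesis
  proof (cases "young_conj \<omega> (real k / real m)")
    case (real y)
    have "exp (- real m * y) \<le> w m k"
    proof (rule conj_weight_greatest)
      fix r :: real assume r: "r \<ge> 1"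
      then have "real k / real m * ln r - \<omega> r \<le> y" using le[of "ln r"] real by simp
      then have "exp (- real m * y) \<le> exp (- real m * (real k / real m * ln r - \<omega> (exp (ln r))))"
        using r m by simp
      then show "exp (- real m * y) \<le> exp (real m * \<omega> r) / r ^ k" unfolding eq[symmetric] using r by simp
    qed
    moreover from this have "w m k > 0" by (rule less_le_trans[rotated]) simp
    then have "y \<le> - ln (w m k) / real m" using ge real by simp
    then have "ln (w m k) \<le> - real m * y" using m by (simp add: field_simps)
    then have "w m k \<le> exp (- real m * y)" using \<open>w m k > 0\<close> by (metis exp_le_cancel_iff exp_ln)
    ultimately show ?thesis by (simp add: real exp_ereal_def)
  next
    case PInf
    then have "\<not> w m k > 0" using ge by force
    then have "w m k = 0" using conj_weight_nonneg[of m k] by linarith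
    then show ?thesis using m by (simp add: PInf exp_ereal_def)
  next
    case MInf
    then show ?thesis using le[of 0] by simp
  qed
qed

end


section \<open>A Landau-Kolmogorov inequality on the half-line\<close>

text \<open>Multiplication by \<open>[:- a, 1:]\<close> adds a shifted copy of the coefficients to a
  copy scaled by at most 1, so each factor at most doubles the bound.\<close>

lemma coeff_prod_monic_linear_le:
  fixes a :: "'i \<Rightarrow> real"
  assumes "finite S" "\<And>l. l \<in> S \<Longrightarrow> \<bar>a l\<bar> \<le> 1"
  shows "\<bar>coeff (\<Prod>l\<in>S. [:- a l, 1:]) j\<bar> \<le> 2 ^ card S"
  using assms
proof (induction S arbitrary: j rule: finite_induct)
  case empty
  then show ?case by (cases j) (auto simp: coeff_pCons)
next
  case (insert x S)
  let ?p = "\<Prod>l\<in>S. [:- a l, 1:]"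
  have IH: "\<bar>coeff ?p i\<bar> \<le> 2 ^ card S" for i using insert by auto
  have "\<bar>coeff (\<Prod>l\<in>insert x S. [:- a l, 1:]) j\<bar> = \<bar>- a x * coeff ?p j + coeff (pCons 0 ?p) j\<bar>"
    using insert by simp
  also have "\<dots> \<le> \<bar>a x\<bar> * \<bar>coeff ?p j\<bar> + \<bar>coeff (pCons 0 ?p) j\<bar>"
    by (rule order_trans[OF abs_triangle_ineq]) (simp add: abs_mult)
  also have "\<dots> \<le> 1 * 2 ^ card S + 2 ^ card S"
  proof (intro add_mono mult_mono)
    show "\<bar>coeff (pCons 0 ?p) j\<bar> \<le> 2 ^ card S" using IH by (cases j) auto
  qed (use insert IH in auto)
  finally show ?case using insert by simp
qed

lemma power_self_le_exp_fact: "real d ^ d \<le> exp (real d) * fact d"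
proof -
  have "(\<Sum>n\<in>{d}. inverse (fact n) *\<^sub>R real d ^ n) \<le> exp (real d)"
    unfolding exp_def by (rule sum_le_suminf[OF summable_exp_generic]) auto
  then show ?thesis by (simp add: field_simps)
qed

lemma prod_node_differences:
  assumes "i \<le> d"
  shows "\<bar>\<Prod>l\<in>{..d} - {i}. (real i - real l)\<bar> = fact i * fact (d - i)"
proof -
  have split: "{..d} - {i} = {..<i} \<union> {i<..d}" using assms by auto
  have "\<bar>\<Prod>l\<in>{..<i} \<union> {i<..d}. (real i - real l)\<bar>
      = (\<Prod>l\<in>{..<i}. \<bar>real i - real l\<bar>) * (\<Prod>l\<in>{i<..d}. \<bar>real i - real l\<bar>)"
    by (subst prod.union_disjoint) (auto simp: abs_mult abs_prod)
  also have "(\<Prod>l\<in>{..<i}. \<bar>real i - real l\<bar>) = fact i"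
  proof -
    have "(\<Prod>l\<in>{..<i}. \<bar>real i - real l\<bar>) = (\<Prod>j\<in>{1..i}. real j)"
      by (rule prod.reindex_bij_witness[of _ "\<lambda>j. i - j" "\<lambda>l. i - l"]) auto
    then show ?thesis by (simp add: fact_prod)
  qed
  also have "(\<Prod>l\<in>{i<..d}. \<bar>real i - real l\<bar>) = fact (d - i)"
  proof -
    have "(\<Prod>l\<in>{i<..d}. \<bar>real i - real l\<bar>) = (\<Prod>j\<in>{1..d - i}. real j)"
      by (rule prod.reindex_bij_witness[of _ "\<lambda>j. i + j" "\<lambda>l. l - i"]) auto
    then show ?thesis by (simp add: fact_prod)
  qed
  finally show ?thesis by (simp add: split)
qed

text \<open>Lagrange interpolation at the nodes \<open>i / d\<close>.\<close>

lemma coeff_le_of_bounded_on_unit_interval: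
  fixes p :: "real poly"
  assumes d: "d \<ge> 1" "degree p \<le> d" and M: "\<And>x. 0 \<le> x \<Longrightarrow> x \<le> 1 \<Longrightarrow> \<bar>poly p x\<bar> \<le> M"
  shows "\<bar>coeff p j\<bar> \<le> (4 * exp 1) ^ d * M"
proof -
  have M0: "M \<ge> 0" using M[of 0] by simp
  define t where "t i = real i / real d" for i
  define N where "N i = (\<Prod>l\<in>{..d} - {i}. [:- t l, 1:])" for i
  define e where "e i = (\<Prod>l\<in>{..d} - {i}. (t i - t l))" for i
  define L where "L = (\<Sum>i\<le>d. smult (poly p (t i) / e i) (N i))"
  have e: "\<bar>e i\<bar> = fact i * fact (d - i) / real d ^ d" if "i \<le> d" for i
  proof -
    have "e i = (\<Prod>l\<in>{..d} - {i}. (real i - real l) / real d)"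
      by (simp add: e_def t_def diff_divide_distrib)
    also have "\<dots> = (\<Prod>l\<in>{..d} - {i}. (real i - real l)) / real d ^ d"
      using that by (simp add: prod_dividef)
    finally show ?thesis using prod_node_differences[OF that] by (simp add: abs_div)
  qed
  have e0: "e i \<noteq> 0" if "i \<le> d" for i
  proof -
    have "\<bar>e i\<bar> > 0" unfolding e[OF that] using d by simp
    then show ?thesis by simp
  qed
  have polyN: "poly (N i) (t k) = (if i = k then e k else 0)" if "i \<le> d" "k \<le> d" for i k
  proof (cases "i = k")
    case True
    then show ?thesis by (simp add: N_def e_def poly_prod)
  next
    case False
    then have "poly (N i) (t k) = 0"
      unfolding N_def poly_prod using that by (intro prod_zero) (auto intro!: bexI[of _ k])
    then show ?thesis using False by simp
  qed
  have degN: "degree (N i) \<le> d" if "i \<le> d" for i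
    unfolding N_def using degree_prod_sum_le[of "{..d} - {i}" "\<lambda>l. [:- t l, 1:]"] that by simp
  \<comment> \<open>A nonzero difference would have degree at most \<open>d\<close> but vanish at
    the \<open>d + 1\<close> distinct nodes.\<close>
  have "p - L = 0"
  proof (rule ccontr)
    assume nz: "p - L \<noteq> 0"
    have "degree L \<le> d"
      unfolding L_def by (rule degree_sum_le) (use degN degree_smult_le order_trans in blast)+
    then have deg: "degree (p - L) \<le> d" using d degree_diff_le by blast
    have root: "poly (p - L) (t k) = 0" if "k \<le> d" for k
    proof -
      have "poly L (t k) = (\<Sum>i\<le>d. if i = k then poly p (t k) else 0)"
        unfolding L_def poly_sum by (rule sum.cong) (use polyN e0 that in auto)
      then show ?thesis using that by simp
    qed
    have "card (t ` {..d}) = Suc d"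
      using d by (subst card_image) (auto simp: inj_on_def t_def)
    moreover have "card (t ` {..d}) \<le> card {x. poly (p - L) x = 0}"
      using root by (intro card_mono poly_roots_finite nz) auto
    ultimately show False using card_poly_roots_bound[OF nz] deg by linarith
  qed
  then have "p = L" by simp
  then have "coeff p j = coeff L j" by simp
  also have "\<dots> = (\<Sum>i\<le>d. poly p (t i) / e i * coeff (N i) j)"
    by (simp add: L_def coeff_sum)
  finally have "\<bar>coeff p j\<bar> = \<bar>\<Sum>i\<le>d. poly p (t i) / e i * coeff (N i) j\<bar>" by simp
  \<comment> \<open>Origin of \<open>(4 * exp 1) ^ d\<close>: one \<open>2 ^ d\<close> bounds the
    coefficients of \<open>N i\<close>, the other is the row sum of the binomial coefficients in
    \<open>1 / \<bar>e i\<bar>\<close>, and \<open>real d ^ d / fact d\<close> is at most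
    \<open>exp d\<close>.\<close>
  also have "\<dots> \<le> (\<Sum>i\<le>d. M * (real d ^ d / fact d) * real (d choose i) * 2 ^ d)"
  proof (rule order_trans[OF sum_abs sum_mono])
    fix i assume "i \<in> {..d}"
    then have i: "i \<le> d" by simp
    have "\<bar>coeff (N i) j\<bar> \<le> 2 ^ card ({..d} - {i})"
      unfolding N_def using i d by (intro coeff_prod_monic_linear_le) (auto simp: t_def divide_le_eq)
    also have "card ({..d} - {i}) = d" using i by simp
    finally have cN: "\<bar>coeff (N i) j\<bar> \<le> 2 ^ d" .
    have ti: "0 \<le> t i" "t i \<le> 1" using i d by (auto simp: t_def)
    have "\<bar>poly p (t i) / e i * coeff (N i) j\<bar> = \<bar>poly p (t i)\<bar> * (1 / \<bar>e i\<bar>) * \<bar>coeff (N i) j\<bar>"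
      by (simp add: abs_mult abs_div)
    also have "\<dots> \<le> M * (1 / \<bar>e i\<bar>) * 2 ^ d"
      by (intro mult_mono M ti cN) (use M0 in auto)
    also have "1 / \<bar>e i\<bar> = real d ^ d / fact d * real (d choose i)"
      using d i by (simp add: e binomial_fact field_simps)
    finally show "\<bar>poly p (t i) / e i * coeff (N i) j\<bar> \<le> M * (real d ^ d / fact d) * real (d choose i) * 2 ^ d"
      by (simp add: mult_ac)
  qed
  also have "\<dots> = M * (real d ^ d / fact d) * real (\<Sum>i\<le>d. d choose i) * 2 ^ d"
    by (simp only: sum_distrib_left sum_distrib_right of_nat_sum)
  also have "\<dots> = M * (real d ^ d / fact d) * 4 ^ d"
  proof -
    have "(4::real) ^ d = 2 ^ d * 2 ^ d" by (simp add: power_mult_distrib[symmetric])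
    then show ?thesis by (simp add: choose_row_sum)
  qed
  also have "\<dots> \<le> M * exp (real d) * 4 ^ d"
    using power_self_le_exp_fact[of d] M0 by (intro mult_right_mono mult_left_mono) (auto simp: divide_le_eq)
  also have "\<dots> = (4 * exp 1) ^ d * M"
    by (simp add: power_mult_distrib exp_of_nat_mult[symmetric])
  finally show ?thesis .
qed

lemma fact_mult_self_le: "(fact k * fact k :: real) \<le> fact (2 * k)"
proof -
  have "(fact k * fact k :: nat) dvd fact (k + k)" by (rule fact_fact_dvd_fact)
  then have "(fact k * fact k :: nat) \<le> fact (2 * k)" by (simp add: dvd_imp_le mult_2)
  then have "real (fact k * fact k) \<le> real (fact (2 * k))" by (rule of_nat_mono)
  then show ?thesis by simp
qed

text \<open>The Taylor polynomial of \<open>f 0\<close> of degree below \<open>2 * k\<close>,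
  rescaled from an interval of length \<delta> to the unit interval, is bounded by \<open>A\<close>
  plus the remainder. The coefficient estimate then bounds its \<open>k\<close>-th coefficient,
  which is \<open>f k 0\<close> up to explicit factors. The factorials cancel, leaving a constant
  that is geometric in \<open>k\<close>.\<close>

theorem Landau_Kolmogorov_halfline:
  fixes f :: "nat \<Rightarrow> real \<Rightarrow> real"
  assumes f: "\<And>j t. (f j has_real_derivative f (Suc j) t) (at t)"
    and A: "A > 0" "\<And>t. t \<ge> 0 \<Longrightarrow> \<bar>f 0 t\<bar> \<le> A"
    and B: "B > 0" "\<And>t. t \<ge> 0 \<Longrightarrow> \<bar>f (2 * k) t\<bar> \<le> B"
  shows "\<bar>f k 0\<bar> \<le> 2 * (4 * exp 1) ^ (2 * k) * sqrt (A * B)"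
proof (cases "k = 0")
  case True
  have "\<bar>f 0 0\<bar> \<le> A" "\<bar>f 0 0\<bar> \<le> B" using A(2)[of 0] B(2)[of 0] True by auto
  then have "sqrt (\<bar>f 0 0\<bar> * \<bar>f 0 0\<bar>) \<le> sqrt (A * B)"
    using A(1) by (intro real_sqrt_le_mono mult_mono) auto
  then have "\<bar>f 0 0\<bar> \<le> sqrt (A * B)" by simp
  then show ?thesis using True A(1) B(1) by simp
next
  case False
  \<comment> \<open>Chosen so that for \<open>\<delta> ^ k = y\<close> the bound
    \<open>B * \<delta> ^ (2 * k) / fact (2 * k)\<close> of the remainder equals
    \<open>A\<close>.\<close>
  define y where "y = sqrt (A * fact (2 * k) / B)"
  have y: "y > 0" "y\<^sup>2 = A * fact (2 * k) / B" using A(1) B(1) by (auto simp: y_def)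
  define \<delta> where "\<delta> = root k y"
  have \<delta>: "\<delta> > 0" "\<delta> ^ k = y" using False y by (auto simp: \<delta>_def real_root_pow_pos)
  then have \<delta>2: "\<delta> ^ (2 * k) = A * fact (2 * k) / B" using y(2) by (metis mult.commute power_mult)
  define p where "p = (\<Sum>j<2 * k. monom (f j 0 / fact j * \<delta> ^ j) j)"
  have coeff_p: "coeff p j = (if j < 2 * k then f j 0 / fact j * \<delta> ^ j else 0)" for j
    by (simp add: p_def coeff_sum)
  have "\<bar>coeff p k\<bar> \<le> (4 * exp 1) ^ (2 * k) * (2 * A)"
  proof (rule coeff_le_of_bounded_on_unit_interval)
    show "1 \<le> 2 * k" using False by simp
    show "degree p \<le> 2 * k" by (rule degree_le) (simp add: coeff_p)
    fix x :: real assume x: "0 \<le> x" "x \<le> 1"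
    show "\<bar>poly p x\<bar> \<le> 2 * A"
    proof (cases "x = 0")
      case True
      have "\<bar>poly p x\<bar> = \<bar>f 0 0\<bar>" using False unfolding True poly_0_coeff_0 coeff_p by simp
      then show ?thesis using A(1) A(2)[of 0] by simp
    next
      case nz: False
      then have "\<exists>t. 0 < t \<and> t < \<delta> * x \<and>
          f 0 (\<delta> * x) = (\<Sum>m<2 * k. f m 0 / fact m * (\<delta> * x) ^ m) + f (2 * k) t / fact (2 * k) * (\<delta> * x) ^ (2 * k)"
        using False x \<delta>(1) f by (intro Maclaurin) auto
      then obtain t where t: "0 < t"
          "f 0 (\<delta> * x) = (\<Sum>m<2 * k. f m 0 / fact m * (\<delta> * x) ^ m) + f (2 * k) t / fact (2 * k) * (\<delta> * x) ^ (2 * k)"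
        by blast
      have "poly p x = (\<Sum>m<2 * k. f m 0 / fact m * (\<delta> * x) ^ m)"
        by (simp add: p_def poly_sum poly_monom power_mult_distrib mult_ac)
      with t(2) have "poly p x = f 0 (\<delta> * x) - f (2 * k) t * (\<delta> * x) ^ (2 * k) / fact (2 * k)" by simp
      also have "\<bar>\<dots>\<bar> \<le> \<bar>f 0 (\<delta> * x)\<bar> + \<bar>f (2 * k) t\<bar> * (\<delta> * x) ^ (2 * k) / fact (2 * k)"
        by (rule order_trans[OF abs_triangle_ineq4]) (simp add: abs_mult abs_div)
      also have "\<dots> \<le> A + B * \<delta> ^ (2 * k) / fact (2 * k)"
        using A B t(1) \<delta>(1) x
        by (intro add_mono divide_right_mono mult_mono power_mono) (auto intro: mult_left_le)
      also have "\<dots> = 2 * A" using B(1) by (simp add: \<delta>2)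
      finally show ?thesis .
    qed
  qed
  then have "\<bar>f k 0\<bar> * y / fact k \<le> (4 * exp 1) ^ (2 * k) * (2 * A)"
    using False \<delta> y by (simp add: coeff_p abs_mult abs_div)
  then have "\<bar>f k 0\<bar> \<le> 2 * (4 * exp 1) ^ (2 * k) * (A * fact k / y)"
    using y by (simp add: field_simps)
  also have "A * fact k / y \<le> sqrt (A * B)"
  proof -
    \<comment> \<open>This is where the factorials cancel: \<open>fact k\<close> from the Taylor
      coefficient is at most the square root of \<open>fact (2 * k)\<close> contained in
      \<open>y\<close>.\<close>
    have "(A * fact k)\<^sup>2 \<le> A\<^sup>2 * fact (2 * k)"
      using fact_mult_self_le[of k] A(1) by (simp add: power_mult_distrib power2_eq_square)
    also have "\<dots> = (sqrt (A * B) * y)\<^sup>2"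
      unfolding power_mult_distrib y(2) using A(1) B(1) by (simp add: power2_eq_square)
    finally have "A * fact k \<le> sqrt (A * B) * y"
      using A(1) B(1) y by (simp add: power2_le_iff_abs_le)
    then show ?thesis using y by (simp add: divide_le_eq)
  qed
  finally show ?thesis using mult_left_mono by fastforce
qed


section \<open>Smooth functions and mixed derivatives\<close>

text \<open>As simp rules these make the simplifier eta-expand sums and products of functions.\<close>

declare plus_fun_apply [simp del] times_fun_apply [simp del]

lemma pderiv_dir_has_derivative:
  "(f has_derivative f') (at x) \<Longrightarrow> pderiv_dir i f x = f' (axis i 1)"
  by (metis frechet_derivative_at pderiv_dir_def)

lemma pderiv_dir_const [simp]: "pderiv_dir i (\<lambda>x. c) = (\<lambda>x. 0)"
  by (rule ext) (rule pderiv_dir_has_derivative[OF has_derivative_const])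

lemma pderiv_dir_add:
  assumes "\<And>x. f differentiable at x" "\<And>x. g differentiable at x"
  shows "pderiv_dir i (f + g) = pderiv_dir i f + pderiv_dir i g"
proof
  fix x
  have "((\<lambda>x. f x + g x) has_derivative
      (\<lambda>h. frechet_derivative f (at x) h + frechet_derivative g (at x) h)) (at x)"
    using assms by (intro has_derivative_add) (auto simp: frechet_derivative_works[symmetric])
  from pderiv_dir_has_derivative[OF this, of i]
  show "pderiv_dir i (f + g) x = (pderiv_dir i f + pderiv_dir i g) x"
    unfolding plus_fun_def by (simp add: pderiv_dir_def)
qed

lemma pderiv_dir_mult:
  assumes "\<And>x. f differentiable at x" "\<And>x. g differentiable at x"
  shows "pderiv_dir i (f * g) = pderiv_dir i f * g + f * pderiv_dir i g"
proof
  fix x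
  have "((\<lambda>x. f x * g x) has_derivative
      (\<lambda>h. f x * frechet_derivative g (at x) h + frechet_derivative f (at x) h * g x)) (at x)"
    using assms by (intro has_derivative_mult) (auto simp: frechet_derivative_works[symmetric])
  from pderiv_dir_has_derivative[OF this, of i]
  show "pderiv_dir i (f * g) x = (pderiv_dir i f * g + f * pderiv_dir i g) x"
    unfolding plus_fun_def times_fun_def by (simp add: pderiv_dir_def add.commute)
qed

lemma differentiable_plus_fun:
  "f differentiable F \<Longrightarrow> g differentiable F \<Longrightarrow> (f + g) differentiable F"
  unfolding plus_fun_def by (rule differentiable_add)

lemma differentiable_times_fun:
  fixes f g :: "'a::real_normed_vector \<Rightarrow> complex"
  shows "f differentiable (at x) \<Longrightarrow> g differentiable (at x) \<Longrightarrow> (f * g) differentiable (at x)"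
  unfolding times_fun_def by (rule differentiable_mult)

lemma times_cont_diff_continuous: "times_cont_diff k f \<Longrightarrow> continuous_on UNIV f"
proof (cases k)
  case (Suc l)
  assume "times_cont_diff k f"
  then have "\<forall>x. f differentiable at x" using Suc by simp
  then show ?thesis
    using continuous_at_imp_continuous_on differentiable_imp_continuous_within by blast
qed simp

lemma times_cont_diff_Suc_imp: "times_cont_diff (Suc k) f \<Longrightarrow> times_cont_diff k f"
proof (induction k arbitrary: f)
  case 0
  from times_cont_diff_continuous[OF 0] show ?case by simp
next
  case (Suc k)
  then show ?case by (metis times_cont_diff.simps(2))
qed

lemma times_cont_diff_const [simp]: "times_cont_diff k (\<lambda>x. c)"
  by (induction k arbitrary: c) auto

lemma times_cont_diff_add:
  "times_cont_diff k f \<Longrightarrow> times_cont_diff k g \<Longrightarrow> times_cont_diff k (f + g)"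
proof (induction k arbitrary: f g)
  case 0
  then show ?case by (simp add: plus_fun_def continuous_on_add)
next
  case (Suc k)
  then show ?case by (simp add: differentiable_plus_fun pderiv_dir_add)
qed

lemma times_cont_diff_mult:
  "times_cont_diff k f \<Longrightarrow> times_cont_diff k g \<Longrightarrow> times_cont_diff k (f * g)"
proof (induction k arbitrary: f g)
  case 0
  then show ?case by (simp add: times_fun_def continuous_on_mult)
next
  case (Suc k)
  have "times_cont_diff k f" "times_cont_diff k g" using Suc.prems times_cont_diff_Suc_imp by auto
  then show ?case
    using Suc by (auto simp: pderiv_dir_mult intro!: differentiable_times_fun times_cont_diff_add)
qed

lemma smooth_differentiable: "smooth f \<Longrightarrow> f differentiable at x"
  unfolding smooth_def by (metis times_cont_diff.simps(2))

lemma smooth_pderiv_dir: "smooth f \<Longrightarrow> smooth (pderiv_dir i f)"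
  unfolding smooth_def by (metis times_cont_diff.simps(2))

lemma smooth_continuous: "smooth f \<Longrightarrow> continuous_on UNIV f"
  unfolding smooth_def by (metis times_cont_diff.simps(1))

lemma smooth_borel_measurable: "smooth f \<Longrightarrow> f \<in> borel_measurable borel"
  by (intro borel_measurable_continuous_onI smooth_continuous)

lemma smooth_const [simp]: "smooth (\<lambda>x. c)"
  by (simp add: smooth_def)

lemma smooth_add: "smooth f \<Longrightarrow> smooth g \<Longrightarrow> smooth (f + g)"
  by (simp add: smooth_def times_cont_diff_add)

lemma smooth_mult: "smooth f \<Longrightarrow> smooth g \<Longrightarrow> smooth (f * g)"
  by (simp add: smooth_def times_cont_diff_mult)

lemma cscale_eq_mult: "cscale c f = (\<lambda>x. c) * f"
  by (simp add: cscale_def times_fun_def)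

lemma smooth_cscale: "smooth f \<Longrightarrow> smooth (cscale c f)"
  by (simp add: cscale_eq_mult smooth_mult)

lemma pderiv_dir_cscale:
  assumes "smooth f"
  shows "pderiv_dir i (cscale c f) = cscale c (pderiv_dir i f)"
  unfolding cscale_eq_mult
  by (subst pderiv_dir_mult) (use assms in \<open>auto simp: smooth_differentiable fun_eq_iff times_fun_apply plus_fun_apply\<close>)

text \<open>A list argument in place of the fixed \<open>coords\<close>, so that statements about
  \<open>mderiv\<close> can be proved by induction over suffixes of the enumeration.\<close>

definition mderiv_along :: "'n::finite list \<Rightarrow> ('n \<Rightarrow> nat) \<Rightarrow> (real ^ 'n \<Rightarrow> complex) \<Rightarrow> real ^ 'n \<Rightarrow> complex" where
  "mderiv_along is \<alpha> f = foldr (\<lambda>i. pderiv_dir i ^^ \<alpha> i) is f"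

lemma mderiv_along_Nil [simp]: "mderiv_along [] \<alpha> f = f"
  and mderiv_along_Cons [simp]:
    "mderiv_along (i # is) \<alpha> f = (pderiv_dir i ^^ \<alpha> i) (mderiv_along is \<alpha> f)"
  by (simp_all add: mderiv_along_def)

lemma mderiv_eq_mderiv_along: "mderiv \<alpha> f = mderiv_along coords \<alpha> f"
  by (simp add: mderiv_def mderiv_along_def)

lemma mderiv_along_cong:
  "(\<And>i. i \<in> set is \<Longrightarrow> \<alpha> i = \<beta> i) \<Longrightarrow> mderiv_along is \<alpha> f = mderiv_along is \<beta> f"
  by (induction "is") auto

lemma mderiv_along_eq_0:
  "(\<And>i. i \<in> set is \<Longrightarrow> \<alpha> i = 0) \<Longrightarrow> mderiv_along is \<alpha> f = f"
  by (induction "is") auto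

lemma mderiv_along_append:
  "mderiv_along (is @ js) \<alpha> f = mderiv_along is \<alpha> (mderiv_along js \<alpha> f)"
  by (simp add: mderiv_along_def)

lemma mderiv_along_invariant:
  assumes "P f" "\<And>i g. P g \<Longrightarrow> P (pderiv_dir i g)"
  shows "P (mderiv_along is \<alpha> f)"
proof (induction "is")
  case (Cons i "is")
  have "P ((pderiv_dir i ^^ k) (mderiv_along is \<alpha> f))" for k
    by (induction k) (use Cons assms in auto)
  then show ?case by simp
qed (use assms in auto)

lemma smooth_mderiv_along: "smooth f \<Longrightarrow> smooth (mderiv_along is \<alpha> f)"
  by (rule mderiv_along_invariant) (auto intro: smooth_pderiv_dir)

lemma smooth_mderiv: "smooth f \<Longrightarrow> smooth (mderiv \<alpha> f)"
  by (simp add: mderiv_eq_mderiv_along smooth_mderiv_along)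

lemma smooth_pderiv_dir_funpow: "smooth f \<Longrightarrow> smooth ((pderiv_dir i ^^ k) f)"
  by (induction k) (auto intro: smooth_pderiv_dir)

lemma mderiv_along_add:
  assumes "smooth f" "smooth g"
  shows "mderiv_along is \<alpha> (f + g) = mderiv_along is \<alpha> f + mderiv_along is \<alpha> g"
proof (induction "is")
  case (Cons i "is")
  have "(pderiv_dir i ^^ k) (u + v) = (pderiv_dir i ^^ k) u + (pderiv_dir i ^^ k) v"
    if "smooth u" "smooth v" for k u v
    by (induction k) (use that in \<open>auto simp: pderiv_dir_add smooth_differentiable smooth_pderiv_dir_funpow\<close>)
  then show ?case using Cons assms by (simp add: smooth_mderiv_along)
qed simp

lemma mderiv_along_cscale:
  assumes "smooth f"
  shows "mderiv_along is \<alpha> (cscale c f) = cscale c (mderiv_along is \<alpha> f)"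
proof (induction "is")
  case (Cons i "is")
  have "(pderiv_dir i ^^ k) (cscale c u) = cscale c ((pderiv_dir i ^^ k) u)" if "smooth u" for k u
    by (induction k) (use that in \<open>auto simp: pderiv_dir_cscale smooth_pderiv_dir_funpow\<close>)
  then show ?case using Cons assms by (simp add: smooth_mderiv_along)
qed simp

lemma mderiv_add: "smooth f \<Longrightarrow> smooth g \<Longrightarrow> mderiv \<alpha> (f + g) = mderiv \<alpha> f + mderiv \<alpha> g"
  by (simp add: mderiv_eq_mderiv_along mderiv_along_add)

lemma mderiv_cscale: "smooth f \<Longrightarrow> mderiv \<alpha> (cscale c f) = cscale c (mderiv \<alpha> f)"
  by (simp add: mderiv_eq_mderiv_along mderiv_along_cscale)

lemma mderiv_0 [simp]: "mderiv (\<lambda>i. 0) f = f"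
  by (simp add: mderiv_eq_mderiv_along mderiv_along_eq_0)

text \<open>Derivatives with respect to a suffix of the enumeration of the coordinates are themselves of
  the form \<open>mderiv \<beta>\<close>, so that no symmetry of second derivatives is ever needed.\<close>

lemma mderiv_suffix:
  assumes "coords = js @ i # is"
  shows "(pderiv_dir i ^^ k) (mderiv_along is \<alpha> f)
           = mderiv (\<lambda>j. if j \<in> set is then \<alpha> j else if j = i then k else 0) f"
    (is "_ = mderiv ?\<beta> f")
proof -
  have d: "distinct (js @ i # is)" using distinct_coords assms by metis
  have "mderiv ?\<beta> f = mderiv_along js ?\<beta> (mderiv_along (i # is) ?\<beta> f)"
    by (simp add: mderiv_eq_mderiv_along assms mderiv_along_append)
  also have "\<dots> = mderiv_along (i # is) ?\<beta> f"
    by (rule mderiv_along_eq_0) (use d in auto)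
  also have "mderiv_along is ?\<beta> f = mderiv_along is \<alpha> f"
    by (rule mderiv_along_cong) auto
  then have "mderiv_along (i # is) ?\<beta> f = (pderiv_dir i ^^ k) (mderiv_along is \<alpha> f)"
    using d by simp
  finally show ?thesis ..
qed

lemma pderiv_dir_funpow_eq_mderiv:
  "(pderiv_dir i ^^ k) f = mderiv (\<lambda>j. if j = i then k else 0) f"
proof -
  obtain js "is" where c: "coords = js @ i # is"
    using set_coords by (metis UNIV_I split_list)
  have d: "distinct (js @ i # is)" using distinct_coords c by metis
  have "(pderiv_dir i ^^ k) f = (pderiv_dir i ^^ k) (mderiv_along is (\<lambda>_. 0) f)"
    by (simp add: mderiv_along_eq_0)
  also have "\<dots> = mderiv (\<lambda>j. if j \<in> set is then 0 else if j = i then k else 0) f"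
    by (rule mderiv_suffix[OF c])
  also have "(\<lambda>j. if j \<in> set is then 0 else if j = i then k else 0) = (\<lambda>j. if j = i then k else 0)"
    using d by auto
  finally show ?thesis .
qed

lemma msize_indicator: "msize (\<lambda>j. if j = i then k else 0) = k"
  by (simp add: msize_def)

lemma msize_suffix:
  assumes "distinct (i # is)"
  shows "msize (\<lambda>j. if j \<in> set is then \<alpha> j else if j = i then k else 0) = sum \<alpha> (set is) + k"
proof -
  have "msize (\<lambda>j. if j \<in> set is then \<alpha> j else if j = i then k else 0)
      = (\<Sum>j\<in>UNIV. (if j \<in> set is then \<alpha> j else 0) + (if j = i then k else 0))"
    unfolding msize_def using assms by (intro sum.cong) auto
  also have "\<dots> = sum \<alpha> (set is) + k"
    by (simp add: sum.distrib flip: sum.inter_restrict)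
  finally show ?thesis .
qed

text \<open>In the Leibniz rule the binomial coefficients are spelled out as repetitions in a list of
  \<open>2 ^ \<bar>\<alpha>\<bar>\<close> products, each differentiation doubling the list.\<close>

definition sum_products :: "(('x \<Rightarrow> complex) \<times> ('x \<Rightarrow> complex)) list \<Rightarrow> 'x \<Rightarrow> complex" where
  "sum_products L x = (\<Sum>(u, v)\<leftarrow>L. u x * v x)"

lemma pderiv_dir_sum_products:
  fixes L :: "((real ^ 'a::finite \<Rightarrow> complex) \<times> (real ^ 'a \<Rightarrow> complex)) list"
  assumes "\<And>u v. (u, v) \<in> set L \<Longrightarrow> smooth u \<and> smooth v"
  shows "smooth (sum_products L) \<and>
     pderiv_dir i (sum_products L) =
       sum_products (concat (map (\<lambda>(u, v). [(pderiv_dir i u, v), (u, pderiv_dir i v)]) L))"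
  using assms
proof (induction L)
  case Nil
  have "sum_products [] = (\<lambda>x :: real ^ 'a. 0)" by (rule ext) (simp add: sum_products_def)
  then show ?case by simp
next
  case (Cons p L)
  obtain u v where p: "p = (u, v)" by (cases p)
  have uv: "smooth u" "smooth v" using Cons.prems p by auto
  have IH: "smooth (sum_products L)" "pderiv_dir i (sum_products L) =
       sum_products (concat (map (\<lambda>(u, v). [(pderiv_dir i u, v), (u, pderiv_dir i v)]) L))"
    using Cons by auto
  have eq: "sum_products (p # L) = u * v + sum_products L"
    by (simp add: sum_products_def fun_eq_iff times_fun_apply plus_fun_apply p)
  have "pderiv_dir i (sum_products (p # L)) =
      (pderiv_dir i u * v + u * pderiv_dir i v) + pderiv_dir i (sum_products L)"
    unfolding eq using uv IH(1)
    by (simp add: pderiv_dir_add pderiv_dir_mult smooth_differentiable smooth_mult)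
  then show ?case
    unfolding IH(2)
    using uv IH(1) by (auto simp: eq smooth_add smooth_mult) (simp add: p sum_products_def fun_eq_iff times_fun_apply plus_fun_apply)
qed

lemma mderiv_along_mult:
  assumes "smooth f" "smooth g" "distinct is"
  shows "\<exists>L. length L = 2 ^ (\<Sum>i\<leftarrow>is. \<alpha> i) \<and>
    (\<forall>(\<beta>, \<gamma>) \<in> set L. \<forall>i\<in>set is. \<beta> i + \<gamma> i = \<alpha> i) \<and>
    mderiv_along is \<alpha> (f * g) = sum_products (map (\<lambda>(\<beta>, \<gamma>). (mderiv_along is \<beta> f, mderiv_along is \<gamma> g)) L)"
  using assms(3)
proof (induction "is")
  case Nil
  show ?case by (rule exI[of _ "[(\<lambda>_. 0, \<lambda>_. 0)]"]) (simp add: sum_products_def fun_eq_iff times_fun_apply)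
next
  case (Cons i "is")
  then obtain L where L: "length L = 2 ^ (\<Sum>i\<leftarrow>is. \<alpha> i)"
      "\<And>\<beta> \<gamma>. (\<beta>, \<gamma>) \<in> set L \<Longrightarrow> \<forall>i\<in>set is. \<beta> i + \<gamma> i = \<alpha> i"
      "mderiv_along is \<alpha> (f * g) = sum_products (map (\<lambda>(\<beta>, \<gamma>). (mderiv_along is \<beta> f, mderiv_along is \<gamma> g)) L)"
    by fastforce
  have i: "i \<notin> set is" using Cons.prems by simp
  have upd: "mderiv_along is (\<beta>(i := b)) h = mderiv_along is \<beta> h" for \<beta> b h
    by (rule mderiv_along_cong) (use i in auto)
  have upd_Suc: "mderiv_along (i # is) (\<beta>(i := Suc (\<beta> i))) h = pderiv_dir i (mderiv_along (i # is) \<beta> h)" for \<beta> h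
    by (simp add: upd fun_upd_same del: fun_upd_apply)
  have "\<exists>L'. length L' = 2 ^ (k + (\<Sum>i\<leftarrow>is. \<alpha> i)) \<and>
      (\<forall>(\<beta>, \<gamma>) \<in> set L'. \<beta> i + \<gamma> i = k \<and> (\<forall>j\<in>set is. \<beta> j + \<gamma> j = \<alpha> j)) \<and>
      (pderiv_dir i ^^ k) (mderiv_along is \<alpha> (f * g)) =
        sum_products (map (\<lambda>(\<beta>, \<gamma>). (mderiv_along (i # is) \<beta> f, mderiv_along (i # is) \<gamma> g)) L')" for k
  proof (induction k)
    case 0
    show ?case
      by (rule exI[of _ "map (\<lambda>(\<beta>, \<gamma>). (\<beta>(i := 0), \<gamma>(i := 0))) L"])
        (use L i in \<open>auto simp: upd case_prod_unfold o_def\<close>)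
  next
    case (Suc k)
    then obtain L' where L': "length L' = 2 ^ (k + (\<Sum>i\<leftarrow>is. \<alpha> i))"
      "\<And>\<beta> \<gamma>. (\<beta>, \<gamma>) \<in> set L' \<Longrightarrow> \<beta> i + \<gamma> i = k \<and> (\<forall>j\<in>set is. \<beta> j + \<gamma> j = \<alpha> j)"
      "(pderiv_dir i ^^ k) (mderiv_along is \<alpha> (f * g)) =
        sum_products (map (\<lambda>(\<beta>, \<gamma>). (mderiv_along (i # is) \<beta> f, mderiv_along (i # is) \<gamma> g)) L')"
      by fastforce
    define M where "M = concat (map (\<lambda>(\<beta>, \<gamma>). [(\<beta>(i := Suc (\<beta> i)), \<gamma>), (\<beta>, \<gamma>(i := Suc (\<gamma> i)))]) L')"
    have "length M = 2 * length L'"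
      unfolding M_def by (induction L') auto
    then have "length M = 2 ^ (Suc k + (\<Sum>i\<leftarrow>is. \<alpha> i))" using L'(1) by simp
    moreover have "\<forall>(\<beta>, \<gamma>) \<in> set M. \<beta> i + \<gamma> i = Suc k \<and> (\<forall>j\<in>set is. \<beta> j + \<gamma> j = \<alpha> j)"
      using L'(2) i by (fastforce simp: M_def)
    moreover have "(pderiv_dir i ^^ Suc k) (mderiv_along is \<alpha> (f * g)) =
        sum_products (map (\<lambda>(\<beta>, \<gamma>). (mderiv_along (i # is) \<beta> f, mderiv_along (i # is) \<gamma> g)) M)"
    proof -
      have "(pderiv_dir i ^^ Suc k) (mderiv_along is \<alpha> (f * g)) = sum_products
        (concat (map (\<lambda>(u, v). [(pderiv_dir i u, v), (u, pderiv_dir i v)])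
          (map (\<lambda>(\<beta>, \<gamma>). (mderiv_along (i # is) \<beta> f, mderiv_along (i # is) \<gamma> g)) L')))"
        using assms(1,2)
        by (simp only: funpow.simps o_def L'(3))
           (intro conjunct2[OF pderiv_dir_sum_products], auto simp del: mderiv_along_Cons intro: smooth_mderiv_along)
      also have "concat (map (\<lambda>(u, v). [(pderiv_dir i u, v), (u, pderiv_dir i v)])
          (map (\<lambda>(\<beta>, \<gamma>). (mderiv_along (i # is) \<beta> f, mderiv_along (i # is) \<gamma> g)) L'))
        = map (\<lambda>(\<beta>, \<gamma>). (mderiv_along (i # is) \<beta> f, mderiv_along (i # is) \<gamma> g)) M"
        unfolding M_def
        by (induction L') (auto simp: upd_Suc simp del: fun_upd_apply mderiv_along_Cons)
      finally show ?thesis .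
    qed
    ultimately show ?case by blast
  qed
  from this[of "\<alpha> i"] show ?case by (simp add: case_prod_unfold)
qed

text \<open>The factor counts the products in the Leibniz list. The estimate concerns a single point
  \<open>x\<close>, so \<open>B\<close> may contain weights depending on \<open>x\<close>.\<close>

lemma norm_mderiv_mult_le:
  assumes "smooth f" "smooth g"
    and bound: "\<And>\<beta> \<gamma>. msize \<beta> + msize \<gamma> = msize \<alpha> \<Longrightarrow> norm (mderiv \<beta> f x) * norm (mderiv \<gamma> g x) \<le> B"
  shows "norm (mderiv \<alpha> (f * g) x) \<le> 2 ^ msize \<alpha> * B"
proof -
  obtain L where L: "length L = 2 ^ (\<Sum>i\<leftarrow>coords. \<alpha> i)"
      "\<And>\<beta> \<gamma>. (\<beta>, \<gamma>) \<in> set L \<Longrightarrow> \<forall>i\<in>set coords. \<beta> i + \<gamma> i = \<alpha> i"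
      "mderiv \<alpha> (f * g) = sum_products (map (\<lambda>(\<beta>, \<gamma>). (mderiv \<beta> f, mderiv \<gamma> g)) L)"
    using mderiv_along_mult[OF assms(1,2) distinct_coords, of \<alpha>]
    unfolding mderiv_eq_mderiv_along by fastforce
  have sz: "(\<Sum>i\<leftarrow>coords. \<alpha> i) = msize \<alpha>"
    by (simp add: sum_list_distinct_conv_sum_set distinct_coords set_coords msize_def)
  have b: "norm (mderiv \<beta> f x * mderiv \<gamma> g x) \<le> B" if "(\<beta>, \<gamma>) \<in> set L" for \<beta> \<gamma>
  proof -
    have "msize \<beta> + msize \<gamma> = msize \<alpha>"
      using L(2)[OF that] by (simp add: msize_def set_coords flip: sum.distrib)
    then show ?thesis using bound by (simp add: norm_mult)
  qed
  have "norm (mderiv \<alpha> (f * g) x) = norm (\<Sum>(\<beta>, \<gamma>)\<leftarrow>L. mderiv \<beta> f x * mderiv \<gamma> g x)"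
    by (simp add: L(3) sum_products_def o_def case_prod_unfold)
  also have "\<dots> \<le> real (length L) * B"
    using b
  proof (induction L)
    case (Cons p L)
    have "norm (\<Sum>(\<beta>, \<gamma>)\<leftarrow>(p # L). mderiv \<beta> f x * mderiv \<gamma> g x)
        \<le> norm (case p of (\<beta>, \<gamma>) \<Rightarrow> mderiv \<beta> f x * mderiv \<gamma> g x)
          + norm (\<Sum>(\<beta>, \<gamma>)\<leftarrow>L. mderiv \<beta> f x * mderiv \<gamma> g x)"
      by (simp add: norm_triangle_ineq)
    also have "\<dots> \<le> B + real (length L) * B"
      using Cons by (intro add_mono) (auto split: prod.split)
    finally show ?case by (simp add: algebra_simps)
  qed simp
  finally show ?thesis by (simp add: L(1) sz)
qed

text \<open>The speed \<open>s\<close> is 1 for difference quotients, and 1 or -1 for half-lines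
  directed away from the origin.\<close>

lemma has_vector_derivative_along_axis:
  assumes "smooth f"
  shows "((\<lambda>t. f (x + (s * t) *\<^sub>R axis i 1)) has_vector_derivative
           complex_of_real s * pderiv_dir i f (x + (s * t) *\<^sub>R axis i 1)) (at t)"
proof -
  let ?D = "frechet_derivative f (at (x + (s * t) *\<^sub>R axis i 1))"
  have D: "(f has_derivative ?D) (at (x + (s * t) *\<^sub>R axis i 1))"
    using smooth_differentiable[OF assms] frechet_derivative_works by blast
  have "((\<lambda>t. f (x + (s * t) *\<^sub>R axis i 1)) has_derivative (\<lambda>h. ?D ((s * h) *\<^sub>R axis i 1))) (at t)"
    by (rule has_derivative_compose[where g = f and g' = ?D]) (auto intro!: derivative_eq_intros D)
  moreover have "?D ((s * h) *\<^sub>R axis i 1) = h *\<^sub>R (complex_of_real s * ?D (axis i 1))" for h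
    using linear_cmul[OF has_derivative_linear[OF D], of "s * h" "axis i 1"]
    by (simp only:) (simp add: scaleR_conv_of_real[where 'a = complex] mult_ac)
  ultimately show ?thesis
    by (simp add: has_vector_derivative_def pderiv_dir_def)
qed

text \<open>The three functions listed are closed under partial derivatives. Coordinates thus have
  explicitly bounded derivatives and can be treated as multipliers.\<close>

lemma smooth_component: "smooth (\<lambda>x :: real ^ 'n::finite. complex_of_real (x $ j))"
  and mderiv_component_cases:
    "mderiv \<alpha> (\<lambda>x :: real ^ 'n. complex_of_real (x $ j)) \<in> {\<lambda>x. complex_of_real (x $ j), \<lambda>x. 0, \<lambda>x. 1}"
proof -
  have d: "((\<lambda>x. complex_of_real (x $ j)) has_derivative (\<lambda>h. complex_of_real (h $ j))) (at x)" for x :: "real ^ 'n"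
    by (intro bounded_linear_imp_has_derivative bounded_linear_compose[OF bounded_linear_of_real]
        bounded_linear_vec_nth)
  have pd: "pderiv_dir i (\<lambda>x. complex_of_real (x $ j)) = (\<lambda>x. if i = j then 1 else 0)" for i
    by (rule ext) (simp add: pderiv_dir_has_derivative[OF d] axis_def)
  show "smooth (\<lambda>x. complex_of_real (x $ j))"
    unfolding smooth_def
  proof
    fix k show "times_cont_diff k (\<lambda>x::real^'n. complex_of_real (x $ j))"
      using d by (cases k) (auto simp: pd differentiable_def intro!: continuous_intros)
  qed
  show "mderiv \<alpha> (\<lambda>x. complex_of_real (x $ j)) \<in> {\<lambda>x. complex_of_real (x $ j), \<lambda>x. 0, \<lambda>x. 1}"
    unfolding mderiv_eq_mderiv_along
  proof (rule mderiv_along_invariant)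
    fix i and g :: "real ^ 'n \<Rightarrow> complex"
    assume "g \<in> {\<lambda>x. complex_of_real (x $ j), \<lambda>x. 0, \<lambda>x. 1}"
    then show "pderiv_dir i g \<in> {\<lambda>x. complex_of_real (x $ j), \<lambda>x. 0, \<lambda>x. 1}"
      by (cases "i = j") (auto simp: pd)
  qed auto
qed


section \<open>Rapidly decreasing functions and the Fourier transform\<close>

lemma sum_Basis_component:
  fixes g :: "real ^ 'n::finite \<Rightarrow> real"
  shows "(\<Sum>b\<in>Basis. g b *\<^sub>R b) $ i = g (axis i 1)"
proof -
  have "(\<Sum>b\<in>Basis. g b *\<^sub>R b) $ i = (\<Sum>b\<in>Basis. g b *\<^sub>R b) \<bullet> axis i 1"
    by (simp add: inner_axis)
  then show ?thesis by (simp add: inner_sum_left_Basis)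
qed

lemma prod_Basis_axis:
  fixes g :: "real ^ 'n::finite \<Rightarrow> 'b::comm_monoid_mult"
  shows "(\<Prod>b\<in>Basis. g b) = (\<Prod>i\<in>UNIV. g (axis i 1))"
proof -
  have "(Basis :: (real ^ 'n) set) = range (\<lambda>i. axis i 1)" by (auto simp: Basis_vec_def)
  moreover have inj: "inj (\<lambda>i :: 'n. axis i (1 :: real))" by (auto simp: inj_on_def axis_eq_axis)
  ultimately show ?thesis using prod.reindex[OF inj, of g] by (simp only: o_def)
qed

text \<open>Fubini for products. \<open>lborel\<close> on \<open>real ^ 'n\<close> is the image of a
  product measure indexed by \<open>Basis\<close>, not by coordinates; \<open>idx\<close> recovers
  the coordinate from the basis vector.\<close>

lemma lborel_prod_component:
  fixes f :: "'n::finite \<Rightarrow> real \<Rightarrow> 'b::{real_normed_field,banach,second_countable_topology}"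
  assumes int: "\<And>i. integrable lborel (f i)"
  shows "integrable lborel (\<lambda>x :: real ^ 'n. \<Prod>i\<in>UNIV. f i (x $ i))" (is ?th1)
    and "(LINT x|lborel. (\<Prod>i\<in>UNIV. f i ((x :: real ^ 'n) $ i))) = (\<Prod>i\<in>UNIV. (LINT t|lborel. f i t))" (is ?th2)
proof -
  interpret product_sigma_finite "\<lambda>_ :: real ^ 'n. lborel :: real measure" ..
  have [measurable]: "f i \<in> borel_measurable borel" for i using int[of i] by auto
  define idx where "idx b = (THE i. b = axis i 1)" for b :: "real ^ 'n"
  have idx: "idx (axis i 1) = i" for i unfolding idx_def by (auto simp: axis_eq_axis)
  let ?P = "\<Pi>\<^sub>M b\<in>(Basis :: (real ^ 'n) set). (lborel :: real measure)"
  let ?S = "\<lambda>g :: real ^ 'n \<Rightarrow> real. \<Sum>b\<in>Basis. g b *\<^sub>R b"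
  have S[measurable]: "?S \<in> measurable ?P borel" by measurable
  have eq: "(\<Prod>i\<in>UNIV. f i (?S g $ i)) = (\<Prod>b\<in>Basis. f (idx b) (g b))" for g
    by (simp only: sum_Basis_component prod_Basis_axis idx)
  have i: "integrable ?P (\<lambda>g. \<Prod>b\<in>Basis. f (idx b) (g b))"
    by (rule product_integrable_prod) (auto intro: int)
  have meas: "(\<lambda>x :: real ^ 'n. \<Prod>i\<in>UNIV. f i (x $ i)) \<in> borel_measurable borel" by measurable
  show ?th1
    unfolding lborel_eq[where 'a = "real ^ 'n"] by (subst integrable_distr_eq[OF S meas], simp only: eq) (rule i)
  have "(LINT x|lborel. (\<Prod>i\<in>UNIV. f i ((x :: real ^ 'n) $ i))) = (LINT g|?P. (\<Prod>b\<in>Basis. f (idx b) (g b)))"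
    unfolding lborel_eq[where 'a = "real ^ 'n"] by (subst integral_distr[OF S meas]) (simp only: eq)
  also have "\<dots> = (\<Prod>b\<in>Basis. (LINT t|lborel. f (idx b) t))"
    by (rule product_integral_prod) (auto intro: int)
  also have "\<dots> = (\<Prod>i\<in>UNIV. (LINT t|lborel. f i t))"
    by (simp add: prod_Basis_axis idx)
  finally show ?th2 .
qed

text \<open>Since \<open>(1 + norm x)\<^sup>2\<close> dominates every
  \<open>1 + (x $ i)\<^sup>2\<close>, the function lies below a product of integrable functions of
  one variable.\<close>

lemma integrable_inverse_power_norm:
  "integrable lborel (\<lambda>x :: real ^ 'n::finite. 1 / (1 + norm x) ^ (2 * CARD('n)))"
proof -
  have "integrable lborel (\<lambda>t :: real. inverse (1 + t\<^sup>2))"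
    using integrable_inverse_1_plus_square
    by (simp add: set_integrable_def)
  then have i: "integrable lborel (\<lambda>x :: real ^ 'n. \<Prod>i\<in>UNIV. inverse (1 + (x $ i)\<^sup>2))"
    by (rule lborel_prod_component)
  show ?thesis
  proof (rule Bochner_Integration.integrable_bound[OF i])
    show "(\<lambda>x :: real ^ 'n. 1 / (1 + norm x) ^ (2 * CARD('n))) \<in> borel_measurable lborel" by measurable
    show "AE x in lborel. norm (1 / (1 + norm x) ^ (2 * CARD('n))) \<le> norm (\<Prod>i\<in>UNIV. inverse (1 + ((x :: real ^ 'n) $ i)\<^sup>2))"
    proof (rule AE_I2)
      fix x :: "real ^ 'n"
      have "(\<Prod>i\<in>UNIV. 1 + (x $ i)\<^sup>2) \<le> (\<Prod>i\<in>(UNIV :: 'n set). (1 + norm x)\<^sup>2)"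
      proof (intro prod_mono conjI)
        fix i
        have "(x $ i)\<^sup>2 \<le> (norm x)\<^sup>2" using component_le_norm_cart[of x i] by (simp add: abs_le_square_iff[symmetric])
        then show "1 + (x $ i)\<^sup>2 \<le> (1 + norm x)\<^sup>2" by (simp add: power2_sum) (smt (verit) norm_ge_zero)
      qed simp
      also have "\<dots> = (1 + norm x) ^ (2 * CARD('n))" by (simp add: power_mult)
      finally have le: "(\<Prod>i\<in>UNIV. 1 + (x $ i)\<^sup>2) \<le> (1 + norm x) ^ (2 * CARD('n))" .
      moreover have "0 < (\<Prod>i\<in>UNIV. 1 + (x $ i)\<^sup>2)" by (intro prod_pos) (auto intro: add_pos_nonneg)
      ultimately have "1 / (1 + norm x) ^ (2 * CARD('n)) \<le> 1 / (\<Prod>i\<in>UNIV. 1 + (x $ i)\<^sup>2)"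
        by (intro divide_left_mono mult_pos_pos) auto
      then show "norm (1 / (1 + norm x) ^ (2 * CARD('n))) \<le> norm (\<Prod>i\<in>UNIV. inverse (1 + (x $ i)\<^sup>2))"
        by (simp add: prod_inversef[symmetric] inverse_eq_divide prod_nonneg abs_of_nonneg prod_dividef del: prod_inversef)
    qed
  qed
qed

lemma lborel_affine_cart:
  fixes f :: "real ^ 'n::finite \<Rightarrow> 'b::{banach,second_countable_topology}"
  assumes c: "c \<noteq> 0" and f: "integrable lborel f"
  shows "integrable lborel (\<lambda>x. f (t + c *\<^sub>R x))" (is ?th1)
    and "(LINT x|lborel. f (t + c *\<^sub>R x)) = (1 / \<bar>c\<bar> ^ CARD('n)) *\<^sub>R (LINT x|lborel. f x)" (is ?th2)
proof -
  have [measurable]: "f \<in> borel_measurable borel" using f by auto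
  have eq: "lborel = density (distr lborel borel (\<lambda>x. t + c *\<^sub>R x)) (\<lambda>_. ennreal (\<bar>c\<bar> ^ CARD('n)))"
    using lborel_affine[OF c, of t] by simp
  have "integrable lborel (\<lambda>x. \<bar>c\<bar> ^ CARD('n) *\<^sub>R f (t + c *\<^sub>R x))"
    using f by (subst (asm) eq) (simp add: integrable_density integrable_distr_eq)
  from integrable_scaleR_right[OF this, of "1 / \<bar>c\<bar> ^ CARD('n)"] show ?th1 using c by simp
  have "(LINT x|lborel. f x) = \<bar>c\<bar> ^ CARD('n) *\<^sub>R (LINT x|lborel. f (t + c *\<^sub>R x))"
    by (subst eq) (simp add: integral_density integral_distr)
  then show ?th2 using c by simp
qed

text \<open>Decay of the function alone, without derivatives: the Fourier lemmas assume it of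
  exactly those derivatives that they involve.\<close>

definition rapid :: "(real ^ 'n::finite \<Rightarrow> complex) \<Rightarrow> bool" where
  "rapid f \<longleftrightarrow> continuous_on UNIV f \<and> (\<forall>M. \<exists>C. \<forall>x. (1 + norm x) ^ M * norm (f x) \<le> C)"

lemma rapid_borel_measurable: "rapid f \<Longrightarrow> f \<in> borel_measurable borel"
  by (auto simp: rapid_def intro: borel_measurable_continuous_onI)

lemma rapid_bound:
  assumes "rapid f"
  obtains C where "C \<ge> 0" "\<And>x. norm (f x) \<le> C * (1 / (1 + norm x) ^ M)"
proof -
  obtain C where C: "\<And>x. (1 + norm x) ^ M * norm (f x) \<le> C" using assms by (auto simp: rapid_def)
  have "(1 + norm x) ^ M > 0" for x :: "real ^ 'a" by (intro zero_less_power add_pos_nonneg) auto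
  then have "norm (f x) \<le> C * (1 / (1 + norm x) ^ M)" for x
    using C[of x] by (simp add: field_simps)
  moreover have "C \<ge> 0" using C[of 0] by (simp add: order_trans[OF norm_ge_zero])
  ultimately show ?thesis using that by blast
qed

lemma rapid_integrable: "rapid f \<Longrightarrow> integrable lborel f"
proof -
  assume f: "rapid f"
  obtain C where "C \<ge> 0" "\<And>x. norm (f x) \<le> C * (1 / (1 + norm x) ^ (2 * CARD('a)))" using rapid_bound[OF f] by blast
  then show ?thesis
    by (intro Bochner_Integration.integrable_bound[OF integrable_mult_right[OF integrable_inverse_power_norm, of C]])
       (auto simp: rapid_borel_measurable[OF f] intro!: AE_I2)
qed

section \<open>The Fourier transform: affine substitutions, derivatives and multiplication by
  coordinates\<close>

lemma norm_exp_ii: "norm (exp (- (\<i> * of_real t))) = 1"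
  by (simp add: norm_exp_eq_Re)

lemma fourier_integrable:
  assumes "integrable lborel f"
  shows "integrable lborel (\<lambda>x. f x * exp (- (\<i> * of_real (x \<bullet> \<xi>))))"
proof (rule Bochner_Integration.integrable_bound[OF assms])
  have [measurable]: "f \<in> borel_measurable borel" using assms by auto
  show "(\<lambda>x. f x * exp (- (\<i> * of_real (x \<bullet> \<xi>)))) \<in> borel_measurable lborel" by measurable
qed (simp add: norm_mult norm_exp_ii)

lemma norm_fourier_le:
  "norm (fourier f \<xi>) \<le> (LINT x|lborel. norm (f x))"
  unfolding fourier_def
  by (rule order_trans[OF integral_norm_bound]) (simp add: norm_mult norm_exp_ii)

lemma fourier_affine:
  fixes f :: "real ^ 'n::finite \<Rightarrow> complex"
  assumes c: "c \<noteq> 0" and f: "integrable lborel f"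
  shows "fourier (\<lambda>x. f (t + c *\<^sub>R x)) \<xi>
    = exp (\<i> * of_real (t \<bullet> \<xi> / c)) * fourier f ((1 / c) *\<^sub>R \<xi>) / of_real (\<bar>c\<bar> ^ CARD('n))"
proof -
  let ?g = "\<lambda>y. exp (\<i> * of_real (t \<bullet> \<xi> / c)) * (f y * exp (- (\<i> * of_real (y \<bullet> ((1 / c) *\<^sub>R \<xi>)))))"
  have eq: "f (t + c *\<^sub>R x) * exp (- (\<i> * of_real (x \<bullet> \<xi>))) = ?g (t + c *\<^sub>R x)" for x
  proof -
    have "(t + c *\<^sub>R x) \<bullet> ((1 / c) *\<^sub>R \<xi>) = t \<bullet> \<xi> / c + x \<bullet> \<xi>"
      using c by (simp add: inner_add_left add_divide_distrib)
    then show ?thesis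
      by (simp only: of_real_add distrib_left minus_add_distrib exp_add) (simp add: exp_minus)
  qed
  have i: "integrable lborel ?g" by (intro integrable_mult_right fourier_integrable f)
  have "fourier (\<lambda>x. f (t + c *\<^sub>R x)) \<xi> = (LINT x|lborel. ?g (t + c *\<^sub>R x))"
    unfolding fourier_def eq ..
  also have "\<dots> = (1 / \<bar>c\<bar> ^ CARD('n)) *\<^sub>R (LINT x|lborel. ?g x)" by (rule lborel_affine_cart(2)[OF c i])
  also have "(LINT x|lborel. ?g x) = exp (\<i> * of_real (t \<bullet> \<xi> / c)) * fourier f ((1 / c) *\<^sub>R \<xi>)"
    unfolding fourier_def by simp
  finally show ?thesis by (simp add: scaleR_conv_of_real)
qed

text \<open>Supplies an integrable majorant of the difference quotients. On a segment of length at
  most 1 the quantity \<open>1 + norm\<close> changes by a factor of at most 2, which costs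
  \<open>2 ^ M\<close>.\<close>

lemma rapid_difference_bound:
  fixes u :: "real ^ 'n::finite \<Rightarrow> complex"
  assumes "smooth u" and u': "rapid (pderiv_dir j u)"
  obtains C where "C \<ge> 0"
    "\<And>x t. 0 < t \<Longrightarrow> t \<le> 1 \<Longrightarrow> norm (u (x + t *\<^sub>R axis j 1) - u x) \<le> t * (C * (1 / (1 + norm x) ^ M))"
proof -
  obtain C where C: "C \<ge> 0" "\<And>x. norm (pderiv_dir j u x) \<le> C * (1 / (1 + norm x) ^ M)"
    using rapid_bound[OF u'] by blast
  have "norm (u (x + t *\<^sub>R axis j 1) - u x) \<le> t * (C * 2 ^ M * (1 / (1 + norm x) ^ M))" if t: "0 < t" "t \<le> 1" for x t
  proof -
    define K where "K = C * 2 ^ M * (1 / (1 + norm x) ^ M)"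
    have d: "((\<lambda>t. u (x + t *\<^sub>R axis j 1)) has_vector_derivative pderiv_dir j u (x + s *\<^sub>R axis j 1)) (at s)" for s
      using has_vector_derivative_along_axis[OF assms(1), of x 1 j s] by simp
    have "norm (u (x + t *\<^sub>R axis j 1) - u (x + 0 *\<^sub>R axis j 1)) \<le> K * t - K * 0"
    proof (rule differentiable_bound_general[OF t(1) _ _ d])
      show "continuous_on {0..t} (\<lambda>t. u (x + t *\<^sub>R axis j 1))"
        by (rule continuous_at_imp_continuous_on) (use d has_vector_derivative_continuous in blast)
      fix s assume s: "0 < s" "s < t"
      define y where "y = x + s *\<^sub>R axis j 1"
      have "norm (y - s *\<^sub>R axis j 1) \<le> norm y + norm (s *\<^sub>R axis j 1 :: real ^ 'n)"
        by (rule norm_triangle_ineq4)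
      then have "norm x \<le> norm y + s" using s by (simp add: y_def)
      then have "1 + norm x \<le> 2 * (1 + norm y)"
        using s t norm_ge_zero[of y] by (smt (verit))
      then have "1 + norm x \<le> 2 * (1 + norm (x + s *\<^sub>R axis j 1))"
        by (simp only: y_def)
      then have "(1 + norm x) ^ M \<le> 2 ^ M * (1 + norm (x + s *\<^sub>R axis j 1)) ^ M"
        by (subst power_mult_distrib[symmetric]) (auto intro!: power_mono)
      moreover have "(1 + norm x) ^ M > 0" "(1 + norm (x + s *\<^sub>R axis j 1)) ^ M > 0"
        by (intro zero_less_power add_pos_nonneg; simp)+
      ultimately have "1 / (1 + norm (x + s *\<^sub>R axis j 1)) ^ M \<le> 2 ^ M * (1 / (1 + norm x) ^ M)"
        by (simp add: field_simps)
      then have "C * (1 / (1 + norm (x + s *\<^sub>R axis j 1)) ^ M) \<le> C * (2 ^ M * (1 / (1 + norm x) ^ M))"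
        using C(1) by (rule mult_left_mono)
      then show "norm (pderiv_dir j u (x + s *\<^sub>R axis j 1)) \<le> K"
        using C(2)[of "x + s *\<^sub>R axis j 1"] by (simp add: K_def)
    qed (auto intro!: derivative_eq_intros continuous_intros)
    then show ?thesis by (simp add: K_def mult.commute)
  qed
  then show ?thesis using that[of "C * 2 ^ M"] C(1) by simp
qed

lemma has_vector_derivative_quotient:
  assumes "(f has_vector_derivative D) (at 0)"
  shows "((\<lambda>s. (f s - f 0) /\<^sub>R s) \<longlongrightarrow> D) (at 0)"
proof -
  have "((\<lambda>s. norm (f (0 + s) - f 0 - s *\<^sub>R D) / norm s) \<longlongrightarrow> 0) (at 0)"
    using assms by (simp only: has_vector_derivative_def has_derivative_at)
  moreover have "\<forall>\<^sub>F s in at 0. norm (f (0 + s) - f 0 - s *\<^sub>R D) / norm s = norm ((f s - f 0) /\<^sub>R s - D)"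
  proof (rule eventually_mono[OF eventually_neq_at_within[of 0]])
    fix s :: real assume "s \<noteq> 0"
    then have "f s - f 0 - s *\<^sub>R D = s *\<^sub>R ((f s - f 0) /\<^sub>R s - D)"
      by (simp add: scaleR_diff_right)
    then show "norm (f (0 + s) - f 0 - s *\<^sub>R D) / norm s = norm ((f s - f 0) /\<^sub>R s - D)"
      using \<open>s \<noteq> 0\<close> by simp
  qed
  ultimately have "((\<lambda>s. norm ((f s - f 0) /\<^sub>R s - D)) \<longlongrightarrow> 0) (at 0)"
    by (rule Lim_transform_eventually)
  then show ?thesis by (rule LIM_zero_cancel[OF tendsto_norm_zero_cancel])
qed

text \<open>Integration by parts is avoided. The transform of a difference quotient is computed by
  translation, which multiplies the transform by a character; letting the step tend to 0, by
  dominated convergence on one side and explicitly on the other, gives two limits of one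
  sequence.\<close>

lemma fourier_pderiv_dir:
  fixes u :: "real ^ 'n::finite \<Rightarrow> complex"
  assumes u: "smooth u" "rapid u" "rapid (pderiv_dir j u)"
  shows "fourier (pderiv_dir j u) \<xi> = \<i> * of_real (\<xi> $ j) * fourier u \<xi>"
proof (rule LIMSEQ_unique)
  define t :: "nat \<Rightarrow> real" where "t n = 1 / real (Suc n)" for n
  have t: "0 < t n" "t n \<le> 1" for n by (auto simp: t_def)
  have t0: "t \<longlonglongrightarrow> 0" unfolding t_def using LIMSEQ_inverse_real_of_nat by (simp add: inverse_eq_divide)
  have t_at: "filterlim t (at 0) sequentially"
    using t0 t by (auto simp: filterlim_at intro!: always_eventually) (metis less_irrefl)
  let ?e = "\<lambda>x. exp (- (\<i> * of_real (x \<bullet> \<xi>)))"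
  let ?s = "\<lambda>n x. ((u (x + t n *\<^sub>R axis j 1) - u x) /\<^sub>R t n) * ?e x"
  have iu: "integrable lborel u" by (rule rapid_integrable) fact
  have [measurable]: "u \<in> borel_measurable borel" "pderiv_dir j u \<in> borel_measurable borel"
    using u by (auto intro: rapid_borel_measurable)
  have ish: "integrable lborel (\<lambda>x. u (x + t n *\<^sub>R axis j 1))" for n
    using lborel_affine_cart(1)[of 1 u "t n *\<^sub>R axis j 1"] iu by (simp add: add.commute)
  have eq: "(LINT x|lborel. ?s n x) = ((exp (\<i> * of_real (t n * \<xi> $ j)) - 1) / of_real (t n)) * fourier u \<xi>" for n
  proof -
    have sh: "(LINT x|lborel. u (x + t n *\<^sub>R axis j 1) * ?e x) = exp (\<i> * of_real (t n * \<xi> $ j)) * fourier u \<xi>"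
      using fourier_affine[OF _ iu, of 1 "t n *\<^sub>R axis j 1" \<xi>]
      by (simp add: fourier_def add.commute inner_axis')
    have "?s n x = (u (x + t n *\<^sub>R axis j 1) * ?e x - u x * ?e x) * of_real (1 / t n)" for x
      by (simp add: scaleR_conv_of_real algebra_simps inverse_eq_divide)
    then have "(LINT x|lborel. ?s n x)
        = (LINT x|lborel. u (x + t n *\<^sub>R axis j 1) * ?e x - u x * ?e x) * of_real (1 / t n)"
      by (simp only: integral_mult_left_zero)
    also have "(LINT x|lborel. u (x + t n *\<^sub>R axis j 1) * ?e x - u x * ?e x)
        = exp (\<i> * of_real (t n * \<xi> $ j)) * fourier u \<xi> - fourier u \<xi>"
      by (subst Bochner_Integration.integral_diff)
         (auto intro!: fourier_integrable ish iu simp: sh fourier_def[symmetric])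
    finally show ?thesis by (simp add: algebra_simps diff_divide_distrib)
  qed
  show "(\<lambda>n. LINT x|lborel. ?s n x) \<longlonglongrightarrow> fourier (pderiv_dir j u) \<xi>"
  proof -
    obtain C where C: "C \<ge> 0" "\<And>x s. 0 < s \<Longrightarrow> s \<le> 1 \<Longrightarrow>
        norm (u (x + s *\<^sub>R axis j 1) - u x) \<le> s * (C * (1 / (1 + norm x) ^ (2 * CARD('n))))"
      using rapid_difference_bound[OF u(1,3)] by blast
    show ?thesis
      unfolding fourier_def
    proof (rule integral_dominated_convergence[where w = "\<lambda>x. C * (1 / (1 + norm x) ^ (2 * CARD('n)))"])
      show "integrable lborel (\<lambda>x :: real ^ 'n. C * (1 / (1 + norm x) ^ (2 * CARD('n))))"
        by (intro integrable_mult_right integrable_inverse_power_norm)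
      show "AE x in lborel. (\<lambda>n. ?s n x) \<longlonglongrightarrow> pderiv_dir j u x * ?e x"
      proof (rule AE_I2)
        fix x
        have "((\<lambda>s. u (x + s *\<^sub>R axis j 1)) has_vector_derivative pderiv_dir j u x) (at 0)"
          using has_vector_derivative_along_axis[OF u(1), of x 1 j 0] by simp
        then have "((\<lambda>s. (u (x + s *\<^sub>R axis j 1) - u x) /\<^sub>R s) \<longlongrightarrow> pderiv_dir j u x) (at 0)"
          using has_vector_derivative_quotient by fastforce
        then show "(\<lambda>n. ?s n x) \<longlonglongrightarrow> pderiv_dir j u x * ?e x"
          by (intro tendsto_mult tendsto_const filterlim_compose[OF _ t_at])
      qed
      show "AE x in lborel. norm (?s n x) \<le> C * (1 / (1 + norm x) ^ (2 * CARD('n)))" for n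
      proof (rule AE_I2)
        fix x
        have "norm (?s n x) = norm (u (x + t n *\<^sub>R axis j 1) - u x) / t n"
          using t[of n] by (simp add: norm_mult norm_exp_ii divide_inverse)
        also have "\<dots> \<le> C * (1 / (1 + norm x) ^ (2 * CARD('n)))"
          using C(2)[OF t[of n], of x] t(1)[of n] by (simp add: divide_le_eq mult_ac)
        finally show "norm (?s n x) \<le> C * (1 / (1 + norm x) ^ (2 * CARD('n)))" .
      qed
      show "(\<lambda>x. pderiv_dir j u x * ?e x) \<in> borel_measurable lborel" by measurable
      show "?s n \<in> borel_measurable lborel" for n by measurable
    qed
  qed
  show "(\<lambda>n. LINT x|lborel. ?s n x) \<longlonglongrightarrow> \<i> * of_real (\<xi> $ j) * fourier u \<xi>"
    unfolding eq
  proof (rule tendsto_mult[OF _ tendsto_const])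
    have "((\<lambda>s. exp (\<i> * (of_real s * of_real (\<xi> $ j)))) has_vector_derivative \<i> * of_real (\<xi> $ j)) (at 0)"
      by (rule has_vector_derivative_real_field[where f = "\<lambda>z. exp (\<i> * (z * of_real (\<xi> $ j)))", simplified])
         (auto intro!: derivative_eq_intros)
    from has_vector_derivative_quotient[OF this]
    have "((\<lambda>s. (exp (\<i> * of_real (s * \<xi> $ j)) - 1) / of_real s) \<longlongrightarrow> \<i> * of_real (\<xi> $ j)) (at 0)"
      by (simp add: scaleR_conv_of_real divide_inverse mult.commute)
    then show "(\<lambda>n. (exp (\<i> * of_real (t n * \<xi> $ j)) - 1) / of_real (t n)) \<longlonglongrightarrow> \<i> * of_real (\<xi> $ j)"
      by (rule filterlim_compose[OF _ t_at])
  qed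
qed


text \<open>The factor is what differentiating the Fourier kernel in the \<open>j\<close>-th
  frequency variable produces.\<close>

definition mult_coord :: "'n::finite \<Rightarrow> (real ^ 'n \<Rightarrow> complex) \<Rightarrow> real ^ 'n \<Rightarrow> complex" where
  "mult_coord j h x = - \<i> * of_real (x $ j) * h x"

lemma rapid_mult_coord:
  assumes "rapid h"
  shows "rapid (mult_coord j h)"
  unfolding rapid_def
proof (intro conjI allI)
  show "continuous_on UNIV (mult_coord j h)"
    unfolding mult_coord_def[abs_def] using assms by (intro continuous_intros) (auto simp: rapid_def)
  fix M
  obtain C where C: "\<And>x. (1 + norm x) ^ Suc M * norm (h x) \<le> C" using assms unfolding rapid_def by blast
  have "(1 + norm x) ^ M * norm (mult_coord j h x) \<le> C" for x
  proof -
    have "\<bar>x $ j\<bar> \<le> 1 + norm x" using component_le_norm_cart[of x j] by (smt (verit))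
    then have "(1 + norm x) ^ M * norm (mult_coord j h x) \<le> (1 + norm x) ^ M * ((1 + norm x) * norm (h x))"
      by (intro mult_left_mono) (auto simp: mult_coord_def norm_mult intro!: mult_right_mono)
    also have "\<dots> \<le> C" using C[of x] by (simp add: mult_ac)
    finally show ?thesis .
  qed
  then show "\<exists>C. \<forall>x. (1 + norm x) ^ M * norm (mult_coord j h x) \<le> C" by blast
qed

lemma norm_exp_ii_taylor: "norm (exp (- (\<i> * of_real (a + b))) - exp (- (\<i> * of_real a)) + \<i> * of_real b * exp (- (\<i> * of_real a))) \<le> b\<^sup>2 / 2"
proof -
  have "exp (- (\<i> * of_real (a + b))) - exp (- (\<i> * of_real a)) + \<i> * of_real b * exp (- (\<i> * of_real a))
      = exp (- (\<i> * of_real a)) * (exp (\<i> * of_real (- b)) - (\<Sum>k\<le>1. (\<i> * of_real (- b)) ^ k / fact k))"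
    by (simp add: exp_add[symmetric] algebra_simps)
  also have "norm \<dots> = norm (exp (\<i> * of_real (- b)) - (\<Sum>k\<le>1. (\<i> * of_real (- b)) ^ k / fact k))"
    by (simp add: norm_mult norm_exp_ii)
  also have "\<dots> \<le> \<bar>- b\<bar> ^ Suc 1 / fact (Suc 1)" by (rule iexp_approx1)
  also have "\<dots> = b\<^sup>2 / 2" by (simp add: power2_eq_square)
  finally show ?thesis .
qed

text \<open>\<open>smooth\<close> asks for total derivatives, so differentiating under the integral
  in each variable would not suffice. The second-order Taylor estimate of the kernel gives an error
  at most quadratic in \<eta>.\<close>

lemma fourier_has_derivative:
  fixes h :: "real ^ 'n::finite \<Rightarrow> complex"
  assumes h: "rapid h"
  shows "(fourier h has_derivative (\<lambda>\<eta>. \<Sum>j\<in>UNIV. of_real (\<eta> $ j) * fourier (mult_coord j h) \<xi>)) (at \<xi>)"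
    (is "(_ has_derivative ?D) _")
  unfolding has_derivative_at
proof
  show bl: "bounded_linear ?D"
    by (intro bounded_linear_sum bounded_linear_compose[OF bounded_linear_mult_left]
          bounded_linear_compose[OF bounded_linear_of_real] bounded_linear_vec_nth)
  let ?e = "\<lambda>\<xi> x. exp (- (\<i> * of_real (x \<bullet> \<xi>)))"
  \<comment> \<open>The two extra powers pay for \<open>(x \<bullet> \<eta>)\<^sup>2\<close>,
    leaving the integrable exponent \<open>2 * CARD('n)\<close>.\<close>
  obtain C where C: "C \<ge> 0" "\<And>x. norm (h x) \<le> C * (1 / (1 + norm x) ^ (2 * CARD('n) + 2))"
    using rapid_bound[OF h] by blast
  have ih: "integrable lborel h" by (rule rapid_integrable) fact
  define K where "K = (LINT x|lborel. C * (1 / (1 + norm (x :: real ^ 'n)) ^ (2 * CARD('n))))"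
  have iK: "integrable lborel (\<lambda>x :: real ^ 'n. C * (1 / (1 + norm x) ^ (2 * CARD('n))))"
    by (intro integrable_mult_right integrable_inverse_power_norm)
  have K: "K \<ge> 0" unfolding K_def by (rule integral_nonneg_AE) (use C(1) in auto)
  have main: "norm (fourier h (\<xi> + \<eta>) - fourier h \<xi> - ?D \<eta>) \<le> K * (norm \<eta>)\<^sup>2" for \<eta>
  proof -
    have ij: "integrable lborel (\<lambda>x. mult_coord j h x * ?e \<xi> x)" for j
      by (intro fourier_integrable rapid_integrable rapid_mult_coord h)
    have D: "?D \<eta> = (LINT x|lborel. (\<Sum>j\<in>UNIV. of_real (\<eta> $ j) * (mult_coord j h x * ?e \<xi> x)))"
      unfolding fourier_def using ij by (subst Bochner_Integration.integral_sum) auto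
    have sumD: "(\<Sum>j\<in>UNIV. of_real (\<eta> $ j) * (mult_coord j h x * ?e \<xi> x))
        = - (\<i> * of_real (x \<bullet> \<eta>) * ?e \<xi> x) * h x" for x
    proof -
      have "(\<Sum>j\<in>UNIV. of_real (\<eta> $ j) * (mult_coord j h x * ?e \<xi> x))
        = (\<Sum>j\<in>UNIV. of_real (x $ j * \<eta> $ j)) * (- \<i> * ?e \<xi> x * h x)"
        unfolding sum_distrib_right by (intro sum.cong) (auto simp: mult_coord_def)
      also have "(\<Sum>j\<in>UNIV. of_real (x $ j * \<eta> $ j)) = (of_real (x \<bullet> \<eta>) :: complex)"
        by (simp add: inner_vec_def)
      finally show ?thesis by (simp add: mult_ac)
    qed
    have eq: "fourier h (\<xi> + \<eta>) - fourier h \<xi> - ?D \<eta>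
        = (LINT x|lborel. h x * (?e (\<xi> + \<eta>) x - ?e \<xi> x + \<i> * of_real (x \<bullet> \<eta>) * ?e \<xi> x))"
    proof -
      have "integrable lborel (\<lambda>x. \<Sum>j\<in>UNIV. of_real (\<eta> $ j) * (mult_coord j h x * ?e \<xi> x))"
        by (intro Bochner_Integration.integrable_sum integrable_mult_right ij)
      then have "(LINT x|lborel. h x * ?e (\<xi> + \<eta>) x - h x * ?e \<xi> x -
          (\<Sum>j\<in>UNIV. of_real (\<eta> $ j) * (mult_coord j h x * ?e \<xi> x)))
        = (LINT x|lborel. h x * ?e (\<xi> + \<eta>) x) - (LINT x|lborel. h x * ?e \<xi> x)
          - (LINT x|lborel. (\<Sum>j\<in>UNIV. of_real (\<eta> $ j) * (mult_coord j h x * ?e \<xi> x)))"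
        using fourier_integrable[OF ih, of \<xi>] fourier_integrable[OF ih, of "\<xi> + \<eta>"]
        by (simp only: Bochner_Integration.integral_diff Bochner_Integration.integrable_diff)
      then have "fourier h (\<xi> + \<eta>) - fourier h \<xi> - ?D \<eta> = (LINT x|lborel. h x * ?e (\<xi> + \<eta>) x - h x * ?e \<xi> x -
          (\<Sum>j\<in>UNIV. of_real (\<eta> $ j) * (mult_coord j h x * ?e \<xi> x)))"
        unfolding D by (simp only: fourier_def)
      also have "\<dots> = (LINT x|lborel. h x * (?e (\<xi> + \<eta>) x - ?e \<xi> x + \<i> * of_real (x \<bullet> \<eta>) * ?e \<xi> x))"
        unfolding sumD by (intro Bochner_Integration.integral_cong refl) (simp add: algebra_simps)
      finally show ?thesis .
    qed
    have "norm (fourier h (\<xi> + \<eta>) - fourier h \<xi> - ?D \<eta>)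
        \<le> (LINT x|lborel. norm (h x * (?e (\<xi> + \<eta>) x - ?e \<xi> x + \<i> * of_real (x \<bullet> \<eta>) * ?e \<xi> x)))"
      unfolding eq by (rule integral_norm_bound)
    also have "\<dots> \<le> (LINT x|lborel. C * (1 / (1 + norm (x :: real ^ 'n)) ^ (2 * CARD('n))) * (norm \<eta>)\<^sup>2)"
    proof (rule integral_mono_AE')
      show "integrable lborel (\<lambda>x :: real ^ 'n. C * (1 / (1 + norm x) ^ (2 * CARD('n))) * (norm \<eta>)\<^sup>2)"
        by (intro integrable_mult_left iK)
      show "AE x in lborel. norm (h x * (?e (\<xi> + \<eta>) x - ?e \<xi> x + \<i> * of_real (x \<bullet> \<eta>) * ?e \<xi> x))
          \<le> C * (1 / (1 + norm x) ^ (2 * CARD('n))) * (norm \<eta>)\<^sup>2"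
      proof (rule AE_I2)
        fix x :: "real ^ 'n"
        have pos: "1 + norm x > 0" by (simp add: add_pos_nonneg)
        have "\<bar>x \<bullet> \<eta>\<bar> \<le> (1 + norm x) * norm \<eta>"
          using Cauchy_Schwarz_ineq2[of x \<eta>] by (simp add: distrib_right) (smt (verit) norm_ge_zero)
        then have "(x \<bullet> \<eta>)\<^sup>2 \<le> ((1 + norm x) * norm \<eta>)\<^sup>2"
          by (metis abs_ge_zero power2_abs power_mono)
        moreover have "(x \<bullet> \<eta>)\<^sup>2 / 2 \<le> (x \<bullet> \<eta>)\<^sup>2" by simp
        ultimately have sq: "(x \<bullet> \<eta>)\<^sup>2 / 2 \<le> ((1 + norm x) * norm \<eta>)\<^sup>2" by (rule order_trans[rotated])
        have "norm (h x * (?e (\<xi> + \<eta>) x - ?e \<xi> x + \<i> * of_real (x \<bullet> \<eta>) * ?e \<xi> x)) \<le> norm (h x) * ((x \<bullet> \<eta>)\<^sup>2 / 2)"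
          unfolding norm_mult inner_add_right by (intro mult_left_mono norm_exp_ii_taylor) auto
        also have "\<dots> \<le> (C * (1 / (1 + norm x) ^ (2 * CARD('n) + 2))) * ((1 + norm x) * norm \<eta>)\<^sup>2"
          using sq C by (intro mult_mono C(2)) auto
        also have "\<dots> = C * (1 / (1 + norm x) ^ (2 * CARD('n))) * (norm \<eta>)\<^sup>2"
          using pos by (simp add: power_mult_distrib power_add power2_eq_square)
        finally show "norm (h x * (?e (\<xi> + \<eta>) x - ?e \<xi> x + \<i> * of_real (x \<bullet> \<eta>) * ?e \<xi> x))
          \<le> C * (1 / (1 + norm x) ^ (2 * CARD('n))) * (norm \<eta>)\<^sup>2" .
      qed
      show "AE x in lborel. 0 \<le> C * (1 / (1 + norm (x :: real ^ 'n)) ^ (2 * CARD('n))) * (norm \<eta>)\<^sup>2"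
        using C(1) by (intro AE_I2) auto
    qed
    also have "\<dots> = K * (norm \<eta>)\<^sup>2" unfolding K_def by (rule integral_mult_left_zero)
    finally show ?thesis .
  qed
  show "(\<lambda>\<eta>. norm (fourier h (\<xi> + \<eta>) - fourier h \<xi> - ?D \<eta>) / norm \<eta>) \<midarrow>0\<rightarrow> 0"
  proof (rule Lim_null_comparison)
    show "\<forall>\<^sub>F \<eta> in at 0. norm (norm (fourier h (\<xi> + \<eta>) - fourier h \<xi> - ?D \<eta>) / norm \<eta>) \<le> K * norm \<eta>"
    proof (rule eventually_mono[OF eventually_neq_at_within[of 0]])
      fix \<eta> :: "real ^ 'n" assume "\<eta> \<noteq> 0"
      then show "norm (norm (fourier h (\<xi> + \<eta>) - fourier h \<xi> - ?D \<eta>) / norm \<eta>) \<le> K * norm \<eta>"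
        using main[of \<eta>] by (simp add: divide_le_eq power2_eq_square mult_ac)
    qed
    show "((\<lambda>\<eta> :: real ^ 'n. K * norm \<eta>) \<longlongrightarrow> 0) (at 0)"
      by (intro tendsto_mult_right_zero tendsto_norm_zero tendsto_ident_at)
  qed
qed

lemma pderiv_dir_fourier: "rapid h \<Longrightarrow> pderiv_dir j (fourier h) = fourier (mult_coord j h)"
proof
  fix \<xi> assume "rapid h"
  from pderiv_dir_has_derivative[OF fourier_has_derivative[OF this, of \<xi>], of j]
  show "pderiv_dir j (fourier h) \<xi> = fourier (mult_coord j h) \<xi>"
    by (simp add: axis_def if_distrib[of of_real] if_distrib[of "\<lambda>z. z * _"] cong: if_cong)
qed

lemma smooth_fourier: "rapid h \<Longrightarrow> smooth (fourier h)"
  unfolding smooth_def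
proof
  fix k show "rapid h \<Longrightarrow> times_cont_diff k (fourier h)"
  proof (induction k arbitrary: h)
    case 0
    have "isCont (fourier h) \<xi>" for \<xi>
      by (rule has_derivative_continuous[OF fourier_has_derivative[OF 0]])
    then show ?case by (simp add: continuous_at_imp_continuous_on)
  next
    case (Suc k)
    then show ?case
      using fourier_has_derivative[OF Suc.prems] by (auto simp: pderiv_dir_fourier rapid_mult_coord differentiable_def)
  qed
qed

text \<open>Gaussian summation: testing \<open>fourier v\<close> against a Gaussian recovers the Gaussian mean of \<open>v\<close>.\<close>

definition gauss_prod :: "real ^ 'n::finite \<Rightarrow> real" where
  "gauss_prod \<xi> = (\<Prod>i\<in>UNIV. std_normal_density (\<xi> $ i))"

definition gauss_exp :: "real ^ 'n::finite \<Rightarrow> real" where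
  "gauss_exp y = (\<Prod>i\<in>UNIV. exp (- (y $ i)\<^sup>2 / 2))"

lemma integrable_gauss_prod: "integrable lborel (gauss_prod :: real ^ 'n::finite \<Rightarrow> real)"
  unfolding gauss_prod_def[abs_def]
  by (rule lborel_prod_component) (simp add: integrable_normal_density)

lemma gauss_prod_bound: "0 \<le> gauss_prod \<xi>" "gauss_prod \<xi> \<le> 1"
proof -
  show "0 \<le> gauss_prod \<xi>" by (simp add: gauss_prod_def prod_nonneg)
  have "std_normal_density t \<le> 1" for t
  proof -
    have "1 \<le> sqrt (2 * pi)" using pi_gt3 by (simp add: real_le_rsqrt)
    then have "1 / sqrt (2 * pi) \<le> 1" by simp
    then have "1 / sqrt (2 * pi) * exp (- t\<^sup>2 / 2) \<le> 1 * 1" by (intro mult_mono) auto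
    then show ?thesis by (simp add: normal_density_def)
  qed
  then show "gauss_prod \<xi> \<le> 1" unfolding gauss_prod_def by (intro prod_le_1) auto
qed

lemma gauss_exp_bound: "0 \<le> gauss_exp \<xi>" "gauss_exp \<xi> \<le> 1"
  by (auto simp: gauss_exp_def intro!: prod_nonneg prod_le_1)

lemma gauss_exp_integral:
  "integrable lborel (gauss_exp :: real ^ 'n::finite \<Rightarrow> real)"
  "(LINT y|lborel. gauss_exp (y :: real ^ 'n)) > 0"
proof -
  have eq: "exp (- t\<^sup>2 / 2) = sqrt (2 * pi) * std_normal_density t" for t
    by (simp add: normal_density_def)
  have i: "integrable lborel (\<lambda>t :: real. exp (- t\<^sup>2 / 2))"
    unfolding eq by (intro integrable_mult_right integrable_normal_density) simp
  have v: "(LINT t|lborel. exp (- t\<^sup>2 / 2)) = sqrt (2 * pi)"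
    unfolding eq by simp
  show "integrable lborel (gauss_exp :: real ^ 'n::finite \<Rightarrow> real)"
    unfolding gauss_exp_def[abs_def] by (rule lborel_prod_component(1)) (rule i)
  have "(LINT y|lborel. gauss_exp (y :: real ^ 'n)) = (\<Prod>i\<in>(UNIV :: 'n set). sqrt (2 * pi))"
    unfolding gauss_exp_def by (subst lborel_prod_component(2)) (rule i, simp only: v)
  then show "(LINT y|lborel. gauss_exp (y :: real ^ 'n)) > 0" by simp
qed

text \<open>The integral factors over the coordinates, and each factor is the characteristic
  function of the standard normal distribution.\<close>

lemma fourier_gauss_prod: "fourier (\<lambda>\<xi>. complex_of_real (gauss_prod \<xi>)) y = of_real (gauss_exp y)"
proof -
  have c: "(LINT s|lborel. complex_of_real (std_normal_density s) * exp (- (\<i> * of_real (s * t)))) = of_real (exp (- t\<^sup>2 / 2))" for t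
  proof -
    have "char std_normal_distribution (- t) = (LINT s|lborel. std_normal_density s *\<^sub>R exp (\<i> * of_real (- t * s)))"
      unfolding char_def by (subst integral_density) auto
    then show ?thesis
      by (simp add: char_std_normal_distribution scaleR_conv_of_real mult.commute)
  qed
  have i: "integrable lborel (\<lambda>s. complex_of_real (std_normal_density s) * exp (- (\<i> * of_real (s * t))))" for t
    by (rule Bochner_Integration.integrable_bound[OF integrable_normal_density[of 1 0]])
       (auto simp: norm_mult norm_exp_ii)
  have "complex_of_real (gauss_prod \<xi>) * exp (- (\<i> * of_real (\<xi> \<bullet> y)))
      = (\<Prod>j\<in>UNIV. complex_of_real (std_normal_density (\<xi> $ j)) * exp (- (\<i> * of_real (\<xi> $ j * y $ j))))" for \<xi>
    by (simp add: gauss_prod_def inner_vec_def prod.distrib exp_sum[symmetric] sum_negf sum_distrib_left)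
  then have "fourier (\<lambda>\<xi>. complex_of_real (gauss_prod \<xi>)) y =
      (LINT \<xi>|lborel. (\<Prod>j\<in>UNIV. (\<lambda>s. complex_of_real (std_normal_density s) * exp (- (\<i> * of_real (s * y $ j)))) ((\<xi> :: real ^ 'a) $ j)))"
    unfolding fourier_def by simp
  also have "\<dots> = (\<Prod>j\<in>UNIV. of_real (exp (- (y $ j)\<^sup>2 / 2)))"
    by (subst lborel_prod_component(2)) (rule i, simp only: c)
  finally show ?thesis by (simp add: gauss_exp_def)
qed

text \<open>Fubini for \<open>v y\<close> times the kernel times the Gaussian density: integrating
  the density gives the left side, integrating \<open>v\<close> the right side.\<close>

lemma gauss_exp_duality:
  fixes v :: "real ^ 'n::finite \<Rightarrow> complex"
  assumes v: "integrable lborel v"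
  shows "(LINT y|lborel. v y * of_real (gauss_exp y)) = (LINT \<xi>|lborel. fourier v \<xi> * of_real (gauss_prod \<xi>))"
proof -
  let ?g = "\<lambda>\<xi>. complex_of_real (gauss_prod \<xi>)"
  let ?f = "\<lambda>\<xi> y. v y * exp (- (\<i> * of_real (y \<bullet> \<xi>))) * ?g \<xi>"
  have [measurable]: "v \<in> borel_measurable borel" using v by auto
  have [measurable]: "(gauss_prod :: real ^ 'n \<Rightarrow> real) \<in> borel_measurable borel"
    using integrable_gauss_prod by auto
  have "integrable (lborel \<Otimes>\<^sub>M lborel) (case_prod ?f)"
  proof (rule lborel_pair.Fubini_integrable)
    show "case_prod ?f \<in> borel_measurable (lborel \<Otimes>\<^sub>M lborel)" by measurable
    have "integrable lborel (\<lambda>\<xi>. (LINT y|lborel. norm (v y)) * gauss_prod \<xi>)"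
      by (intro integrable_mult_right integrable_gauss_prod)
    then show "integrable lborel (\<lambda>\<xi>. LINT y|lborel. norm (case_prod ?f (\<xi>, y)))"
      by (simp add: norm_mult norm_exp_ii gauss_prod_bound)
    show "AE \<xi> in lborel. integrable lborel (\<lambda>y. case_prod ?f (\<xi>, y))"
      using fourier_integrable[OF v] by simp
  qed
  from lborel_pair.Fubini_integral[OF this]
  have "(LINT y|lborel. (LINT \<xi>|lborel. ?f \<xi> y)) = (LINT \<xi>|lborel. (LINT y|lborel. ?f \<xi> y))" .
  moreover have "(LINT \<xi>|lborel. ?f \<xi> y) = v y * of_real (gauss_exp y)" for y
  proof -
    have "(LINT \<xi>|lborel. ?f \<xi> y) = (LINT \<xi>|lborel. v y * (?g \<xi> * exp (- (\<i> * of_real (\<xi> \<bullet> y)))))"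
      by (simp add: inner_commute mult_ac)
    also have "\<dots> = v y * fourier ?g y" unfolding fourier_def by (rule integral_mult_right_zero)
    finally show ?thesis by (simp add: fourier_gauss_prod)
  qed
  moreover have F: "(LINT y|lborel. ?f \<xi> y) = fourier v \<xi> * of_real (gauss_prod \<xi>)" for \<xi>
    unfolding fourier_def by (rule integral_mult_left_zero)
  ultimately show ?thesis by (simp only: F)
qed

text \<open>Only the sup-norm consequence of Fourier inversion is needed, with some constant
  independent of \<open>u\<close> and \<open>x\<close>. The Gaussian means of
  \<open>u (x + t n *\<^sub>R y)\<close> tend to a positive multiple of \<open>u x\<close>, while by
  duality each is at most the integral of the modulus of the transform, because
  \<open>gauss_prod\<close> is at most 1.\<close>

lemma fourier_inversion_bound:
  "\<exists>C>0. \<forall>u :: real ^ 'n::finite \<Rightarrow> complex. \<forall>x. rapid u \<longrightarrow> integrable lborel (fourier u) \<longrightarrow>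
     norm (u x) \<le> C * (LINT \<xi>|lborel. norm (fourier u \<xi>))"
proof -
  define G where "G = (LINT y|lborel. gauss_exp (y :: real ^ 'n))"
  have G: "G > 0" unfolding G_def by (rule gauss_exp_integral)
  have "norm (u x) * G \<le> (LINT \<xi>|lborel. norm (fourier u \<xi>))"
    if u: "rapid u" and iF: "integrable lborel (fourier u)" for u :: "real ^ 'n \<Rightarrow> complex" and x
  proof (rule LIMSEQ_le_const2)
    define t :: "nat \<Rightarrow> real" where "t n = 1 / real (Suc n)" for n
    have t: "t n > 0" for n by (simp add: t_def)
    have t0: "t \<longlonglongrightarrow> 0" unfolding t_def using LIMSEQ_inverse_real_of_nat by (simp add: inverse_eq_divide)
    have iu: "integrable lborel u" by (rule rapid_integrable) fact
    have [measurable]: "u \<in> borel_measurable borel" "(gauss_exp :: real ^ 'n \<Rightarrow> real) \<in> borel_measurable borel"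
      using u gauss_exp_integral(1) by (auto intro: rapid_borel_measurable)
    let ?v = "\<lambda>n y. u (x + t n *\<^sub>R y)"
    obtain B where B: "B \<ge> 0" "\<And>y. norm (u y) \<le> B * (1 / (1 + norm y) ^ 0)" using rapid_bound[OF u] by blast
    have "(\<lambda>n. LINT y|lborel. ?v n y * of_real (gauss_exp y)) \<longlonglongrightarrow> (LINT y|lborel. u x * of_real (gauss_exp (y :: real ^ 'n)))"
    proof (rule integral_dominated_convergence[where w = "\<lambda>y :: real ^ 'n. B * gauss_exp y"])
      show "integrable lborel (\<lambda>y :: real ^ 'n. B * gauss_exp y)"
        by (intro integrable_mult_right gauss_exp_integral)
      show "AE y in lborel. (\<lambda>n. ?v n y * of_real (gauss_exp y)) \<longlonglongrightarrow> u x * of_real (gauss_exp y)"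
      proof (intro AE_I2 tendsto_mult tendsto_const)
        fix y :: "real ^ 'n"
        have "(\<lambda>n. x + t n *\<^sub>R y) \<longlonglongrightarrow> x + 0 *\<^sub>R y" by (intro tendsto_intros t0)
        moreover have "isCont u (x + 0 *\<^sub>R y)" using u by (simp add: rapid_def continuous_on_eq_continuous_at)
        ultimately show "(\<lambda>n. ?v n y) \<longlonglongrightarrow> u x" using isCont_tendsto_compose by fastforce
      qed
      show "AE y in lborel. norm (?v n y * of_real (gauss_exp y)) \<le> B * gauss_exp y" for n
        using B by (auto simp: norm_mult gauss_exp_bound intro!: AE_I2 mult_right_mono)
    qed measurable
    also have "(LINT y|lborel. u x * of_real (gauss_exp (y :: real ^ 'n))) = u x * of_real G"
      by (simp add: G_def)
    finally have "(\<lambda>n. norm (LINT y|lborel. ?v n y * of_real (gauss_exp y))) \<longlonglongrightarrow> norm (u x * of_real G)"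
      by (rule tendsto_norm)
    then show "(\<lambda>n. norm (LINT y|lborel. ?v n y * of_real (gauss_exp y))) \<longlonglongrightarrow> norm (u x) * G"
      using G by (simp add: norm_mult)
    have "norm (LINT y|lborel. ?v n y * of_real (gauss_exp y)) \<le> (LINT \<xi>|lborel. norm (fourier u \<xi>))" for n
    proof -
      have iv: "integrable lborel (?v n)" by (rule lborel_affine_cart(1)) (use t[of n] iu in auto)
      \<comment> \<open>Shrinking by \<open>t n\<close> does not change the integral of the modulus
        of the transform: this factor cancels against the Jacobian of the dilation below.\<close>
      have nF: "norm (fourier (?v n) \<xi>) = norm (fourier u (0 + (1 / t n) *\<^sub>R \<xi>)) * (1 / t n ^ CARD('n))" for \<xi>
      proof -
        have "norm (exp (\<i> * of_real (x \<bullet> \<xi> / t n))) = 1" by (simp add: norm_exp_eq_Re)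
        then show ?thesis
          using t[of n] by (subst fourier_affine[OF _ iu]) (auto simp: norm_mult norm_divide norm_power)
      qed
      have iF': "integrable lborel (\<lambda>\<xi>. norm (fourier u (0 + (1 / t n) *\<^sub>R \<xi>)))"
        using t[of n] iF by (intro lborel_affine_cart(1) integrable_norm) auto
      then have i1: "integrable lborel (\<lambda>\<xi>. norm (fourier (?v n) \<xi>))"
        unfolding nF by (rule integrable_mult_left)
      have "norm (LINT y|lborel. ?v n y * of_real (gauss_exp y))
          = norm (LINT \<xi>|lborel. fourier (?v n) \<xi> * of_real (gauss_prod \<xi>))"
        by (simp add: gauss_exp_duality[OF iv])
      also have "\<dots> \<le> (LINT \<xi>|lborel. norm (fourier (?v n) \<xi> * of_real (gauss_prod \<xi>)))"
        by (rule integral_norm_bound)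
      also have "\<dots> \<le> (LINT \<xi>|lborel. norm (fourier (?v n) \<xi>))"
        by (rule integral_mono_AE'[OF i1])
           (auto simp: norm_mult gauss_prod_bound intro!: AE_I2 mult_left_le)
      also have "\<dots> = (LINT \<xi>|lborel. norm (fourier u (0 + (1 / t n) *\<^sub>R \<xi>))) * (1 / t n ^ CARD('n))"
        unfolding nF by (rule integral_mult_left_zero)
      also have "(LINT \<xi>|lborel. norm (fourier u (0 + (1 / t n) *\<^sub>R \<xi>)))
          = (1 / \<bar>1 / t n\<bar> ^ CARD('n)) *\<^sub>R (LINT \<xi>|lborel. norm (fourier u \<xi>))"
        by (rule lborel_affine_cart(2)) (use t[of n] iF in auto)
      finally show ?thesis using t[of n] by (simp add: power_divide)
    qed
    then show "\<exists>N. \<forall>n\<ge>N. norm (LINT y|lborel. ?v n y * of_real (gauss_exp y)) \<le> (LINT \<xi>|lborel. norm (fourier u \<xi>))"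
      by blast
  qed
  then show ?thesis using G by (intro exI[of _ "1 / G"]) (auto simp: field_simps)
qed


section \<open>Characterization of \<open>S_space\<close> by the norms \<open>q_norm\<close>\<close>

lemma norm_add_axis_ge:
  fixes x :: "real ^ 'n::finite"
  assumes "r * x $ i \<ge> 0"
  shows "norm x \<le> norm (x + r *\<^sub>R axis i 1)"
proof (rule power2_le_imp_le)
  have "(norm (x + r *\<^sub>R axis i 1))\<^sup>2 = (norm x)\<^sup>2 + 2 * (r * x $ i) + r\<^sup>2"
    unfolding power2_norm_eq_inner
    by (simp add: inner_add_left inner_add_right inner_axis inner_axis' power2_eq_square algebra_simps)
  then show "(norm x)\<^sup>2 \<le> (norm (x + r *\<^sub>R axis i 1))\<^sup>2" using assms by simp
qed simp

text \<open>The half-line points away from the origin, so that radially decreasing bounds for the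
  function are available along it.\<close>

lemma norm_pderiv_dir_funpow_interpolation:
  fixes u :: "real ^ 'n::finite \<Rightarrow> complex"
  assumes u: "smooth u" and A: "A > 0" "\<And>y. norm x \<le> norm y \<Longrightarrow> norm (u y) \<le> A"
    and B: "B > 0" "\<And>y. norm ((pderiv_dir i ^^ (2 * k)) u y) \<le> B"
  shows "norm ((pderiv_dir i ^^ k) u x) \<le> 4 * (4 * exp 1) ^ (2 * k) * sqrt (A * B)"
proof -
  define s :: real where "s = (if x $ i \<ge> 0 then 1 else -1)"
  have s: "\<bar>s\<bar> = 1" "s * x $ i \<ge> 0" by (auto simp: s_def)
  \<comment> \<open>The power of \<open>s\<close> is the chain-rule factor; it has modulus
    1.\<close>
  define F where "F j t = of_real (s ^ j) * (pderiv_dir i ^^ j) u (x + (s * t) *\<^sub>R axis i 1)" for j t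
  have F': "(F j has_vector_derivative F (Suc j) t) (at t)" for j t
  proof -
    have "smooth ((pderiv_dir i ^^ j) u)" by (rule smooth_pderiv_dir_funpow[OF u])
    from has_vector_derivative_along_axis[OF this, of x s i t]
    have "((\<lambda>t. of_real (s ^ j) * (pderiv_dir i ^^ j) u (x + (s * t) *\<^sub>R axis i 1)) has_vector_derivative
        of_real (s ^ j) * (of_real s * pderiv_dir i ((pderiv_dir i ^^ j) u) (x + (s * t) *\<^sub>R axis i 1))) (at t)"
      by (rule has_vector_derivative_mult_right)
    then show ?thesis by (simp add: F_def[abs_def] mult_ac)
  qed
  have nF: "norm (F j t) = norm ((pderiv_dir i ^^ j) u (x + (s * t) *\<^sub>R axis i 1))" for j t
    using s by (simp add: F_def norm_mult norm_power)
  have FA: "norm (F 0 t) \<le> A" if "t \<ge> 0" for t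
  proof -
    have "(s * t) * x $ i \<ge> 0" using mult_nonneg_nonneg[OF that s(2)] by (simp add: mult_ac)
    from A(2)[OF norm_add_axis_ge[OF this]] show ?thesis by (simp add: nF)
  qed
  have FB: "norm (F (2 * k) t) \<le> B" for t by (simp add: nF B(2))
  \<comment> \<open>The inequality on the half-line is for real functions; treating real and
    imaginary parts separately turns its factor 2 into 4.\<close>
  have re: "\<bar>Re (F k 0)\<bar> \<le> 2 * (4 * exp 1) ^ (2 * k) * sqrt (A * B)"
  proof (rule Landau_Kolmogorov_halfline[where f = "\<lambda>j t. Re (F j t)"])
    show "((\<lambda>t. Re (F j t)) has_real_derivative Re (F (Suc j) t)) (at t)" for j t
      using F'[of j t] by (rule has_field_derivative_Re)
  qed (use A(1) B(1) FA FB abs_Re_le_cmod order_trans in blast)+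
  have im: "\<bar>Im (F k 0)\<bar> \<le> 2 * (4 * exp 1) ^ (2 * k) * sqrt (A * B)"
  proof (rule Landau_Kolmogorov_halfline[where f = "\<lambda>j t. Im (F j t)"])
    show "((\<lambda>t. Im (F j t)) has_real_derivative Im (F (Suc j) t)) (at t)" for j t
      using F'[of j t] by (rule has_field_derivative_Im)
  qed (use A(1) B(1) FA FB abs_Im_le_cmod order_trans in blast)+
  have "norm ((pderiv_dir i ^^ k) u x) = norm (F k 0)" by (simp add: nF)
  also have "\<dots> \<le> \<bar>Re (F k 0)\<bar> + \<bar>Im (F k 0)\<bar>" by (rule cmod_le)
  also have "\<dots> \<le> 4 * (4 * exp 1) ^ (2 * k) * sqrt (A * B)" using re im by simp
  finally show ?thesis .
qed

lemma fourier_pderiv_dir_funpow: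
  fixes u :: "real ^ 'n::finite \<Rightarrow> complex"
  assumes "smooth u" "\<And>l. rapid ((pderiv_dir i ^^ l) u)"
  shows "fourier ((pderiv_dir i ^^ k) u) \<xi> = (\<i> * of_real (\<xi> $ i)) ^ k * fourier u \<xi>"
proof (induction k)
  case (Suc k)
  have "fourier ((pderiv_dir i ^^ Suc k) u) \<xi> = \<i> * of_real (\<xi> $ i) * fourier ((pderiv_dir i ^^ k) u) \<xi>"
    using fourier_pderiv_dir[of "(pderiv_dir i ^^ k) u" i \<xi>] smooth_pderiv_dir_funpow[OF assms(1)]
      assms(2)[of k] assms(2)[of "Suc k"] by simp
  then show ?case by (simp add: Suc)
qed simp

text \<open>Differentiations are peeled off along suffixes of \<open>coords\<close>, because
  \<open>mderiv_suffix\<close> then presents every intermediate function as some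
  \<open>mderiv\<close>, for which rapid decay is assumed.\<close>

lemma norm_fourier_mderiv_le:
  fixes u :: "real ^ 'n::finite \<Rightarrow> complex"
  assumes u: "smooth u" "\<And>\<alpha>. rapid (mderiv \<alpha> u)"
  shows "norm (fourier (mderiv \<alpha> u) \<xi>) \<le> norm \<xi> ^ msize \<alpha> * norm (fourier u \<xi>)"
proof -
  have "norm (fourier (mderiv_along is \<alpha> u) \<xi>) \<le> norm \<xi> ^ (\<Sum>i\<leftarrow>is. \<alpha> i) * norm (fourier u \<xi>)"
    if "coords = js @ is" for js "is"
    using that
  proof (induction "is" arbitrary: js)
    case (Cons i "is")
    have "rapid ((pderiv_dir i ^^ l) (mderiv_along is \<alpha> u))" for l
      using mderiv_suffix[OF Cons.prems, of l \<alpha> u] u(2) by simp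
    then have "norm (fourier (mderiv_along (i # is) \<alpha> u) \<xi>)
        = \<bar>\<xi> $ i\<bar> ^ \<alpha> i * norm (fourier (mderiv_along is \<alpha> u) \<xi>)"
      by (simp add: fourier_pderiv_dir_funpow smooth_mderiv_along[OF u(1)] norm_mult norm_power)
    also have "\<dots> \<le> norm \<xi> ^ \<alpha> i * (norm \<xi> ^ (\<Sum>i\<leftarrow>is. \<alpha> i) * norm (fourier u \<xi>))"
      using Cons.IH[of "js @ [i]"] Cons.prems component_le_norm_cart[of \<xi> i]
      by (intro mult_mono power_mono) auto
    finally show ?case by (simp add: power_add mult_ac)
  qed simp
  from this[of "[]" coords] show ?thesis
    by (simp add: mderiv_eq_mderiv_along sum_list_distinct_conv_sum_set distinct_coords set_coords msize_def)
qed

lemma smooth_zero: "smooth 0"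
  unfolding zero_fun_def by (rule smooth_const)

lemma mderiv_zero_fun [simp]: "mderiv \<alpha> 0 = 0"
proof -
  have "mderiv \<alpha> (cscale 0 0) = cscale 0 (mderiv \<alpha> 0)" by (rule mderiv_cscale[OF smooth_zero])
  then show ?thesis by (simp add: cscale_def zero_fun_def)
qed

context weight
begin

text \<open>Real-valued counterpart of the inequality between \<open>q_norm\<close> and a constant,
  as \<open>r_bound\<close> is for \<open>r_norm\<close>; the translation for
  \<open>m \<ge> 1\<close> is in \<open>q_norm_le_iff\<close> and \<open>r_norm_le_iff\<close>. All
  estimates thereby stay within the reals.\<close>

definition q_bound :: "nat \<Rightarrow> nat \<Rightarrow> (real ^ 'n::finite \<Rightarrow> complex) \<Rightarrow> real \<Rightarrow> bool" where
  "q_bound m n f C \<longleftrightarrow> (\<forall>\<alpha> x. exp (real n * \<omega> (norm x)) * norm (mderiv \<alpha> f x) * w m (msize \<alpha>) \<le> C)"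

definition r_bound :: "nat \<Rightarrow> nat \<Rightarrow> (real ^ 'n::finite \<Rightarrow> complex) \<Rightarrow> real \<Rightarrow> bool" where
  "r_bound m n f C \<longleftrightarrow> (\<forall>\<alpha> x. norm (mderiv \<alpha> f x) * w m (msize \<alpha>) \<le> C * exp (real n * \<omega> (norm x)))"

lemma q_bound_nonneg:
  assumes "q_bound m n (f :: real ^ 'n::finite \<Rightarrow> complex) C"
  shows "C \<ge> 0"
proof -
  have "0 \<le> exp (real n * \<omega> (norm (0 :: real ^ 'n))) * norm (mderiv (\<lambda>_. 0) f 0) * w m (msize (\<lambda>_ :: 'n. 0))"
    by simp
  also have "\<dots> \<le> C" using assms by (simp only: q_bound_def)
  finally show ?thesis .
qed

lemma r_bound_nonneg:
  assumes "r_bound m n (f :: real ^ 'n::finite \<Rightarrow> complex) C"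
  shows "C \<ge> 0"
proof -
  have "0 \<le> norm (mderiv (\<lambda>_. 0) f 0) * w m (msize (\<lambda>_ :: 'n. 0))" by simp
  also have "\<dots> \<le> C * exp (real n * \<omega> (norm (0 :: real ^ 'n)))" using assms by (simp only: r_bound_def)
  finally show ?thesis by (simp add: zero_le_mult_iff)
qed

lemma q_bound_0: "q_bound m n 0 0"
  by (simp add: q_bound_def)

lemma q_bound_add:
  fixes f g :: "real ^ 'n::finite \<Rightarrow> complex"
  assumes "smooth f" "smooth g" "q_bound m n f C" "q_bound m n g D"
  shows "q_bound m n (f + g) (C + D)"
  unfolding q_bound_def
proof (intro allI)
  fix \<alpha> and x :: "real ^ 'n"
  let ?E = "exp (real n * \<omega> (norm x))"
  have "?E * norm (mderiv \<alpha> (f + g) x) * w m (msize \<alpha>)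
      \<le> ?E * (norm (mderiv \<alpha> f x) + norm (mderiv \<alpha> g x)) * w m (msize \<alpha>)"
    unfolding mderiv_add[OF assms(1,2)] plus_fun_apply
    by (intro mult_right_mono mult_left_mono norm_triangle_ineq) auto
  also have "\<dots> \<le> C + D"
    using assms(3,4) unfolding q_bound_def by (simp add: distrib_left distrib_right add_mono)
  finally show "?E * norm (mderiv \<alpha> (f + g) x) * w m (msize \<alpha>) \<le> C + D" .
qed

lemma q_bound_cscale:
  fixes f :: "real ^ 'n::finite \<Rightarrow> complex"
  assumes "smooth f" "q_bound m n f C"
  shows "q_bound m n (cscale c f) (norm c * C)"
  unfolding q_bound_def
proof (intro allI)
  fix \<alpha> and x :: "real ^ 'n"
  have "norm c * (exp (real n * \<omega> (norm x)) * norm (mderiv \<alpha> f x) * w m (msize \<alpha>)) \<le> norm c * C"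
    using assms(2) unfolding q_bound_def by (intro mult_left_mono) auto
  then show "exp (real n * \<omega> (norm x)) * norm (mderiv \<alpha> (cscale c f) x) * w m (msize \<alpha>) \<le> norm c * C"
    unfolding mderiv_cscale[OF assms(1)] by (simp add: cscale_def norm_mult mult_ac)
qed

lemma r_bound_add:
  fixes f g :: "real ^ 'n::finite \<Rightarrow> complex"
  assumes "smooth f" "smooth g" "r_bound m n f C" "r_bound m n g D"
  shows "r_bound m n (f + g) (C + D)"
  unfolding r_bound_def
proof (intro allI)
  fix \<alpha> and x :: "real ^ 'n"
  have "norm (mderiv \<alpha> (f + g) x) * w m (msize \<alpha>)
      \<le> (norm (mderiv \<alpha> f x) + norm (mderiv \<alpha> g x)) * w m (msize \<alpha>)"
    unfolding mderiv_add[OF assms(1,2)] plus_fun_apply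
    by (intro mult_right_mono norm_triangle_ineq) auto
  also have "\<dots> \<le> (C + D) * exp (real n * \<omega> (norm x))"
    using assms(3,4) unfolding r_bound_def by (simp add: distrib_right add_mono)
  finally show "norm (mderiv \<alpha> (f + g) x) * w m (msize \<alpha>) \<le> (C + D) * exp (real n * \<omega> (norm x))" .
qed

lemma r_bound_cscale:
  fixes f :: "real ^ 'n::finite \<Rightarrow> complex"
  assumes "smooth f" "r_bound m n f C"
  shows "r_bound m n (cscale c f) (norm c * C)"
  unfolding r_bound_def
proof (intro allI)
  fix \<alpha> and x :: "real ^ 'n"
  have "norm c * (norm (mderiv \<alpha> f x) * w m (msize \<alpha>)) \<le> norm c * (C * exp (real n * \<omega> (norm x)))"
    using assms(2) unfolding r_bound_def by (intro mult_left_mono) auto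
  then show "norm (mderiv \<alpha> (cscale c f) x) * w m (msize \<alpha>) \<le> norm c * C * exp (real n * \<omega> (norm x))"
    unfolding mderiv_cscale[OF assms(1)] by (simp add: cscale_def norm_mult mult_ac)
qed

lemma r_bound_mono:
  fixes f :: "real ^ 'n::finite \<Rightarrow> complex"
  assumes "r_bound m n f C" "n \<le> n'"
  shows "r_bound m n' f C"
  unfolding r_bound_def
proof (intro allI)
  fix \<alpha> and x :: "real ^ 'n"
  have "C \<ge> 0" using assms(1) by (rule r_bound_nonneg)
  have "norm (mderiv \<alpha> f x) * w m (msize \<alpha>) \<le> C * exp (real n * \<omega> (norm x))"
    using assms(1) by (simp add: r_bound_def)
  also have "\<dots> \<le> C * exp (real n' * \<omega> (norm x))"
    using assms(2) \<open>C \<ge> 0\<close> weight_nonneg[of "norm x"] by (auto intro!: mult_left_mono mult_right_mono)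
  finally show "norm (mderiv \<alpha> f x) * w m (msize \<alpha>) \<le> C * exp (real n' * \<omega> (norm x))" .
qed

text \<open>A description free of the Fourier transform; that it coincides with
  \<open>S_space\<close> is \<open>S_space_eq\<close>.\<close>

definition ultra_decay :: "(real ^ 'n::finite \<Rightarrow> complex) \<Rightarrow> bool" where
  "ultra_decay f \<longleftrightarrow> smooth f \<and> (\<forall>m n. \<exists>C. q_bound m n f C)"

lemma rapid_of_weight_decay:
  assumes "continuous_on UNIV f" "\<And>n. \<exists>C. \<forall>x. exp (real n * \<omega> (norm x)) * norm (f x) \<le> C"
  shows "rapid f"
  unfolding rapid_def
proof (intro conjI allI assms(1))
  fix M
  obtain n D where D: "D > 0" "\<And>t. t \<ge> 0 \<Longrightarrow> (1 + t) ^ M \<le> D * exp (real n * \<omega> t)"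
    using power_le_exp_weight[of M] by blast
  obtain C where C: "\<And>x. exp (real n * \<omega> (norm x)) * norm (f x) \<le> C" using assms(2)[of n] by blast
  have "(1 + norm x) ^ M * norm (f x) \<le> D * C" for x
  proof -
    have "(1 + norm x) ^ M * norm (f x) \<le> D * exp (real n * \<omega> (norm x)) * norm (f x)"
      by (intro mult_right_mono D(2)) auto
    also have "\<dots> \<le> D * C" using C[of x] D(1) by (simp add: mult.assoc)
    finally show ?thesis .
  qed
  then show "\<exists>C. \<forall>x. (1 + norm x) ^ M * norm (f x) \<le> C" by blast
qed

text \<open>\<open>m\<close> is chosen after \<alpha>, so that the weight of its order is positive
  and can be divided away.\<close>

lemma ultra_decay_mderiv_bound:
  assumes "ultra_decay f"
  shows "\<exists>C. \<forall>x. exp (real n * \<omega> (norm x)) * norm (mderiv \<alpha> f x) \<le> C"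
proof -
  obtain m where m: "w m (msize \<alpha>) > 0" using conj_weight_pos by blast
  obtain C where C: "\<And>\<alpha> x. exp (real n * \<omega> (norm x)) * norm (mderiv \<alpha> f x) * w m (msize \<alpha>) \<le> C"
    using assms unfolding ultra_decay_def q_bound_def by blast
  have "exp (real n * \<omega> (norm x)) * norm (mderiv \<alpha> f x) \<le> C / w m (msize \<alpha>)" for x
    using C[of x \<alpha>] m by (simp add: pos_le_divide_eq)
  then show ?thesis by blast
qed

lemma ultra_decay_rapid:
  assumes "ultra_decay f"
  shows "rapid (mderiv \<alpha> f)"
proof (rule rapid_of_weight_decay)
  show "continuous_on UNIV (mderiv \<alpha> f)"
    using assms by (intro smooth_continuous smooth_mderiv) (simp add: ultra_decay_def)
qed (rule ultra_decay_mderiv_bound[OF assms])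

section \<open>From membership in \<open>S_space\<close> to uniform control of all
  derivatives\<close>

lemma S_space_weight_decay:
  assumes "f \<in> S_space \<omega>"
  shows "\<exists>C. \<forall>x. exp (real n * \<omega> (norm x)) * norm (mderiv \<alpha> f x) \<le> C"
    and "\<exists>C. \<forall>x. exp (real n * \<omega> (norm x)) * norm (fourier f x) \<le> C"
proof -
  have *: "\<exists>C. \<forall>x. exp (real n * \<omega> (norm x)) * norm (g x) \<le> C"
    \<comment> \<open>\<open>S_space\<close> speaks of positive exponents only, whereas
      \<open>n\<close> may be 0; hence \<open>Suc n\<close>.\<close>
    if "bounded (range (\<lambda>x. exp (real (Suc n) * \<omega> (norm x)) *\<^sub>R (g x :: complex)))" for g :: "real ^ 'n \<Rightarrow> complex"
  proof -
    obtain C where C: "\<And>x. norm (exp (real (Suc n) * \<omega> (norm x)) *\<^sub>R g x) \<le> C"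
      using \<open>bounded _\<close> by (auto simp: bounded_iff)
    have "exp (real n * \<omega> (norm x)) * norm (g x) \<le> C" for x
    proof -
      have "real n * \<omega> (norm x) \<le> real (Suc n) * \<omega> (norm x)"
        by (intro mult_right_mono weight_nonneg) auto
      then have "exp (real n * \<omega> (norm x)) * norm (g x) \<le> exp (real (Suc n) * \<omega> (norm x)) * norm (g x)"
        by (intro mult_right_mono) auto
      also have "\<dots> \<le> C" using C[of x] by simp
      finally show ?thesis .
    qed
    then show ?thesis by blast
  qed
  have "bounded (range (\<lambda>x. exp (real (Suc n) * \<omega> (norm x)) *\<^sub>R mderiv \<alpha> f x))"
    using assms unfolding S_space_def mem_Collect_eq by (metis of_nat_0_less_iff zero_less_Suc)
  then show "\<exists>C. \<forall>x. exp (real n * \<omega> (norm x)) * norm (mderiv \<alpha> f x) \<le> C" by (rule *)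
  have "bounded (range (\<lambda>x. exp (real (Suc n) * \<omega> (norm x)) *\<^sub>R mderiv (\<lambda>_. 0) (fourier f) x))"
    using assms unfolding S_space_def mem_Collect_eq by (metis of_nat_0_less_iff zero_less_Suc)
  then show "\<exists>C. \<forall>x. exp (real n * \<omega> (norm x)) * norm (fourier f x) \<le> C" unfolding mderiv_0 by (rule *)
qed

lemma S_space_smooth: "f \<in> S_space \<omega> \<Longrightarrow> smooth f"
  by (simp add: S_space_def)

lemma S_space_rapid: "f \<in> S_space \<omega> \<Longrightarrow> rapid (mderiv \<alpha> f)"
  by (intro rapid_of_weight_decay smooth_continuous smooth_mderiv S_space_smooth S_space_weight_decay)

lemma S_space_fourier_rapid: "f \<in> S_space \<omega> \<Longrightarrow> rapid (fourier f)"
  by (intro rapid_of_weight_decay S_space_weight_decay smooth_continuous) (simp add: S_space_def)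

text \<open>Apply the inversion bound to each derivative. In the integral,
  \<open>norm \<xi> ^ k * w m k\<close> is at most \<open>exp (m * \<omega> (norm \<xi>))\<close>,
  and the decay of the transform with index \<open>m + n0\<close> beats this with an integrable
  function to spare, uniformly in the order.\<close>

lemma S_space_mderiv_bound:
  fixes f :: "real ^ 'n::finite \<Rightarrow> complex"
  assumes f: "f \<in> S_space \<omega>"
  shows "\<exists>C. \<forall>\<alpha> x. norm (mderiv \<alpha> f x) * w m (msize \<alpha>) \<le> C"
proof -
  obtain K where K: "K > 0" "\<And>u x. rapid u \<Longrightarrow> integrable lborel (fourier u) \<Longrightarrow>
     norm (u x) \<le> K * (LINT \<xi>|lborel. norm (fourier u (\<xi> :: real ^ 'n)))"
    using fourier_inversion_bound by blast
  define J where "J = (\<lambda>\<xi> :: real ^ 'n. 1 / (1 + norm \<xi>) ^ (2 * CARD('n)))"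
  have iJ: "integrable lborel J" unfolding J_def by (rule integrable_inverse_power_norm)
  have J0: "J \<xi> \<ge> 0" for \<xi> by (simp add: J_def)
  obtain n0 D where D: "D > 0" "\<And>t. t \<ge> 0 \<Longrightarrow> (1 + t) ^ (2 * CARD('n)) \<le> D * exp (real n0 * \<omega> t)"
    using power_le_exp_weight[of "2 * CARD('n)"] by blast
  obtain C where C: "\<And>\<xi>. exp (real (m + n0) * \<omega> (norm \<xi>)) * norm (fourier f \<xi>) \<le> C"
    using S_space_weight_decay(2)[OF f] by blast
  have "C \<ge> 0" using C[of 0] by (rule order_trans[rotated]) simp
  have pt: "norm \<xi> ^ k * norm (fourier f \<xi>) * w m k \<le> C * D * J \<xi>" for k \<xi>
  proof -
    have pos: "(1 + norm \<xi>) ^ (2 * CARD('n)) > 0" by (intro zero_less_power add_pos_nonneg) auto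
    have "norm \<xi> ^ k * norm (fourier f \<xi>) * w m k = (norm \<xi> ^ k * w m k) * norm (fourier f \<xi>)" by simp
    also have "\<dots> \<le> exp (real m * \<omega> (norm \<xi>)) * norm (fourier f \<xi>)"
      by (intro mult_right_mono power_mult_conj_weight_le) auto
    finally have "norm \<xi> ^ k * norm (fourier f \<xi>) * w m k * (1 + norm \<xi>) ^ (2 * CARD('n))
        \<le> exp (real m * \<omega> (norm \<xi>)) * norm (fourier f \<xi>) * (D * exp (real n0 * \<omega> (norm \<xi>)))"
      by (rule mult_mono[OF _ D(2)]) auto
    also have "\<dots> = D * (exp (real (m + n0) * \<omega> (norm \<xi>)) * norm (fourier f \<xi>))"
      by (simp add: distrib_right exp_add)
    also have "\<dots> \<le> D * C" using C[of \<xi>] D(1) by simp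
    finally show ?thesis using pos by (simp add: J_def pos_le_divide_eq mult_ac)
  qed
  have "norm (mderiv \<alpha> f x) * w m (msize \<alpha>) \<le> K * (C * D * (LINT \<xi>|lborel. J \<xi>))" for \<alpha> x
  proof -
    let ?u = "mderiv \<alpha> f"
    have ru: "rapid ?u" by (rule S_space_rapid[OF f])
    have le: "norm (fourier ?u \<xi>) \<le> norm \<xi> ^ msize \<alpha> * norm (fourier f \<xi>)" for \<xi>
      by (rule norm_fourier_mderiv_le[OF S_space_smooth[OF f] S_space_rapid[OF f]])
    have meas: "fourier ?u \<in> borel_measurable borel" by (intro smooth_borel_measurable smooth_fourier ru)
    \<comment> \<open>This \<open>B\<close> depends on \<alpha> and is used only for integrability;
      the uniform constant comes from \<open>pt\<close>.\<close>
    obtain B where B: "B \<ge> 0" "\<And>\<xi>. norm (fourier f \<xi>) \<le> B * (1 / (1 + norm \<xi>) ^ (msize \<alpha> + 2 * CARD('n)))"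
      using rapid_bound[OF S_space_fourier_rapid[OF f]] by blast
    have "integrable lborel (fourier ?u)"
    proof (rule Bochner_Integration.integrable_bound[OF integrable_mult_right[OF iJ, of B]])
      show "AE \<xi> in lborel. norm (fourier ?u \<xi>) \<le> norm (B * J \<xi>)"
      proof (rule AE_I2)
        fix \<xi> :: "real ^ 'n"
        have pos: "1 + norm \<xi> > 0" by (simp add: add_pos_nonneg)
        have "norm (fourier ?u \<xi>) \<le> (1 + norm \<xi>) ^ msize \<alpha> * (B * (1 / (1 + norm \<xi>) ^ (msize \<alpha> + 2 * CARD('n))))"
          by (rule order_trans[OF le]) (intro mult_mono power_mono B(2), auto)
        also have "\<dots> = B * J \<xi>" using pos by (simp add: J_def power_add)
        finally show "norm (fourier ?u \<xi>) \<le> norm (B * J \<xi>)" by simp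
      qed
    qed (use meas in simp)
    from K(2)[OF ru this, of x]
    have "norm (?u x) * w m (msize \<alpha>) \<le> K * (LINT \<xi>|lborel. norm (fourier ?u \<xi>)) * w m (msize \<alpha>)"
      by (intro mult_right_mono) auto
    also have "\<dots> = K * (LINT \<xi>|lborel. norm (fourier ?u \<xi>) * w m (msize \<alpha>))"
      by simp
    also have "\<dots> \<le> K * (LINT \<xi>|lborel. C * D * J \<xi>)"
    proof (intro mult_left_mono integral_mono_AE' AE_I2)
      fix \<xi> :: "real ^ 'n"
      have "norm (fourier ?u \<xi>) * w m (msize \<alpha>) \<le> norm \<xi> ^ msize \<alpha> * norm (fourier f \<xi>) * w m (msize \<alpha>)"
        by (intro mult_right_mono le) auto
      also note pt
      finally show "norm (fourier ?u \<xi>) * w m (msize \<alpha>) \<le> C * D * J \<xi>" .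
    qed (use iJ J0 \<open>C \<ge> 0\<close> D(1) K(1) in auto)
    also have "\<dots> = K * (C * D * (LINT \<xi>|lborel. J \<xi>))" by simp
    finally show ?thesis .
  qed
  then show ?thesis by blast
qed

text \<open>Coordinates are added one at a time along suffixes of \<open>coords\<close>. The
  \<open>k\<close>-th derivative in the new coordinate is interpolated between the function already
  treated, whose weighted decay with doubled indices is the induction hypothesis, and its derivative
  of order \<open>2 * k\<close>, for which \<open>S_space_mderiv_bound\<close> suffices.\<close>

lemma S_space_ultra_decay:
  fixes f :: "real ^ 'n::finite \<Rightarrow> complex"
  assumes f: "f \<in> S_space \<omega>"
  shows "ultra_decay f"
proof -
  have sm: "smooth f" by (rule S_space_smooth[OF f])
  have "\<forall>m n. \<exists>C. \<forall>\<alpha> x. exp (real n * \<omega> (norm x)) * norm (mderiv_along is \<alpha> f x) * w m (sum \<alpha> (set is)) \<le> C"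
    if "coords = js @ is" for js "is"
    using that
  proof (induction "is" arbitrary: js)
    case Nil
    show ?case
    proof (intro allI)
      fix m n
      obtain C where C: "\<And>x. exp (real n * \<omega> (norm x)) * norm (f x) \<le> C"
        using S_space_weight_decay(1)[OF f, of n "\<lambda>_. 0"] by auto
      have "exp (real n * \<omega> (norm x)) * norm (f x) * w m 0 \<le> C" for x
      proof -
        have "exp (real n * \<omega> (norm x)) * norm (f x) * w m 0 \<le> exp (real n * \<omega> (norm x)) * norm (f x) * 1"
          by (intro mult_left_mono conj_weight_le_1) auto
        also have "\<dots> \<le> C" using C[of x] by simp
        finally show ?thesis .
      qed
      then show "\<exists>C. \<forall>\<alpha> x. exp (real n * \<omega> (norm x)) * norm (mderiv_along [] \<alpha> f x) * w m (sum \<alpha> (set [])) \<le> C"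
        by auto
    qed
  next
    case (Cons i "is")
    have dist: "distinct (i # is)" using distinct_coords Cons.prems by (metis distinct_append)
    show ?case
    proof (intro allI)
      fix m n
      \<comment> \<open>The base of the geometric constant of the interpolation; its powers are
        absorbed by passing from \<open>m\<close> to \<open>m1\<close>.\<close>
      define c :: real where "c = (4 * exp 1)\<^sup>2"
      have c: "c \<ge> 1"
      proof -
        have "(1::real) \<le> 4 * exp 1" using exp_ge_add_one_self[of 1] by simp
        then show ?thesis unfolding c_def by (rule one_le_power)
      qed
      obtain m1 D where D: "m1 \<ge> m" "D > 0" "\<And>k. c ^ k * w m k \<le> D * w m1 k"
        using conj_weight_absorb[of c m] c by auto
      obtain C0 where C0: "\<And>\<alpha> x. exp (real (2 * n) * \<omega> (norm x)) * norm (mderiv_along is \<alpha> f x) * w (2 * m1) (sum \<alpha> (set is)) \<le> C0"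
        using Cons.IH[of "js @ [i]"] Cons.prems by (metis append.assoc append_Cons append_Nil)
      obtain B0 where B0: "\<And>\<alpha> x. norm (mderiv \<alpha> f x) * w (2 * m1) (msize \<alpha>) \<le> B0"
        using S_space_mderiv_bound[OF f] by blast
      \<comment> \<open>Enlarged to be strictly positive, as the interpolation requires.\<close>
      define C1 where "C1 = \<bar>C0\<bar> + 1"
      define B1 where "B1 = \<bar>B0\<bar> + 1"
      have C1: "C1 > 0" "\<And>\<alpha> x. exp (real (2 * n) * \<omega> (norm x)) * norm (mderiv_along is \<alpha> f x) * w (2 * m1) (sum \<alpha> (set is)) \<le> C1"
        using order_trans[OF C0, of C1] by (simp_all add: C1_def)
      have B1: "B1 > 0" "\<And>\<alpha> x. norm (mderiv \<alpha> f x) * w (2 * m1) (msize \<alpha>) \<le> B1"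
        using order_trans[OF B0, of B1] by (simp_all add: B1_def)
      have "exp (real n * \<omega> (norm x)) * norm (mderiv_along (i # is) \<alpha> f x) * w m (sum \<alpha> (set (i # is))) \<le> 4 * D * sqrt (C1 * B1)" for \<alpha> x
      proof -
        define k where "k = \<alpha> i"
        define a where "a = sum \<alpha> (set is)"
        have sz: "sum \<alpha> (set (i # is)) = a + k" using dist by (simp add: a_def k_def)
        let ?u = "mderiv_along is \<alpha> f"
        define W where "W = w m1 (a + k)"
        show ?thesis
        \<comment> \<open>If \<open>W\<close> vanishes, the choice of \<open>D\<close> forces
          \<open>w m (a + k)\<close> to vanish as well and the claim is trivial. Otherwise
          \<open>WW\<close> below makes \<open>wa\<close> and \<open>wb\<close> positive.\<close>
        proof (cases "W = 0")
          case True
          have "c ^ (a + k) * w m (a + k) \<le> 0" using D(3)[of "a + k"] True by (simp add: W_def)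
          moreover have "0 < c ^ (a + k)" using c by simp
          ultimately have "w m (a + k) = 0"
            using conj_weight_nonneg[of m "a + k"] by (metis linorder_not_less mult_pos_pos order_less_le)
          then show ?thesis using D(2) C1(1) B1(1) unfolding sz by simp
        next
          case False
          then have W: "W > 0" using conj_weight_nonneg[of m1 "a + k"] by (simp add: W_def order_less_le)
          define wa where "wa = w (2 * m1) a"
          define wb where "wb = w (2 * m1) (a + 2 * k)"
          \<comment> \<open>The weights match the geometric mean: twice the order
            \<open>a + k\<close> is split into the orders \<open>a\<close> and
            \<open>a + 2 * k\<close> of the two interpolated functions.\<close>
          have "W\<^sup>2 \<le> w (2 * m1) (2 * (a + k))" unfolding W_def by (rule conj_weight_double)
          also have "2 * (a + k) = a + (a + 2 * k)" by simp
          also have "w (2 * m1) (a + (a + 2 * k)) \<le> wa * wb" unfolding wa_def wb_def by (rule conj_weight_add_le)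
          finally have WW: "W\<^sup>2 \<le> wa * wb" .
          then have "wa * wb > 0" using W by (auto intro: less_le_trans[OF zero_less_power])
          moreover have "wa \<ge> 0" "wb \<ge> 0" by (auto simp: wa_def wb_def)
          ultimately have wab: "wa > 0" "wb > 0" by (auto simp: zero_less_mult_iff)
          define E where "E = exp (real n * \<omega> (norm x))"
          have E: "E > 0" by (simp add: E_def)
          have E2: "E\<^sup>2 = exp (real (2 * n) * \<omega> (norm x))"
            by (simp add: E_def power2_eq_square flip: exp_add)
          have "norm ((pderiv_dir i ^^ k) ?u x) \<le> 4 * (4 * exp 1) ^ (2 * k) * sqrt (C1 / (E\<^sup>2 * wa) * (B1 / wb))"
          proof (rule norm_pderiv_dir_funpow_interpolation)
            show "smooth ?u" by (rule smooth_mderiv_along[OF sm])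
            show "C1 / (E\<^sup>2 * wa) > 0" "B1 / wb > 0" using C1(1) B1(1) E wab by auto
            fix y :: "real ^ 'n"
            show "norm ((pderiv_dir i ^^ (2 * k)) ?u y) \<le> B1 / wb"
            proof -
              have "norm ((pderiv_dir i ^^ (2 * k)) ?u y) * wb \<le> B1"
                using B1(2)[of "\<lambda>j. if j \<in> set is then \<alpha> j else if j = i then 2 * k else 0" y]
                unfolding mderiv_suffix[OF Cons.prems] msize_suffix[OF dist] wb_def a_def .
              then show ?thesis using wab by (simp add: pos_le_divide_eq)
            qed
            assume y: "norm x \<le> norm y"
            have "E\<^sup>2 \<le> exp (real (2 * n) * \<omega> (norm y))"
              unfolding E2 using y by (auto intro!: mult_left_mono weight_mono)
            then have "E\<^sup>2 * norm (?u y) * wa \<le> exp (real (2 * n) * \<omega> (norm y)) * norm (?u y) * wa"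
              using wab by (intro mult_right_mono) auto
            also have "\<dots> \<le> C1" unfolding wa_def a_def by (rule C1(2))
            finally show "norm (?u y) \<le> C1 / (E\<^sup>2 * wa)" using E wab by (simp add: pos_le_divide_eq mult_ac)
          qed
          also have "sqrt (C1 / (E\<^sup>2 * wa) * (B1 / wb)) \<le> sqrt (C1 * B1 / (E * W)\<^sup>2)"
          proof (rule real_sqrt_le_mono)
            have "C1 / (E\<^sup>2 * wa) * (B1 / wb) = C1 * B1 / (E\<^sup>2 * (wa * wb))" by simp
            also have "\<dots> \<le> C1 * B1 / (E\<^sup>2 * W\<^sup>2)"
              using WW C1(1) B1(1) E W wab by (intro divide_left_mono mult_left_mono mult_pos_pos) auto
            finally show "C1 / (E\<^sup>2 * wa) * (B1 / wb) \<le> C1 * B1 / (E * W)\<^sup>2" by (simp add: power_mult_distrib)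
          qed
          also have "sqrt (C1 * B1 / (E * W)\<^sup>2) = sqrt (C1 * B1) / (E * W)"
            using E W by (simp add: real_sqrt_divide)
          also have "(4 * exp 1) ^ (2 * k) = c ^ k" by (simp only: c_def power_mult)
          finally have "norm ((pderiv_dir i ^^ k) ?u x) \<le> 4 * c ^ k * (sqrt (C1 * B1) / (E * W))" by simp
          \<comment> \<open>Raised to the full order, since the absorption compares
            \<open>c ^ j\<close> and \<open>w m j\<close> for the same \<open>j\<close>.\<close>
          also have "\<dots> \<le> 4 * c ^ (a + k) * (sqrt (C1 * B1) / (E * W))"
            using c C1(1) B1(1) E W by (intro mult_right_mono mult_left_mono power_increasing) auto
          finally have "E * norm ((pderiv_dir i ^^ k) ?u x) * w m (a + k)
              \<le> E * (4 * c ^ (a + k) * (sqrt (C1 * B1) / (E * W))) * w m (a + k)"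
            using E by (intro mult_right_mono mult_left_mono) auto
          also have "\<dots> = 4 * (c ^ (a + k) * w m (a + k)) * sqrt (C1 * B1) / W"
            using E W by (simp add: field_simps)
          also have "\<dots> \<le> 4 * (D * W) * sqrt (C1 * B1) / W"
            using D(3)[of "a + k"] W C1(1) B1(1) unfolding W_def[symmetric]
            by (intro divide_right_mono mult_right_mono mult_left_mono) auto
          also have "\<dots> = 4 * D * sqrt (C1 * B1)" using W by simp
          finally show ?thesis unfolding sz E_def[symmetric] by (simp add: k_def)
        qed
      qed
      then show "\<exists>C. \<forall>\<alpha> x. exp (real n * \<omega> (norm x)) * norm (mderiv_along (i # is) \<alpha> f x) * w m (sum \<alpha> (set (i # is))) \<le> C"
        by blast
    qed
  qed
  from this[of "[]" coords] show ?thesis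
    by (simp add: ultra_decay_def q_bound_def sm mderiv_eq_mderiv_along set_coords msize_def)
qed

text \<open>Submultiplicativity distributes \<open>w m'\<close> over the two factors of each Leibniz
  term, and passing from \<open>m'\<close> back to \<open>m\<close> absorbs the number of terms.
  Everything happens at one point \<open>x\<close>, so \<open>R\<close> and \<open>B\<close> may
  carry spatial weights.\<close>

lemma mderiv_mult_bound:
  "\<exists>m'\<ge>m. \<exists>D>0. \<forall>(f :: real ^ 'n::finite \<Rightarrow> complex) g R B \<alpha> x. smooth f \<longrightarrow> smooth g \<longrightarrow> R \<ge> 0 \<longrightarrow> B \<ge> 0 \<longrightarrow>
     (\<forall>\<beta>. norm (mderiv \<beta> f x) * w m' (msize \<beta>) \<le> R) \<longrightarrow>
     (\<forall>\<gamma>. norm (mderiv \<gamma> g x) * w m' (msize \<gamma>) \<le> B) \<longrightarrow>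
     norm (mderiv \<alpha> (f * g) x) * w m (msize \<alpha>) \<le> D * R * B"
proof -
  obtain m' D where D: "m' \<ge> m" "D > 0" "\<And>k. 2 ^ k * w m k \<le> D * w m' k"
    using conj_weight_absorb_2 by blast
  have "norm (mderiv \<alpha> (f * g) x) * w m (msize \<alpha>) \<le> D * R * B"
    if s: "smooth f" "smooth g" and RB: "R \<ge> 0" "B \<ge> 0"
      and f: "\<And>\<beta>. norm (mderiv \<beta> f x) * w m' (msize \<beta>) \<le> R"
      and g: "\<And>\<gamma>. norm (mderiv \<gamma> g x) * w m' (msize \<gamma>) \<le> B"
    for f g :: "real ^ 'n \<Rightarrow> complex" and R B \<alpha> x
  proof (cases "w m' (msize \<alpha>) = 0")
    case True
    have "2 ^ msize \<alpha> * w m (msize \<alpha>) \<le> 0" using D(3)[of "msize \<alpha>"] True by simp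
    moreover have "(0 :: real) < 2 ^ msize \<alpha>" by simp
    ultimately have "w m (msize \<alpha>) = 0"
      using conj_weight_nonneg[of m "msize \<alpha>"] by (metis linorder_not_less mult_pos_pos order_less_le)
    then show ?thesis using RB D(2) by simp
  next
    case False
    define W where "W = w m' (msize \<alpha>)"
    have W: "W > 0" using False conj_weight_nonneg[of m' "msize \<alpha>"] by (simp add: W_def order_less_le)
    have "norm (mderiv \<alpha> (f * g) x) \<le> 2 ^ msize \<alpha> * (R * B / W)"
    proof (rule norm_mderiv_mult_le[OF s])
      fix \<beta> \<gamma> :: "'n \<Rightarrow> nat" assume sz: "msize \<beta> + msize \<gamma> = msize \<alpha>"
      have "norm (mderiv \<beta> f x) * norm (mderiv \<gamma> g x) * W
          \<le> norm (mderiv \<beta> f x) * norm (mderiv \<gamma> g x) * (w m' (msize \<beta>) * w m' (msize \<gamma>))"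
        unfolding W_def sz[symmetric] by (intro mult_left_mono conj_weight_add_le) auto
      also have "\<dots> = (norm (mderiv \<beta> f x) * w m' (msize \<beta>)) * (norm (mderiv \<gamma> g x) * w m' (msize \<gamma>))"
        by simp
      also have "\<dots> \<le> R * B" by (intro mult_mono f g RB) auto
      finally show "norm (mderiv \<beta> f x) * norm (mderiv \<gamma> g x) \<le> R * B / W"
        using W by (simp add: pos_le_divide_eq)
    qed
    then have "norm (mderiv \<alpha> (f * g) x) * w m (msize \<alpha>) \<le> 2 ^ msize \<alpha> * (R * B / W) * w m (msize \<alpha>)"
      by (intro mult_right_mono) auto
    also have "\<dots> = (2 ^ msize \<alpha> * w m (msize \<alpha>)) * (R * B / W)" by simp
    also have "\<dots> \<le> (D * W) * (R * B / W)"
      unfolding W_def using D(3)[of "msize \<alpha>"] RB by (intro mult_right_mono) auto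
    also have "\<dots> = D * R * B" using W by simp
    finally show ?thesis .
  qed
  then show ?thesis using D(1,2) by blast
qed

text \<open>The extra weight \<open>k\<close> on \<open>g\<close> pays for the growth of
  \<open>f\<close>. That \<open>m'\<close> depends on \<open>m\<close> alone is essential: the index
  \<open>k\<close> of a multiplier is known only after \<open>m'\<close> has been fixed.\<close>

lemma q_bound_mult:
  "\<exists>m'\<ge>m. \<exists>D>0. \<forall>(f :: real ^ 'n::finite \<Rightarrow> complex) g R B n k. smooth f \<longrightarrow> smooth g \<longrightarrow>
     r_bound m' k f R \<longrightarrow> q_bound m' (n + k) g B \<longrightarrow> q_bound m n (f * g) (D * R * B)"
proof -
  obtain m' D where D: "m' \<ge> m" "D > 0" "\<And>(f :: real ^ 'n \<Rightarrow> complex) g R B \<alpha> x. smooth f \<Longrightarrow> smooth g \<Longrightarrow> R \<ge> 0 \<Longrightarrow> B \<ge> 0 \<Longrightarrow>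
     (\<forall>\<beta>. norm (mderiv \<beta> f x) * w m' (msize \<beta>) \<le> R) \<Longrightarrow>
     (\<forall>\<gamma>. norm (mderiv \<gamma> g x) * w m' (msize \<gamma>) \<le> B) \<Longrightarrow>
     norm (mderiv \<alpha> (f * g) x) * w m (msize \<alpha>) \<le> D * R * B"
    using mderiv_mult_bound[of m, where 'n = 'n] by blast
  have "q_bound m n (f * g) (D * R * B)"
    if s: "smooth f" "smooth g" and R: "r_bound m' k f R" and B: "q_bound m' (n + k) g B"
    for f g :: "real ^ 'n \<Rightarrow> complex" and R B n k
    unfolding q_bound_def
  proof (intro allI)
    fix \<alpha> and x :: "real ^ 'n"
    let ?E = "\<lambda>j. exp (real j * \<omega> (norm x))"
    have RB: "R \<ge> 0" "B \<ge> 0" using R B r_bound_nonneg q_bound_nonneg by blast+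
    have "norm (mderiv \<alpha> (f * g) x) * w m (msize \<alpha>) \<le> D * (R * ?E k) * (B / ?E (n + k))"
    proof (rule D(3)[OF s])
      show "\<forall>\<beta>. norm (mderiv \<beta> f x) * w m' (msize \<beta>) \<le> R * ?E k" using R by (simp add: r_bound_def)
      show "\<forall>\<gamma>. norm (mderiv \<gamma> g x) * w m' (msize \<gamma>) \<le> B / ?E (n + k)"
        using B unfolding q_bound_def by (simp add: pos_le_divide_eq mult_ac)
    qed (use RB in auto)
    also have "\<dots> = D * R * B / ?E n" by (simp add: distrib_right exp_add)
    finally show "?E n * norm (mderiv \<alpha> (f * g) x) * w m (msize \<alpha>) \<le> D * R * B"
      by (simp add: pos_le_divide_eq mult_ac)
  qed
  then show ?thesis using D(1,2) by blast
qed

lemma ultra_decay_mult: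
  fixes f g :: "real ^ 'n::finite \<Rightarrow> complex"
  assumes f: "smooth f" "\<And>m. \<exists>k R. r_bound m k f R" and g: "ultra_decay g"
  shows "ultra_decay (f * g)"
  unfolding ultra_decay_def
proof (intro conjI allI)
  have sg: "smooth g" using g by (simp add: ultra_decay_def)
  show "smooth (f * g)" by (rule smooth_mult[OF f(1) sg])
  fix m n
  obtain m' D where D: "\<And>(f :: real ^ 'n \<Rightarrow> complex) g R B n k. smooth f \<Longrightarrow> smooth g \<Longrightarrow>
     r_bound m' k f R \<Longrightarrow> q_bound m' (n + k) g B \<Longrightarrow> q_bound m n (f * g) (D * R * B)"
    using q_bound_mult[of m, where 'n = 'n] by blast
  obtain k R where R: "r_bound m' k f R" using f(2)[of m'] by blast
  obtain B where "q_bound m' (n + k) g B" using g unfolding ultra_decay_def by blast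
  from D[OF f(1) sg R this] show "\<exists>C. q_bound m n (f * g) C" by blast
qed

section \<open>From uniform control of all derivatives back to membership in
  \<open>S_space\<close>\<close>

lemma ultra_decay_cscale: "ultra_decay f \<Longrightarrow> ultra_decay (cscale c f)"
  unfolding ultra_decay_def by (blast intro: smooth_cscale q_bound_cscale)

text \<open>A coordinate function is a multiplier, with the same constant and growth index for every
  \<open>m\<close>, so this is a case of \<open>ultra_decay_mult\<close>.\<close>

lemma ultra_decay_mult_coord:
  assumes "ultra_decay h"
  shows "ultra_decay (mult_coord j h)"
proof -
  obtain n D where D: "D > 0" "\<And>t. t \<ge> 0 \<Longrightarrow> (1 + t) ^ 1 \<le> D * exp (real n * \<omega> t)"
    using power_le_exp_weight[of 1] by blast
  have "norm (mderiv \<alpha> (\<lambda>x. complex_of_real (x $ j)) x) * w m (msize \<alpha>) \<le> D * exp (real n * \<omega> (norm x))" for \<alpha> m x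
  proof -
    have "norm (mderiv \<alpha> (\<lambda>x. complex_of_real (x $ j)) x) \<le> 1 + norm x"
      using mderiv_component_cases[of \<alpha> j] component_le_norm_cart[of x j] by (auto intro: add_increasing add_nonneg_nonneg)
    then have "norm (mderiv \<alpha> (\<lambda>x. complex_of_real (x $ j)) x) * w m (msize \<alpha>) \<le> (1 + norm x) * 1"
      by (intro mult_mono conj_weight_le_1) auto
    also have "\<dots> \<le> D * exp (real n * \<omega> (norm x))" using D(2)[of "norm x"] by simp
    finally show ?thesis .
  qed
  then have "r_bound m n (\<lambda>x. complex_of_real (x $ j)) D" for m
    by (simp add: r_bound_def)
  then have "ultra_decay ((\<lambda>x. complex_of_real (x $ j)) * h)"
    by (intro ultra_decay_mult smooth_component assms) blast
  from ultra_decay_cscale[OF this, of "- \<i>"]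
  have "ultra_decay (cscale (- \<i>) ((\<lambda>x. complex_of_real (x $ j)) * h))" .
  also have "cscale (- \<i>) ((\<lambda>x. complex_of_real (x $ j)) * h) = mult_coord j h"
    by (simp add: mult_coord_def cscale_def times_fun_def fun_eq_iff)
  finally show ?thesis .
qed

lemma norm_le_card_mult_component:
  fixes \<xi> :: "real ^ 'n::finite"
  obtains j where "norm \<xi> \<le> real CARD('n) * \<bar>\<xi> $ j\<bar>"
proof -
  have "Max (range (\<lambda>i. \<bar>\<xi> $ i\<bar>)) \<in> range (\<lambda>i. \<bar>\<xi> $ i\<bar>)" by (intro Max_in) auto
  then obtain j where "Max (range (\<lambda>i. \<bar>\<xi> $ i\<bar>)) = \<bar>\<xi> $ j\<bar>" by blast
  then have j: "\<bar>\<xi> $ i\<bar> \<le> \<bar>\<xi> $ j\<bar>" for i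
    using Max_ge[of "range (\<lambda>i. \<bar>\<xi> $ i\<bar>)" "\<bar>\<xi> $ i\<bar>"] by simp
  have "norm \<xi> \<le> (\<Sum>i\<in>UNIV. \<bar>\<xi> $ i\<bar>)" by (rule norm_le_l1_cart)
  also have "\<dots> \<le> (\<Sum>i\<in>(UNIV :: 'n set). \<bar>\<xi> $ j\<bar>)" by (intro sum_mono j)
  finally show ?thesis using that by simp
qed

text \<open>The exponential weight at \<xi> is at most \<open>norm \<xi>\<close> times a single term
  \<open>norm \<xi> ^ k * w (n + n1) k\<close>, with \<open>k\<close> depending on \<xi>. Replacing
  \<open>norm \<xi>\<close> by the largest coordinate turns the power into the transform of a pure
  derivative of order \<open>k\<close>, which is bounded by an integral uniformly in
  \<open>k\<close>. Inside the unit ball the weight is trivial.\<close>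

lemma ultra_decay_fourier_bound:
  fixes h :: "real ^ 'n::finite \<Rightarrow> complex"
  assumes h: "ultra_decay h"
  shows "\<exists>C. \<forall>\<xi>. exp (real n * \<omega> (norm \<xi>)) * norm (fourier h \<xi>) \<le> C"
proof -
  define J where "J = (\<lambda>\<xi> :: real ^ 'n. 1 / (1 + norm \<xi>) ^ (2 * CARD('n)))"
  have iJ: "integrable lborel J" unfolding J_def by (rule integrable_inverse_power_norm)
  have J0: "J \<xi> \<ge> 0" for \<xi> by (simp add: J_def)
  define N where "N = real CARD('n)"
  have N: "N \<ge> 0" by (simp add: N_def)
  \<comment> \<open>\<open>n1\<close> cancels the stray factor \<open>norm \<xi>\<close> in
    \<open>exp_weight_le_conj_weight\<close>, \<open>m'\<close> absorbs the powers of the dimension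
    \<open>N\<close> that come from the choice of a coordinate, and \<open>n3\<close> makes the
    derivatives integrable.\<close>
  obtain n1 D1 where D1: "D1 > 0" "\<And>t. t \<ge> 0 \<Longrightarrow> (1 + t) ^ 1 \<le> D1 * exp (real n1 * \<omega> t)"
    using power_le_exp_weight[of 1] by blast
  obtain m' D2 where D2: "D2 > 0" "\<And>k. N ^ k * w (n + n1) k \<le> D2 * w m' k"
    using conj_weight_absorb[OF N] by blast
  obtain n3 D3 where D3: "D3 > 0" "\<And>t. t \<ge> 0 \<Longrightarrow> (1 + t) ^ (2 * CARD('n)) \<le> D3 * exp (real n3 * \<omega> t)"
    using power_le_exp_weight[of "2 * CARD('n)"] by blast
  obtain C where C: "\<And>\<alpha> x. exp (real n3 * \<omega> (norm x)) * norm (mderiv \<alpha> h x) * w m' (msize \<alpha>) \<le> C"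
    using h unfolding ultra_decay_def q_bound_def by blast
  have C0: "C \<ge> 0" by (rule order_trans[OF _ C[of 0 "\<lambda>_. 0"]]) simp
  have sh: "smooth h" using h by (simp add: ultra_decay_def)
  have comp: "\<bar>\<xi> $ j\<bar> ^ k * norm (fourier h \<xi>) * w m' k \<le> C * D3 * (LINT x|lborel. J x)" for \<xi> j k
  proof -
    let ?u = "(pderiv_dir j ^^ k) h"
    have "norm (fourier ?u \<xi>) = \<bar>\<xi> $ j\<bar> ^ k * norm (fourier h \<xi>)"
      by (subst fourier_pderiv_dir_funpow[OF sh])
         (auto simp: pderiv_dir_funpow_eq_mderiv norm_mult norm_power intro: ultra_decay_rapid[OF h])
    then have "\<bar>\<xi> $ j\<bar> ^ k * norm (fourier h \<xi>) * w m' k \<le> (LINT x|lborel. norm (?u x)) * w m' k"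
      using norm_fourier_le[of ?u \<xi>] by (intro mult_right_mono) auto
    also have "\<dots> = (LINT x|lborel. norm (?u x) * w m' k)" by simp
    also have "\<dots> \<le> (LINT x|lborel. C * D3 * J x)"
    proof (intro integral_mono_AE' AE_I2)
      fix x :: "real ^ 'n"
      have pos: "(1 + norm x) ^ (2 * CARD('n)) > 0" by (intro zero_less_power add_pos_nonneg) auto
      have "norm (?u x) * w m' k * (1 + norm x) ^ (2 * CARD('n)) \<le> norm (?u x) * w m' k * (D3 * exp (real n3 * \<omega> (norm x)))"
        by (intro mult_left_mono D3(2)) auto
      also have "\<dots> = D3 * (exp (real n3 * \<omega> (norm x)) * norm (?u x) * w m' k)" by simp
      also have "\<dots> \<le> D3 * C"
        using C[of x "\<lambda>i. if i = j then k else 0"] D3(1)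
        unfolding pderiv_dir_funpow_eq_mderiv msize_indicator by simp
      finally show "norm (?u x) * w m' k \<le> C * D3 * J x" using pos by (simp add: J_def pos_le_divide_eq mult_ac)
    qed (use iJ J0 C0 D3(1) in auto)
    finally show ?thesis by simp
  qed
  have IJ: "(LINT x|lborel. J x) \<ge> 0" by (intro integral_nonneg_AE AE_I2 J0)
  define C4 where "C4 = D1 * (D2 * (C * D3 * (LINT x|lborel. J x)))"
  have "exp (real n * \<omega> (norm \<xi>)) * norm (fourier h \<xi>) \<le> C4 + (LINT x|lborel. norm (h x))" for \<xi>
  proof (cases "norm \<xi> \<ge> 1")
    case True
    obtain k where k: "exp (real (n + n1) * \<omega> (norm \<xi>)) \<le> norm \<xi> * (norm \<xi> ^ k * w (n + n1) k)"
      using exp_weight_le_conj_weight[OF True] by blast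
    obtain j where j: "norm \<xi> \<le> N * \<bar>\<xi> $ j\<bar>" unfolding N_def by (rule norm_le_card_mult_component)
    have "norm \<xi> * exp (real n * \<omega> (norm \<xi>)) \<le> (D1 * exp (real n1 * \<omega> (norm \<xi>))) * exp (real n * \<omega> (norm \<xi>))"
      using D1(2)[of "norm \<xi>"] by (intro mult_right_mono) auto
    also have "\<dots> = D1 * exp (real (n + n1) * \<omega> (norm \<xi>))" by (simp add: distrib_right exp_add)
    also have "\<dots> \<le> D1 * (norm \<xi> * (norm \<xi> ^ k * w (n + n1) k))" using k D1(1) by simp
    finally have "norm \<xi> * exp (real n * \<omega> (norm \<xi>)) \<le> norm \<xi> * (D1 * (norm \<xi> ^ k * w (n + n1) k))"
      by (simp add: mult_ac)
    then have "exp (real n * \<omega> (norm \<xi>)) \<le> D1 * (norm \<xi> ^ k * w (n + n1) k)"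
      using True by (simp only: mult_le_cancel_left_pos)
    also have "\<dots> \<le> D1 * ((N * \<bar>\<xi> $ j\<bar>) ^ k * w (n + n1) k)"
      using j D1(1) by (intro mult_left_mono mult_right_mono power_mono) auto
    also have "\<dots> = D1 * (\<bar>\<xi> $ j\<bar> ^ k * (N ^ k * w (n + n1) k))" by (simp add: power_mult_distrib)
    also have "\<dots> \<le> D1 * (\<bar>\<xi> $ j\<bar> ^ k * (D2 * w m' k))"
      using D1(1) D2(2)[of k] by (intro mult_left_mono) auto
    finally have "exp (real n * \<omega> (norm \<xi>)) * norm (fourier h \<xi>) \<le> D1 * (\<bar>\<xi> $ j\<bar> ^ k * (D2 * w m' k)) * norm (fourier h \<xi>)"
      by (intro mult_right_mono) auto
    also have "\<dots> = D1 * (D2 * (\<bar>\<xi> $ j\<bar> ^ k * norm (fourier h \<xi>) * w m' k))" by simp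
    also have "\<dots> \<le> C4"
      unfolding C4_def using D1(1) D2(1) by (intro mult_left_mono comp) auto
    finally show ?thesis by (rule order_trans) simp
  next
    case False
    have "\<omega> (norm \<xi>) \<le> \<omega> 1" using False by (intro weight_mono) auto
    then have "\<omega> (norm \<xi>) = 0" using weight_nonneg[of "norm \<xi>"] by (simp add: weight_one)
    moreover have "C4 \<ge> 0" unfolding C4_def using D1(1) D2(1) C0 D3(1) IJ by simp
    ultimately show ?thesis using norm_fourier_le[of h \<xi>] by simp
  qed
  then show ?thesis by blast
qed

text \<open>Every derivative of the transform of \<open>h\<close> is itself the transform of a
  function with \<open>ultra_decay\<close>, obtained by multiplication by coordinates. Decay of the
  transforms themselves is therefore enough.\<close>

lemma ultra_decay_S_space:
  fixes h :: "real ^ 'n::finite \<Rightarrow> complex"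
  assumes h: "ultra_decay h"
  shows "h \<in> S_space \<omega>"
proof -
  have bdd: "bounded (range (\<lambda>x. exp (l * \<omega> (norm x)) *\<^sub>R g x))"
    if decay: "\<And>n. \<exists>C. \<forall>x. exp (real n * \<omega> (norm x)) * norm (g x) \<le> C" for l and g :: "real ^ 'n \<Rightarrow> complex"
  proof -
    obtain n where n: "l \<le> real n" using real_arch_simple by blast
    obtain C where C: "\<And>x. exp (real n * \<omega> (norm x)) * norm (g x) \<le> C" using decay by blast
    have "norm (exp (l * \<omega> (norm x)) *\<^sub>R g x) \<le> C" for x
    proof -
      have "norm (exp (l * \<omega> (norm x)) *\<^sub>R g x) = exp (l * \<omega> (norm x)) * norm (g x)" by simp
      also have "\<dots> \<le> exp (real n * \<omega> (norm x)) * norm (g x)"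
        using n weight_nonneg[of "norm x"] by (intro mult_right_mono) (auto intro: mult_right_mono)
      finally show ?thesis using C[of x] by simp
    qed
    then show ?thesis by (auto simp: bounded_iff)
  qed
  have rap: "rapid h" using ultra_decay_rapid[OF h, of "\<lambda>_. 0"] by simp
  have "\<exists>h'. ultra_decay h' \<and> mderiv \<alpha> (fourier h) = fourier h'" for \<alpha>
    unfolding mderiv_eq_mderiv_along
  proof (rule mderiv_along_invariant[where P = "\<lambda>F. \<exists>h'. ultra_decay h' \<and> F = fourier h'"])
    show "\<exists>h'. ultra_decay h' \<and> fourier h = fourier h'" using h by blast
    fix i F assume "\<exists>h'. ultra_decay h' \<and> F = fourier h'"
    then obtain h' where h': "ultra_decay h'" "F = fourier h'" by blast
    have "rapid h'" using ultra_decay_rapid[OF h'(1), of "\<lambda>_. 0"] by simp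
    then show "\<exists>h'. ultra_decay h' \<and> pderiv_dir i F = fourier h'"
      using pderiv_dir_fourier ultra_decay_mult_coord[OF h'(1)] h'(2) by blast
  qed
  then have "\<exists>C. \<forall>x. exp (real n * \<omega> (norm x)) * norm (mderiv \<alpha> (fourier h) x) \<le> C" for n \<alpha>
    using ultra_decay_fourier_bound by metis
  then show ?thesis
    unfolding S_space_def mem_Collect_eq
    using h rap bdd ultra_decay_mderiv_bound[OF h]
    by (intro conjI allI impI) (simp_all add: ultra_decay_def rapid_integrable smooth_fourier)
qed

lemma S_space_eq: "S_space \<omega> = Collect ultra_decay"
  using S_space_ultra_decay ultra_decay_S_space by blast

end


section \<open>Multiplication\<close>

lemma exp_ereal_diff: "exp_ereal (- ereal a - b) = ereal (exp (- a)) * exp_ereal (- b)"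
  by (cases b) (auto simp: exp_ereal_def exp_diff exp_minus divide_inverse simp flip: exp_add)

lemma cscale_mult_left: "cscale c f * g = cscale c (f * g)"
  and cscale_mult_right: "f * cscale c g = cscale c (f * g)"
  by (simp_all add: cscale_def fun_eq_iff times_fun_apply)

context weight
begin

section \<open>The norms as real seminorms, and open sets in the multiplier space\<close>

lemma q_norm_le_iff:
  assumes m: "m \<ge> 1" and C: "C \<ge> 0"
  shows "q_norm \<omega> m n f \<le> ereal C \<longleftrightarrow> q_bound m n f C"
proof -
  have "(SUP x. ereal (exp (real n * \<omega> (norm x)) * norm (mderiv \<alpha> f x))) * ereal (w m (msize \<alpha>)) \<le> ereal C
      \<longleftrightarrow> (\<forall>x. exp (real n * \<omega> (norm x)) * norm (mderiv \<alpha> f x) * w m (msize \<alpha>) \<le> C)"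
    (is "?S * _ \<le> _ \<longleftrightarrow> _") for \<alpha>
  proof (cases "w m (msize \<alpha>) = 0")
    \<comment> \<open>The inner supremum may be infinite here; its product with 0 is still
      0.\<close>
    case True
    then show ?thesis using C by (simp add: zero_ereal_def[symmetric])
  next
    case False
    then have W: "w m (msize \<alpha>) > 0" using conj_weight_nonneg[of m "msize \<alpha>"] by (simp add: order_less_le)
    show ?thesis
    proof (intro iffI allI)
      fix x assume le: "?S * ereal (w m (msize \<alpha>)) \<le> ereal C"
      have "ereal (exp (real n * \<omega> (norm x)) * norm (mderiv \<alpha> f x)) * ereal (w m (msize \<alpha>)) \<le> ?S * ereal (w m (msize \<alpha>))"
        by (intro ereal_mult_right_mono SUP_upper) auto
      with le have "ereal (exp (real n * \<omega> (norm x)) * norm (mderiv \<alpha> f x)) * ereal (w m (msize \<alpha>)) \<le> ereal C"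
        by (rule order_trans[rotated])
      then show "exp (real n * \<omega> (norm x)) * norm (mderiv \<alpha> f x) * w m (msize \<alpha>) \<le> C" by simp
    next
      assume le: "\<forall>x. exp (real n * \<omega> (norm x)) * norm (mderiv \<alpha> f x) * w m (msize \<alpha>) \<le> C"
      have "?S \<le> ereal (C / w m (msize \<alpha>))"
        by (rule SUP_least) (use le W in \<open>simp add: pos_le_divide_eq\<close>)
      then have "?S * ereal (w m (msize \<alpha>)) \<le> ereal (C / w m (msize \<alpha>)) * ereal (w m (msize \<alpha>))"
        by (rule ereal_mult_right_mono) simp
      then show "?S * ereal (w m (msize \<alpha>)) \<le> ereal C" using W by simp
    qed
  qed
  then show ?thesis by (simp add: q_norm_def exp_ereal_young_conj[OF m] SUP_le_iff q_bound_def)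
qed

lemma q_norm_nonneg:
  assumes m: "m \<ge> 1"
  shows "0 \<le> q_norm \<omega> m n f"
  unfolding q_norm_def exp_ereal_young_conj[OF m]
  by (rule SUP_upper2[of "\<lambda>_. 0"], simp, rule ereal_0_le_mult, rule SUP_upper2[of 0]) auto

lemma r_norm_le_iff:
  assumes m: "m \<ge> 1"
  shows "r_norm \<omega> m n f \<le> ereal C \<longleftrightarrow> r_bound m n f C"
proof -
  have "a * (exp (- b) * c) \<le> C \<longleftrightarrow> a * c \<le> C * exp b" for a b c :: real
    by (simp add: exp_minus field_simps)
  then show ?thesis
    unfolding r_norm_def exp_ereal_diff exp_ereal_young_conj[OF m] by (simp add: SUP_le_iff r_bound_def)
qed

lemma r_norm_nonneg:
  assumes m: "m \<ge> 1"
  shows "0 \<le> r_norm \<omega> m n f"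
  unfolding r_norm_def exp_ereal_diff exp_ereal_young_conj[OF m]
  by (rule SUP_upper2[of "\<lambda>_. 0"], simp, rule SUP_upper2[of 0]) auto

lemma S_space_iff: "f \<in> S_space \<omega> \<longleftrightarrow> smooth f \<and> (\<forall>m n. \<exists>C. q_bound m n f C)"
  by (simp add: S_space_eq ultra_decay_def)

lemma O_step_space_iff:
  assumes m: "m \<ge> 1"
  shows "f \<in> O_step_space \<omega> m n \<longleftrightarrow> smooth f \<and> (\<exists>C. r_bound m n f C)"
proof -
  have "r_norm \<omega> m n f < \<infinity> \<longleftrightarrow> (\<exists>C. r_norm \<omega> m n f \<le> ereal C)"
    using r_norm_nonneg[OF m, of n f] by (cases "r_norm \<omega> m n f") auto
  then show ?thesis by (simp add: O_step_space_def r_norm_le_iff[OF m])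
qed

lemma subspace_S_space: "cfun.subspace (S_space \<omega> :: (real ^ 'n::finite \<Rightarrow> complex) set)"
  unfolding cfun.subspace_def
proof (intro conjI ballI allI)
  show "0 \<in> (S_space \<omega> :: (real ^ 'n \<Rightarrow> complex) set)"
    using q_bound_0 by (auto simp: S_space_iff smooth_zero)
  fix f g :: "real ^ 'n \<Rightarrow> complex" and c
  assume f: "f \<in> S_space \<omega>"
  then show "cscale c f \<in> S_space \<omega>"
    unfolding S_space_iff by (blast intro: smooth_cscale q_bound_cscale)
  assume "g \<in> S_space \<omega>"
  with f show "f + g \<in> S_space \<omega>"
    unfolding S_space_iff by (blast intro: smooth_add q_bound_add)
qed

lemma subspace_O_step_space:
  assumes m: "m \<ge> 1"
  shows "cfun.subspace (O_step_space \<omega> m n :: (real ^ 'n::finite \<Rightarrow> complex) set)"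
  unfolding cfun.subspace_def
proof (intro conjI ballI allI)
  have "r_bound m n (0 :: real ^ 'n \<Rightarrow> complex) 0" by (simp add: r_bound_def)
  then show "0 \<in> (O_step_space \<omega> m n :: (real ^ 'n \<Rightarrow> complex) set)"
    unfolding O_step_space_iff[OF m] using smooth_zero by blast
  fix f g :: "real ^ 'n \<Rightarrow> complex" and c
  assume f: "f \<in> O_step_space \<omega> m n"
  then show "cscale c f \<in> O_step_space \<omega> m n"
    unfolding O_step_space_iff[OF m] by (blast intro: smooth_cscale r_bound_cscale)
  assume "g \<in> O_step_space \<omega> m n"
  with f show "f + g \<in> O_step_space \<omega> m n"
    unfolding O_step_space_iff[OF m] by (blast intro: smooth_add r_bound_add)
qed

lemma O_step_space_mono: "m \<ge> 1 \<Longrightarrow> n \<le> n' \<Longrightarrow> O_step_space \<omega> m n \<subseteq> O_step_space \<omega> m n'"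
  using r_bound_mono unfolding O_step_space_iff subset_iff by blast

text \<open>The space underlying the \<open>m\<close>-th inductive limit.\<close>

definition O_union :: "nat \<Rightarrow> (real ^ 'n::finite \<Rightarrow> complex) set" where
  "O_union m = (\<Union>n\<in>{1..}. O_step_space \<omega> m n)"

lemma O_union_iff: "m \<ge> 1 \<Longrightarrow> f \<in> O_union m \<longleftrightarrow> smooth f \<and> (\<exists>n\<ge>1. \<exists>C. r_bound m n f C)"
  by (auto simp: O_union_def O_step_space_iff)

lemma subspace_O_union:
  assumes m: "m \<ge> 1"
  shows "cfun.subspace (O_union m :: (real ^ 'n::finite \<Rightarrow> complex) set)"
  unfolding cfun.subspace_def
proof (intro conjI ballI allI)
  note sub = subspace_O_step_space[OF m]
  show "0 \<in> (O_union m :: (real ^ 'n \<Rightarrow> complex) set)"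
    using cfun.subspace_0[OF sub, of 1] by (auto simp: O_union_def)
  fix f g :: "real ^ 'n \<Rightarrow> complex" and c
  assume f: "f \<in> O_union m"
  then obtain n where n: "n \<ge> 1" "f \<in> O_step_space \<omega> m n" by (auto simp: O_union_def)
  then show "cscale c f \<in> O_union m"
    using cfun.subspace_scale[OF sub n(2), of c] by (auto simp: O_union_def)
  assume "g \<in> O_union m"
  then obtain n' where n': "n' \<ge> 1" "g \<in> O_step_space \<omega> m n'" by (auto simp: O_union_def)
  have "f \<in> O_step_space \<omega> m (max n n')" "g \<in> O_step_space \<omega> m (max n n')"
    using O_step_space_mono[OF m, of n "max n n'"] O_step_space_mono[OF m, of n' "max n n'"] n n' by auto
  then have "f + g \<in> O_step_space \<omega> m (max n n')" by (rule cfun.subspace_add[OF sub])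
  then show "f + g \<in> O_union m" using n by (auto simp: O_union_def intro!: bexI[of _ "max n n'"])
qed

lemma OM_space_subset: "m \<ge> 1 \<Longrightarrow> OM_space \<omega> \<subseteq> O_union m"
  by (auto simp: OM_space_def O_union_def)

lemma OM_space_iff: "f \<in> OM_space \<omega> \<longleftrightarrow> smooth f \<and> (\<forall>m\<ge>1. \<exists>n\<ge>1. \<exists>C. r_bound m n f C)"
proof -
  have "f \<in> OM_space \<omega> \<longleftrightarrow> (\<forall>m\<ge>1. f \<in> O_union m)" by (auto simp: OM_space_def O_union_def)
  also have "\<dots> \<longleftrightarrow> smooth f \<and> (\<forall>m\<ge>1. \<exists>n\<ge>1. \<exists>C. r_bound m n f C)"
    using O_union_iff order_refl by metis
  finally show ?thesis .
qed

lemma subspace_OM_space: "cfun.subspace (OM_space \<omega> :: (real ^ 'n::finite \<Rightarrow> complex) set)"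
proof -
  have "OM_space \<omega> = (\<Inter>m\<in>{1..}. O_union m :: (real ^ 'n \<Rightarrow> complex) set)"
    by (auto simp: OM_space_def O_union_def)
  then show ?thesis
    using subspace_O_union unfolding cfun.subspace_def by auto
qed

lemma q_norm_seminorm:
  assumes m: "m \<ge> 1"
  shows "\<exists>p. seminorm_on (S_space \<omega> :: (real ^ 'n::finite \<Rightarrow> complex) set) p \<and> (\<forall>f\<in>S_space \<omega>. q_norm \<omega> m n f = ereal (p f))"
proof -
  define L where "L = (\<lambda>(\<alpha>, x) f. of_real (exp (real n * \<omega> (norm x)) * w m (msize \<alpha>)) * mderiv \<alpha> f (x :: real ^ 'n))"
  have nL: "norm (L (\<alpha>, x) f) = exp (real n * \<omega> (norm x)) * norm (mderiv \<alpha> f x) * w m (msize \<alpha>)" for \<alpha> x f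
    by (simp add: L_def norm_mult)
  have bound: "(\<forall>i. norm (L i f) \<le> C) \<longleftrightarrow> q_bound m n f C" for f C
    by (simp add: nL q_bound_def split_paired_All)
  have 1: "L i (f + g) = L i f + L i g" if "f \<in> S_space \<omega>" "g \<in> S_space \<omega>" for i f g
    using that by (cases i) (simp add: L_def mderiv_add S_space_smooth plus_fun_apply distrib_left)
  have 2: "L i (cscale c f) = c * L i f" if "f \<in> S_space \<omega>" for i c f
    using that by (cases i) (simp add: L_def mderiv_cscale S_space_smooth, simp add: cscale_def)
  have 3: "\<exists>C. \<forall>i. norm (L i f) \<le> C" if "f \<in> S_space \<omega>" for f
    using that unfolding bound S_space_iff by blast
  show ?thesis
  proof (rule seminorm_on_of_upper_bounds[OF subspace_S_space, where L = L])
    show "q_norm \<omega> m n f \<le> ereal C \<longleftrightarrow> (\<forall>i. norm (L i f) \<le> C)" if "C \<ge> 0" for f C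
      unfolding bound using m that by (simp only: q_norm_le_iff)
  qed (rule 1 2 3 q_norm_nonneg[OF m]; assumption)+
qed

lemma S_seminorm_family:
  "seminorm_family (S_space \<omega> :: (real ^ 'n::finite \<Rightarrow> complex) set) {q_norm \<omega> m n | m n. m \<ge> 1 \<and> n \<ge> 1}"
  unfolding seminorm_family_def
proof (intro conjI ballI subspace_S_space)
  show "{q_norm \<omega> m n | m n. m \<ge> 1 \<and> n \<ge> 1} \<noteq> {}" by blast
next
  fix q :: "(real ^ 'n \<Rightarrow> complex) \<Rightarrow> ereal"
  assume "q \<in> {q_norm \<omega> m n | m n. m \<ge> 1 \<and> n \<ge> 1}"
  then show "\<exists>p. seminorm_on (S_space \<omega>) p \<and> (\<forall>f\<in>S_space \<omega>. q f = ereal (p f))"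
    using q_norm_seminorm by blast
next
  have mono: "q_norm \<omega> m n f \<le> q_norm \<omega> m' n' f"
    if mn: "m \<ge> 1" "m \<le> m'" "n \<le> n'" and f: "f \<in> S_space \<omega>" for m m' n n' and f :: "real ^ 'n \<Rightarrow> complex"
  proof -
    have m': "m' \<ge> 1" using mn by simp
    obtain r where r: "q_norm \<omega> m' n' f = ereal r" using q_norm_seminorm[OF m'] f by blast
    have r0: "r \<ge> 0" using q_norm_nonneg[OF m', of n' f] r by simp
    have "q_bound m' n' f r" using q_norm_le_iff[OF m' r0, of n' f] r by simp
    then have le: "exp (real n' * \<omega> (norm x)) * norm (mderiv \<alpha> f x) * w m' (msize \<alpha>) \<le> r" for \<alpha> x
      by (simp add: q_bound_def)
    have "q_bound m n f r"
      unfolding q_bound_def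
    proof (intro allI)
      fix \<alpha> and x :: "real ^ 'n"
      have "exp (real n * \<omega> (norm x)) * norm (mderiv \<alpha> f x) * w m (msize \<alpha>)
          \<le> exp (real n' * \<omega> (norm x)) * norm (mderiv \<alpha> f x) * w m' (msize \<alpha>)"
        using mn weight_nonneg[of "norm x"]
        by (intro mult_mono conj_weight_mono mult_right_mono) (auto intro: mult_right_mono)
      then show "exp (real n * \<omega> (norm x)) * norm (mderiv \<alpha> f x) * w m (msize \<alpha>) \<le> r" using le order_trans by blast
    qed
    then show ?thesis unfolding r by (simp add: q_norm_le_iff[OF mn(1) r0])
  qed
  fix q q' :: "(real ^ 'n \<Rightarrow> complex) \<Rightarrow> ereal"
  assume "q \<in> {q_norm \<omega> m n | m n. m \<ge> 1 \<and> n \<ge> 1}" "q' \<in> {q_norm \<omega> m n | m n. m \<ge> 1 \<and> n \<ge> 1}"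
  then obtain m n m' n' where q: "q = q_norm \<omega> m n" "q' = q_norm \<omega> m' n'" "m \<ge> 1" "n \<ge> 1" "m' \<ge> 1" "n' \<ge> 1" by blast
  show "\<exists>q''\<in>{q_norm \<omega> m n | m n. m \<ge> 1 \<and> n \<ge> 1}. \<forall>f\<in>S_space \<omega>. q f \<le> q'' f \<and> q' f \<le> q'' f"
  proof (rule bexI[of _ "q_norm \<omega> (max m m') (max n n')"])
    show "q_norm \<omega> (max m m') (max n n') \<in> {q_norm \<omega> m n | m n. m \<ge> 1 \<and> n \<ge> 1}" using q by force
  qed (use q in \<open>auto intro!: mono\<close>)
qed

lemma r_norm_seminorm:
  assumes m: "m \<ge> 1"
  shows "\<exists>p. seminorm_on (O_step_space \<omega> m n :: (real ^ 'n::finite \<Rightarrow> complex) set) p \<and>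
    (\<forall>f\<in>O_step_space \<omega> m n. r_norm \<omega> m n f = ereal (p f))"
proof -
  define L where "L = (\<lambda>(\<alpha>, x) f. of_real (w m (msize \<alpha>) / exp (real n * \<omega> (norm x))) * mderiv \<alpha> f (x :: real ^ 'n))"
  have bound: "(\<forall>i. norm (L i f) \<le> C) \<longleftrightarrow> r_bound m n f C" for f C
  proof -
    have "norm (L (\<alpha>, x) f) \<le> C \<longleftrightarrow> norm (mderiv \<alpha> f x) * w m (msize \<alpha>) \<le> C * exp (real n * \<omega> (norm x))" for \<alpha> x
    proof -
      have "norm (L (\<alpha>, x) f) = norm (mderiv \<alpha> f x) * w m (msize \<alpha>) / exp (real n * \<omega> (norm x))"
        by (simp add: L_def norm_mult norm_divide del: of_real_divide)
      then show ?thesis by (simp add: pos_divide_le_eq)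
    qed
    then show ?thesis by (simp add: r_bound_def split_paired_All)
  qed
  have 1: "L i (f + g) = L i f + L i g" if "f \<in> O_step_space \<omega> m n" "g \<in> O_step_space \<omega> m n" for i f g
    using that by (cases i) (simp add: L_def mderiv_add O_step_space_iff[OF m] plus_fun_apply distrib_left add_divide_distrib)
  have 2: "L i (cscale c f) = c * L i f" if "f \<in> O_step_space \<omega> m n" for i c f
    using that by (cases i) (simp add: L_def mderiv_cscale O_step_space_iff[OF m], simp add: cscale_def)
  have 3: "\<exists>C. \<forall>i. norm (L i f) \<le> C" if "f \<in> O_step_space \<omega> m n" for f
    using that unfolding bound O_step_space_iff[OF m] by blast
  show ?thesis
  proof (rule seminorm_on_of_upper_bounds[OF subspace_O_step_space[OF m], where L = L])
    show "r_norm \<omega> m n f \<le> ereal C \<longleftrightarrow> (\<forall>i. norm (L i f) \<le> C)" if "C \<ge> 0" for f C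
      unfolding bound using m that by (simp only: r_norm_le_iff)
  qed (rule 1 2 3 r_norm_nonneg[OF m]; assumption)+
qed

text \<open>The constant \<open>C\<close> may depend on the step \<open>n\<close> without any
  uniformity, because continuity on an inductive limit is tested on each step separately. This
  freedom is what both applications exploit.\<close>

lemma openin_OM_ball:
  fixes p :: "(real ^ 'n::finite \<Rightarrow> complex) \<Rightarrow> real"
  assumes m: "m \<ge> 1" and p: "seminorm_on (O_union m) p"
    and bound: "\<And>n. n \<ge> 1 \<Longrightarrow> \<exists>C\<ge>0. \<forall>f r. f \<in> O_step_space \<omega> m n \<longrightarrow> r_bound m n f r \<longrightarrow> p f \<le> C * r"
    and f1: "f1 \<in> O_union m"
  shows "openin (OM_topology \<omega>) {f \<in> OM_space \<omega>. p (f - f1) < e}"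
proof -
  let ?T = "\<lambda>n. O_step_topology \<omega> m n :: (real ^ 'n \<Rightarrow> complex) topology"
  let ?X = "seminorm_topology (O_union m) {\<lambda>f. ereal (p f)}"
  have U: "O_union m = (\<Union>n\<in>{1..}. topspace (?T n))" by (simp add: O_union_def O_step_topology_def)
  have cont: "continuous_map (?T n) ?X (\<lambda>f. f)" if n: "n \<in> {1..}" for n
  proof (rule continuous_map_into_seminorm_topology[OF seminorm_family_singleton[OF p refl]])
    have sub: "O_step_space \<omega> m n \<subseteq> (O_union m :: (real ^ 'n \<Rightarrow> complex) set)" using n by (auto simp: O_union_def)
    then show "(\<lambda>f. f) ` topspace (?T n) \<subseteq> O_union m" by (simp add: O_step_topology_def)
    fix q f and d :: real
    assume q: "q \<in> {\<lambda>f. ereal (p f)}" and d: "d > 0" and f: "f \<in> topspace (?T n)"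
    have fO: "f \<in> O_step_space \<omega> m n" using f by (simp add: O_step_topology_def)
    obtain C where C: "C \<ge> 0" "\<And>f r. f \<in> O_step_space \<omega> m n \<Longrightarrow> r_bound m n f r \<Longrightarrow> p f \<le> C * r"
      using bound[of n] n by auto
    obtain p' where p': "seminorm_on (O_step_space \<omega> m n) p'"
        "\<And>f :: real ^ 'n \<Rightarrow> complex. f \<in> O_step_space \<omega> m n \<Longrightarrow> r_norm \<omega> m n f = ereal (p' f)"
      using r_norm_seminorm[OF m, where 'n = 'n] by blast
    define d' where "d' = d / (C + 1)"
    have d': "d' > 0" using d C by (simp add: d'_def)
    let ?U = "{g \<in> O_step_space \<omega> m n. r_norm \<omega> m n (g - f) < ereal d'}"
    have "openin (?T n) ?U"
      unfolding O_step_topology_def by (rule openin_seminorm_topology_ball) (use fO d' in auto)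
    moreover have "f \<in> ?U"
      using fO d' p'(2)[OF cfun.subspace_0[OF subspace_O_step_space[OF m]]] seminorm_on_0[OF p'(1)] by simp
    moreover have "q (g - f) < ereal d" if g: "g \<in> ?U" for g
    proof -
      have gf: "g - f \<in> O_step_space \<omega> m n"
        using g fO cfun.subspace_diff[OF subspace_O_step_space[OF m]] by blast
      have lt: "p' (g - f) < d'" using g p'(2)[OF gf] by simp
      have "r_bound m n (g - f) (p' (g - f))" using r_norm_le_iff[OF m] p'(2)[OF gf] by force
      then have "p (g - f) \<le> C * p' (g - f)" by (rule C(2)[OF gf])
      also have "\<dots> \<le> C * d'" using lt C(1) by (intro mult_left_mono) auto
      also have "\<dots> < d" using d C(1) by (simp add: d'_def field_simps)
      finally show ?thesis using q by simp
    qed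
    ultimately show "\<exists>U. openin (?T n) U \<and> f \<in> U \<and> (\<forall>g\<in>U. q (g - f) < ereal d)" by blast
  qed
  have "openin (lc_inductive_limit {1..} ?T) {g \<in> O_union m. p (g - f1) < e}"
    by (rule openin_inductive_limit_ball[OF p U f1 cont])
  from openin_projective_limit[of m "{1..}" "\<lambda>m. lc_inductive_limit {1..} (\<lambda>n. O_step_topology \<omega> m n)", OF _ this] m
  have "openin (OM_topology \<omega>) (topspace (OM_topology \<omega>) \<inter> {g \<in> O_union m. p (g - f1) < e})"
    unfolding OM_topology_def topspace_projective_limit by simp
  moreover have "topspace (OM_topology \<omega>) \<inter> {g \<in> O_union m. p (g - f1) < e} = {f \<in> OM_space \<omega>. p (f - f1) < e}"
    unfolding topspace_OM_topology using OM_space_subset[OF m] by blast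
  ultimately show ?thesis by simp
qed

lemma mult_in_S_space:
  fixes f g :: "real ^ 'n::finite \<Rightarrow> complex"
  assumes f: "f \<in> OM_space \<omega>" and g: "g \<in> S_space \<omega>"
  shows "f * g \<in> S_space \<omega>"
proof -
  have "\<exists>k R. r_bound m k f R" for m
  proof -
    \<comment> \<open>\<open>OM_space\<close> provides bounds for \<open>m \<ge> 1\<close> only,
      while \<open>ultra_decay_mult\<close> also asks for \<open>m = 0\<close>; enlarging
      \<open>m\<close> only strengthens a bound.\<close>
    obtain k R where R: "r_bound (Suc m) k f R" using f unfolding OM_space_iff by (metis le_add1 plus_1_eq_Suc)
    have "norm (mderiv \<alpha> f x) * w m (msize \<alpha>) \<le> norm (mderiv \<alpha> f x) * w (Suc m) (msize \<alpha>)" for \<alpha> x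
      by (intro mult_left_mono conj_weight_mono) auto
    then have "r_bound m k f R" using R unfolding r_bound_def by (meson order_trans)
    then show ?thesis by blast
  qed
  then show ?thesis using f g by (simp add: S_space_eq ultra_decay_mult OM_space_iff)
qed

section \<open>Equicontinuity of multiplication in each factor\<close>

lemma clinear_between_mult_left:
  "f \<in> OM_space \<omega> \<Longrightarrow> clinear_between (S_space \<omega>) (S_space \<omega>) (\<lambda>g :: real ^ 'n::finite \<Rightarrow> complex. f * g)"
  by (auto simp: clinear_between_def mult_in_S_space distrib_left cscale_mult_right)

lemma clinear_between_mult_right:
  "g \<in> S_space \<omega> \<Longrightarrow> clinear_between (OM_space \<omega>) (S_space \<omega>) (\<lambda>f :: real ^ 'n::finite \<Rightarrow> complex. f * g)"
  by (auto simp: clinear_between_def mult_in_S_space distrib_right cscale_mult_left)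

text \<open>With one \<open>k\<close> and one \<open>R\<close> for all of \<open>A\<close>,
  \<open>q_bound_mult\<close> bounds a seminorm of \<open>f * g\<close> by a multiple of
  \<open>q_norm \<omega> m' (n + k)\<close> of \<open>g\<close>, independently of
  \<open>f\<close>.\<close>

lemma equicontinuous_mult_left:
  fixes A :: "(real ^ 'n::finite \<Rightarrow> complex) set"
  assumes A: "A \<subseteq> OM_space \<omega>" and bdd: "\<And>m. m \<ge> 1 \<Longrightarrow> \<exists>k R. \<forall>f\<in>A. r_bound m k f R"
  shows "tvs_equicontinuous (S_topology \<omega>) (S_topology \<omega>) ((\<lambda>f g. f * g) ` A)"
  unfolding S_topology_def[of \<omega>]
proof (rule tvs_equicontinuousI[OF S_seminorm_family])
  let ?S = "S_space \<omega> :: (real ^ 'n \<Rightarrow> complex) set"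
  let ?P = "{q_norm \<omega> m n | m n. m \<ge> 1 \<and> n \<ge> 1} :: ((real ^ 'n \<Rightarrow> complex) \<Rightarrow> ereal) set"
  show "cfun.subspace (topspace (seminorm_topology ?S ?P))" using subspace_S_space by simp
  show "clinear_between (topspace (seminorm_topology ?S ?P)) ?S h" if "h \<in> (\<lambda>f g. f * g) ` A" for h
    using that A clinear_between_mult_left by auto
  fix q g1 and e :: real
  assume q: "q \<in> ?P" and e: "e > 0" and "g1 \<in> topspace (seminorm_topology ?S ?P)"
  then have g1: "g1 \<in> ?S" by simp
  obtain m n where mn: "q = q_norm \<omega> m n" "m \<ge> 1" "n \<ge> 1" using q by blast
  obtain m' D where D: "m' \<ge> m" "D > 0" "\<And>(f :: real ^ 'n \<Rightarrow> complex) g R B n k. smooth f \<Longrightarrow> smooth g \<Longrightarrow>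
     r_bound m' k f R \<Longrightarrow> q_bound m' (n + k) g B \<Longrightarrow> q_bound m n (f * g) (D * R * B)"
    using q_bound_mult[of m, where 'n = 'n] by blast
  have m': "m' \<ge> 1" using D(1) mn(2) by simp
  obtain k R0 where R0: "\<And>f. f \<in> A \<Longrightarrow> r_bound m' k f R0" using bdd[OF m'] by blast
  define R where "R = \<bar>R0\<bar>"
  have R: "R \<ge> 0" "\<And>f. f \<in> A \<Longrightarrow> r_bound m' k f R"
  proof -
    show "r_bound m' k f R" if "f \<in> A" for f
      using R0[OF that] r_bound_nonneg[OF R0[OF that]] by (simp add: R_def)
  qed (simp add: R_def)
  define d where "d = e / (D * R + 1)"
  have DR: "D * R \<ge> 0" using D(2) R(1) by simp
  have d: "d > 0" using e DR by (simp add: d_def)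
  obtain p where p: "seminorm_on ?S p" "\<And>g. g \<in> ?S \<Longrightarrow> q_norm \<omega> m' (n + k) g = ereal (p g)"
    using q_norm_seminorm[OF m', where 'n = 'n] by blast
  let ?U = "{g \<in> ?S. q_norm \<omega> m' (n + k) (g - g1) < ereal d}"
  have "n + k \<ge> 1" using mn(3) by simp
  then have "q_norm \<omega> m' (n + k) \<in> ?P" using m' by blast
  then have "openin (seminorm_topology ?S ?P) ?U" by (rule openin_seminorm_topology_ball[OF _ g1 d])
  moreover have "g1 \<in> ?U"
    using g1 d p(2)[OF cfun.subspace_0[OF subspace_S_space]] seminorm_on_0[OF p(1)] by simp
  moreover have "q (f * g - f * g1) < ereal e" if f: "f \<in> A" and g: "g \<in> ?U" for f g
  proof -
    have gg: "g - g1 \<in> ?S" using g g1 cfun.subspace_diff[OF subspace_S_space] by blast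
    have lt: "p (g - g1) < d" using g p(2)[OF gg] by simp
    have p0: "p (g - g1) \<ge> 0" by (rule seminorm_on_nonneg[OF p(1) gg])
    have "q_bound m' (n + k) (g - g1) (p (g - g1))"
      using q_norm_le_iff[OF m' p0, of "n + k" "g - g1"] p(2)[OF gg] by simp
    then have "q_bound m n (f * (g - g1)) (D * R * p (g - g1))"
      by (rule D(3)[OF _ S_space_smooth[OF gg] R(2)[OF f], rotated]) (use A f in \<open>auto simp: OM_space_iff\<close>)
    then have "q (f * (g - g1)) \<le> ereal (D * R * p (g - g1))"
      unfolding mn(1) by (intro iffD2[OF q_norm_le_iff[OF mn(2) mult_nonneg_nonneg[OF DR p0]]])
    also have "D * R * p (g - g1) \<le> D * R * d" using DR lt by (intro mult_left_mono) auto
    also have "D * R * d < e" using e DR by (simp add: d_def field_simps)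
    finally show ?thesis by (simp add: right_diff_distrib)
  qed
  ultimately show "\<exists>U. openin (seminorm_topology ?S ?P) U \<and> g1 \<in> U \<and>
      (\<forall>g\<in>U. \<forall>h\<in>(\<lambda>f g. f * g) ` A. q (h g - h g1) < ereal e)" by blast
qed

text \<open>The supremum over \<open>g\<close> in \<open>B\<close> of a seminorm of
  \<open>f * g\<close> is a seminorm in \<open>f\<close>. On the \<open>k\<close>-th step it is
  bounded because \<open>B\<close> is bounded for the weight index \<open>n + k\<close>, so its
  balls are open in the multiplier space.\<close>

lemma equicontinuous_mult_right:
  fixes B :: "(real ^ 'n::finite \<Rightarrow> complex) set"
  assumes B: "B \<subseteq> S_space \<omega>" and bdd: "\<And>m n. m \<ge> 1 \<Longrightarrow> n \<ge> 1 \<Longrightarrow> \<exists>C. \<forall>g\<in>B. q_bound m n g C"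
  shows "tvs_equicontinuous (OM_topology \<omega>) (S_topology \<omega>) ((\<lambda>g f. f * g) ` B)"
  unfolding S_topology_def[of \<omega>]
proof (rule tvs_equicontinuousI[OF S_seminorm_family])
  let ?P = "{q_norm \<omega> m n | m n. m \<ge> 1 \<and> n \<ge> 1} :: ((real ^ 'n \<Rightarrow> complex) \<Rightarrow> ereal) set"
  show "cfun.subspace (topspace (OM_topology \<omega> :: (real ^ 'n \<Rightarrow> complex) topology))"
    unfolding topspace_OM_topology by (rule subspace_OM_space)
  show "clinear_between (topspace (OM_topology \<omega>)) (S_space \<omega>) h" if "h \<in> (\<lambda>g f. f * g) ` B" for h
    unfolding topspace_OM_topology using that B clinear_between_mult_right by auto
  fix q and f1 :: "real ^ 'n \<Rightarrow> complex" and e :: real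
  assume q: "q \<in> ?P" and e: "e > 0" and "f1 \<in> topspace (OM_topology \<omega>)"
  then have f1: "f1 \<in> OM_space \<omega>" by (simp add: topspace_OM_topology)
  obtain m n where mn: "q = q_norm \<omega> m n" "m \<ge> 1" "n \<ge> 1" using q by blast
  obtain m' D where D: "m' \<ge> m" "D > 0" "\<And>(f :: real ^ 'n \<Rightarrow> complex) g R B n k. smooth f \<Longrightarrow> smooth g \<Longrightarrow>
     r_bound m' k f R \<Longrightarrow> q_bound m' (n + k) g B \<Longrightarrow> q_bound m n (f * g) (D * R * B)"
    using q_bound_mult[of m, where 'n = 'n] by blast
  have m': "m' \<ge> 1" using D(1) mn(2) by simp
  \<comment> \<open>The index runs over all functions \<open>g\<close>, with the functional 0
    outside \<open>B\<close>, so that the index type is nonempty even if \<open>B\<close> is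
    empty.\<close>
  define L where "L = (\<lambda>(g, \<alpha>, x) f. if g \<in> B
      then of_real (exp (real n * \<omega> (norm x)) * w m (msize \<alpha>)) * mderiv \<alpha> (f * g) (x :: real ^ 'n) else 0)"
  have nL: "norm (L (g, \<alpha>, x) f) = (if g \<in> B then exp (real n * \<omega> (norm x)) * norm (mderiv \<alpha> (f * g) x) * w m (msize \<alpha>) else 0)"
    for g \<alpha> x f by (simp add: L_def norm_mult)
  have bound: "(\<forall>i. norm (L i f) \<le> C) \<longleftrightarrow> (\<forall>g\<in>B. q_bound m n (f * g) C)" if "C \<ge> 0" for f C
    using that by (auto simp: nL q_bound_def split_paired_All)
  have sB: "smooth g" if "g \<in> B" for g using that B by (auto simp: S_space_iff)
  have sO: "smooth f" if "f \<in> O_union m'" for f :: "real ^ 'n \<Rightarrow> complex" using that by (simp add: O_union_iff[OF m'])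
  have step: "\<exists>C\<ge>0. \<forall>f r. smooth f \<longrightarrow> r_bound m' k f r \<longrightarrow> (\<forall>i. norm (L i f) \<le> C * r)" for k
  proof -
    have "n + k \<ge> 1" using mn(3) by simp
    then obtain C where C: "\<And>g. g \<in> B \<Longrightarrow> q_bound m' (n + k) g C" using bdd[OF m'] by blast
    have "\<forall>i. norm (L i f) \<le> D * \<bar>C\<bar> * r" if f: "smooth f" "r_bound m' k f r" for f r
    proof -
      have r: "r \<ge> 0" using f(2) by (rule r_bound_nonneg)
      have "q_bound m n (f * g) (D * \<bar>C\<bar> * r)" if g: "g \<in> B" for g
        using D(3)[OF f(1) sB[OF g] f(2) C[OF g]] q_bound_nonneg[OF C[OF g]] by (simp add: mult_ac)
      then show ?thesis using D(2) r by (subst bound) auto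
    qed
    then show ?thesis using D(2) by (intro exI[of _ "D * \<bar>C\<bar>"]) auto
  qed
  note sup = seminorm_on_SUP[OF subspace_O_union[OF m'], where L = L]
  have 1: "L i (f + g) = L i f + L i g" if "f \<in> O_union m'" "g \<in> O_union m'" for i f g
    using that sB sO by (cases i) (auto simp: L_def distrib_right[of f g] mderiv_add smooth_mult plus_fun_apply distrib_left)
  have 2: "L i (cscale c f) = c * L i f" if "f \<in> O_union m'" for i c f
  proof (cases i)
    case (fields g \<alpha> x)
    show ?thesis
    proof (cases "g \<in> B")
      case True
      then have "mderiv \<alpha> (cscale c f * g) = cscale c (mderiv \<alpha> (f * g))"
        unfolding cscale_mult_left using that by (intro mderiv_cscale smooth_mult sB sO)
      then show ?thesis using True fields by (simp add: L_def cscale_def[of c "mderiv _ _"])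
    qed (simp add: L_def fields)
  qed
  have 3: "\<exists>C. \<forall>i. norm (L i f) \<le> C" if f: "f \<in> O_union m'" for f
  proof -
    obtain k r where "r_bound m' k f r" using f by (auto simp: O_union_iff[OF m'])
    then show ?thesis using step[of k] sO[OF f] by blast
  qed
  define p where "p f = (SUP i. norm (L i f))" for f
  have p: "seminorm_on (O_union m') p" unfolding p_def[abs_def] by (rule sup(1)) (rule 1 2 3; assumption)+
  have p_le: "p f \<le> C \<longleftrightarrow> (\<forall>i. norm (L i f) \<le> C)" if "f \<in> O_union m'" for f C
    unfolding p_def by (rule sup(2)[OF _ _ _ that]) (rule 1 2 3; assumption)+
  have f1': "f1 \<in> O_union m'" using f1 OM_space_subset[OF m'] by blast
  let ?U = "{f \<in> OM_space \<omega>. p (f - f1) < e}"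
  have "openin (OM_topology \<omega>) ?U"
  proof (rule openin_OM_ball[OF m' p _ f1'])
    fix k :: nat assume k: "k \<ge> 1"
    obtain C where C: "C \<ge> 0" "\<And>f r. smooth f \<Longrightarrow> r_bound m' k f r \<Longrightarrow> (\<forall>i. norm (L i f) \<le> C * r)"
      using step[of k] by blast
    have "p f \<le> C * r" if f: "f \<in> O_step_space \<omega> m' k" "r_bound m' k f r" for f r
    proof -
      have "f \<in> O_union m'" using f(1) k by (auto simp: O_union_def)
      then show ?thesis using p_le C(2)[OF _ f(2)] sO by blast
    qed
    then show "\<exists>C\<ge>0. \<forall>f r. f \<in> O_step_space \<omega> m' k \<longrightarrow> r_bound m' k f r \<longrightarrow> p f \<le> C * r" using C(1) by blast
  qed
  moreover have "f1 \<in> ?U" using f1 e seminorm_on_0[OF p] by simp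
  moreover have "q (f * g - f1 * g) < ereal e" if f: "f \<in> ?U" and g: "g \<in> B" for f g
  proof -
    have f': "f - f1 \<in> O_union m'"
      using f f1' OM_space_subset[OF m'] cfun.subspace_diff[OF subspace_O_union[OF m']] by blast
    have p0: "p (f - f1) \<ge> 0" by (rule seminorm_on_nonneg[OF p f'])
    have "\<forall>i. norm (L i (f - f1)) \<le> p (f - f1)" using p_le[OF f'] by blast
    then have "q_bound m n ((f - f1) * g) (p (f - f1))" using g bound[OF p0] by blast
    then have "q ((f - f1) * g) \<le> ereal (p (f - f1))" unfolding mn(1) by (intro iffD2[OF q_norm_le_iff[OF mn(2) p0]])
    also have "\<dots> < ereal e" using f by simp
    finally show ?thesis by (simp add: left_diff_distrib)
  qed
  ultimately show "\<exists>U. openin (OM_topology \<omega>) U \<and> f1 \<in> U \<and>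
      (\<forall>f\<in>U. \<forall>h\<in>(\<lambda>g f. f * g) ` B. q (h f - h f1) < ereal e)" by blast
qed

section \<open>Uniform estimates on bounded sets\<close>

lemma bounded_S_imp_q_bound:
  fixes B :: "(real ^ 'n::finite \<Rightarrow> complex) set"
  assumes B: "tvs_bounded (S_topology \<omega>) B" and mn: "m \<ge> 1" "n \<ge> 1"
  shows "\<exists>C. \<forall>g\<in>B. q_bound m n g C"
proof -
  let ?S = "S_space \<omega> :: (real ^ 'n \<Rightarrow> complex) set"
  obtain p where p: "seminorm_on ?S p" "\<And>g. g \<in> ?S \<Longrightarrow> q_norm \<omega> m n g = ereal (p g)"
    using q_norm_seminorm[OF mn(1), where 'n = 'n] by blast
  note S0 = cfun.subspace_0[OF subspace_S_space]
  let ?U = "{g \<in> ?S. q_norm \<omega> m n (g - 0) < ereal 1}"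
  have "openin (S_topology \<omega>) ?U"
    unfolding S_topology_def by (rule openin_seminorm_topology_ball[OF _ S0]) (use mn in auto)
  moreover have "0 \<in> ?U" using S0 p(2)[OF S0] seminorm_on_0[OF p(1)] by simp
  ultimately obtain \<rho> where \<rho>: "\<rho> > 0" "\<And>c. norm c \<ge> \<rho> \<Longrightarrow> B \<subseteq> cscale c ` ?U"
    using B unfolding tvs_bounded_def by blast
  have "q_bound m n g \<rho>" if g: "g \<in> B" for g
  proof -
    have "B \<subseteq> cscale (of_real \<rho>) ` ?U" using \<rho> by (intro \<rho>(2)) simp
    then obtain u where u: "u \<in> ?S" "q_norm \<omega> m n u < ereal 1" "g = cscale (of_real \<rho>) u" using g by auto
    have "p u \<le> 1" using u p(2) by simp
    have "q_norm \<omega> m n g = ereal (p g)" unfolding u(3) by (rule p(2)[OF cfun.subspace_scale[OF subspace_S_space u(1)]])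
    also have "p g = \<rho> * p u" unfolding u(3) seminorm_on_cscale[OF p(1) u(1)] using \<rho>(1) by simp
    finally have "q_norm \<omega> m n g \<le> ereal \<rho>" using \<open>p u \<le> 1\<close> \<rho>(1) by (simp add: mult_left_le)
    then show ?thesis using q_norm_le_iff[OF mn(1), of \<rho> n g] \<rho>(1) by simp
  qed
  then show ?thesis by blast
qed

text \<open>If a bounded set were unbounded in every step, there would be \<open>f k\<close> in it violating the
  \<open>k\<close>-th estimate at a point \<open>x k\<close> with a derivative \<open>\<alpha> k\<close>; the supremum over \<open>k\<close> of these point
  evaluations, scaled by \<open>exp (- k \<omega> (x k))\<close>, is finite and continuous on the inductive limit.\<close>

lemma bounded_OM_imp_r_bound:
  fixes A :: "(real ^ 'n::finite \<Rightarrow> complex) set"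
  assumes A: "tvs_bounded (OM_topology \<omega>) A" and m: "m \<ge> 1"
  shows "\<exists>k R. \<forall>f\<in>A. r_bound m k f R"
proof (rule ccontr)
  assume "\<not> ?thesis"
  \<comment> \<open>The same \<open>k\<close> serves as growth index and as constant, so that every
    pair of them is eventually exceeded.\<close>
  then have "\<forall>k. \<exists>f\<in>A. \<not> r_bound m k f (real k)" by blast
  then have "\<forall>k. \<exists>f \<alpha> x. f \<in> A \<and> norm (mderiv \<alpha> f x) * w m (msize \<alpha>) > real k * exp (real k * \<omega> (norm x))"
    by (simp only: r_bound_def not_all not_le) blast
  then obtain f \<alpha> x where f: "\<And>k. f k \<in> A"
      "\<And>k :: nat. norm (mderiv (\<alpha> k) (f k) (x k)) * w m (msize (\<alpha> k)) > real k * exp (real k * \<omega> (norm (x k)))"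
    by metis
  have AO: "A \<subseteq> OM_space \<omega>" using A by (simp add: tvs_bounded_def topspace_OM_topology)
  define L where "L k g = of_real (w m (msize (\<alpha> k)) / exp (real k * \<omega> (norm (x k)))) * mderiv (\<alpha> k) g (x k)" for k g
  have nL: "norm (L k g) = norm (mderiv (\<alpha> k) g (x k)) * w m (msize (\<alpha> k)) / exp (real k * \<omega> (norm (x k)))" for k g
    by (simp add: L_def norm_mult norm_divide del: of_real_divide)
  have step: "\<exists>C\<ge>0. \<forall>g r. r_bound m j g r \<longrightarrow> (\<forall>k. norm (L k g) \<le> C * r)" for j
  proof -
    \<comment> \<open>On the \<open>j\<close>-th step the quotient of exponentials exceeds 1 only
      for indices \<open>k < j\<close>; the sum over these finitely many exceptions bounds
      it.\<close>
    define C where "C = 1 + (\<Sum>k<j. exp (real j * \<omega> (norm (x k))))"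
    have C1: "C \<ge> 1" by (simp add: C_def sum_nonneg)
    have "norm (L k g) \<le> C * r" if r: "r_bound m j g r" for g r k
    proof -
      have r0: "r \<ge> 0" using r by (rule r_bound_nonneg)
      have "norm (L k g) \<le> r * exp (real j * \<omega> (norm (x k))) / exp (real k * \<omega> (norm (x k)))"
        unfolding nL using r by (intro divide_right_mono) (auto simp: r_bound_def)
      also have "\<dots> = r * (exp (real j * \<omega> (norm (x k))) / exp (real k * \<omega> (norm (x k))))" by simp
      also have "\<dots> \<le> r * C"
      proof (rule mult_left_mono[OF _ r0])
        show "exp (real j * \<omega> (norm (x k))) / exp (real k * \<omega> (norm (x k))) \<le> C"
        proof (cases "k < j")
          case True
          have "exp (real j * \<omega> (norm (x k))) / exp (real k * \<omega> (norm (x k))) \<le> exp (real j * \<omega> (norm (x k))) / 1"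
            using weight_nonneg[of "norm (x k)"] by (intro divide_left_mono) auto
          also have "\<dots> \<le> (\<Sum>k<j. exp (real j * \<omega> (norm (x k))))"
            unfolding div_by_1 using True
            by (intro member_le_sum[where f = "\<lambda>k. exp (real j * \<omega> (norm (x k)))"]) auto
          finally show ?thesis by (simp add: C_def)
        next
          case False
          then have "exp (real j * \<omega> (norm (x k))) \<le> exp (real k * \<omega> (norm (x k)))"
            using weight_nonneg[of "norm (x k)"] by (auto intro: mult_right_mono)
          then show ?thesis using C1 by (simp add: pos_divide_le_eq order_trans[OF _ mult_right_mono[OF C1]])
        qed
      qed
      finally show ?thesis by (simp add: mult.commute)
    qed
    then show ?thesis using C1 by (intro exI[of _ C]) auto
  qed
  have sO: "smooth g" if "g \<in> O_union m" for g :: "real ^ 'n \<Rightarrow> complex" using that by (simp add: O_union_iff[OF m])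
  note sup = seminorm_on_SUP[OF subspace_O_union[OF m], where L = L]
  have 1: "L i (g + h) = L i g + L i h" if "g \<in> O_union m" "h \<in> O_union m" for i g h
    using that sO by (simp add: L_def mderiv_add plus_fun_apply distrib_left)
  have 2: "L i (cscale c g) = c * L i g" if "g \<in> O_union m" for i c g
    using that sO by (simp add: L_def mderiv_cscale, simp add: cscale_def)
  have 3: "\<exists>C. \<forall>i. norm (L i g) \<le> C" if g: "g \<in> O_union m" for g
  proof -
    obtain j r where "r_bound m j g r" using g unfolding O_union_iff[OF m] by blast
    then show ?thesis using step[of j] by blast
  qed
  define p where "p g = (SUP i. norm (L i g))" for g
  have p: "seminorm_on (O_union m) p" unfolding p_def[abs_def] by (rule sup(1)) (rule 1 2 3; assumption)+
  have p_le: "p g \<le> C \<longleftrightarrow> (\<forall>i. norm (L i g) \<le> C)" if "g \<in> O_union m" for g C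
    unfolding p_def by (rule sup(2)[OF _ _ _ that]) (rule 1 2 3; assumption)+
  let ?U = "{g \<in> OM_space \<omega>. p (g - 0) < 1}"
  have "openin (OM_topology \<omega>) ?U"
  proof (rule openin_OM_ball[OF m p _ cfun.subspace_0[OF subspace_O_union[OF m]]])
    fix j :: nat assume j: "j \<ge> 1"
    obtain C where C: "C \<ge> 0" "\<And>g r. r_bound m j g r \<Longrightarrow> (\<forall>k. norm (L k g) \<le> C * r)" using step[of j] by blast
    have "p g \<le> C * r" if g: "g \<in> O_step_space \<omega> m j" "r_bound m j g r" for g r
    proof -
      have "g \<in> O_union m" using g(1) j by (auto simp: O_union_def)
      then show ?thesis using p_le C(2)[OF g(2)] by blast
    qed
    then show "\<exists>C\<ge>0. \<forall>g r. g \<in> O_step_space \<omega> m j \<longrightarrow> r_bound m j g r \<longrightarrow> p g \<le> C * r" using C(1) by blast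
  qed
  moreover have "0 \<in> ?U" using cfun.subspace_0[OF subspace_OM_space] seminorm_on_0[OF p] by simp
  ultimately obtain \<rho> where \<rho>: "\<rho> > 0" "\<And>c. norm c \<ge> \<rho> \<Longrightarrow> A \<subseteq> cscale c ` ?U"
    using A unfolding tvs_bounded_def by blast
  \<comment> \<open>All of \<open>A\<close> lies in one multiple of the unit ball of
    \<open>p\<close>, of radius \<rho>, but \<open>f k\<close> was chosen to make its own functional
    \<open>L k\<close> exceed \<open>k\<close>.\<close>
  obtain k :: nat where k: "\<rho> \<le> real k" using real_arch_simple by blast
  have "A \<subseteq> cscale (of_real \<rho>) ` ?U" using \<rho> by (intro \<rho>(2)) simp
  then obtain u where u: "u \<in> OM_space \<omega>" "p u < 1" "f k = cscale (of_real \<rho>) u" using f(1)[of k] by auto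
  have uO: "u \<in> O_union m" using u(1) OM_space_subset[OF m] by blast
  have "p (f k) = \<rho> * p u" unfolding u(3) seminorm_on_cscale[OF p uO] using \<rho>(1) by simp
  also have "\<dots> \<le> \<rho> * 1" using u(2) \<rho>(1) by (intro mult_left_mono) auto
  also have "\<dots> \<le> real k" using k by simp
  finally have "p (f k) \<le> real k" .
  moreover have "f k \<in> O_union m" using f(1)[of k] AO OM_space_subset[OF m] by blast
  ultimately have "norm (L k (f k)) \<le> real k" using p_le by blast
  then show False using f(2)[of k] by (simp add: nL pos_divide_le_eq)
qed

end

theorem proposition4p1:
  fixes \<omega> :: "real \<Rightarrow> real"
  assumes "nonquasianalytic_weight \<omega>"
  shows "cbilinear_between (OM_space \<omega>) (S_space \<omega>) (S_space \<omega>)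
           (\<lambda>(f :: real ^ 'n::finite \<Rightarrow> complex) g. f * g) \<and>
         separately_continuous (OM_topology \<omega>) (S_topology \<omega>) (S_topology \<omega>)
           (\<lambda>(f :: real ^ 'n \<Rightarrow> complex) g. f * g) \<and>
         hypocontinuous (OM_topology \<omega>) (S_topology \<omega>) (S_topology \<omega>)
           (\<lambda>(f :: real ^ 'n \<Rightarrow> complex) g. f * g)"
proof -
  interpret weight \<omega> by standard (rule assms)
  \<comment> \<open>Separate continuity is equicontinuity of singletons, for which the uniform
    bounds are those of a single function.\<close>
  have left: "tvs_equicontinuous (S_topology \<omega>) (S_topology \<omega>) ((\<lambda>f g. f * g) ` {f})"
    if "f \<in> OM_space \<omega>" for f :: "real ^ 'n \<Rightarrow> complex"
  proof -
    have "\<exists>k R. r_bound m k f R" if "m \<ge> 1" for m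
      using \<open>f \<in> OM_space \<omega>\<close> that unfolding OM_space_iff by blast
    then show ?thesis using that by (intro equicontinuous_mult_left) auto
  qed
  have right: "tvs_equicontinuous (OM_topology \<omega>) (S_topology \<omega>) ((\<lambda>g f. f * g) ` {g})"
    if "g \<in> S_space \<omega>" for g :: "real ^ 'n \<Rightarrow> complex"
    using that by (intro equicontinuous_mult_right) (auto simp: S_space_iff)
  show ?thesis
  proof (intro conjI)
    show "cbilinear_between (OM_space \<omega>) (S_space \<omega>) (S_space \<omega>) (\<lambda>(f :: real ^ 'n \<Rightarrow> complex) g. f * g)"
      by (simp add: cbilinear_between_def clinear_between_mult_left clinear_between_mult_right)
    show "separately_continuous (OM_topology \<omega>) (S_topology \<omega>) (S_topology \<omega>) (\<lambda>(f :: real ^ 'n \<Rightarrow> complex) g. f * g)"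
      unfolding separately_continuous_def topspace_OM_topology topspace_S_topology
      using left right by (simp add: tvs_equicontinuous_def)
    show "hypocontinuous (OM_topology \<omega>) (S_topology \<omega>) (S_topology \<omega>) (\<lambda>(f :: real ^ 'n \<Rightarrow> complex) g. f * g)"
      unfolding hypocontinuous_def
    proof (intro conjI allI impI)
      fix A :: "(real ^ 'n \<Rightarrow> complex) set" assume A: "tvs_bounded (OM_topology \<omega>) A"
      then show "tvs_equicontinuous (S_topology \<omega>) (S_topology \<omega>) ((\<lambda>f g. f * g) ` A)"
        by (intro equicontinuous_mult_left bounded_OM_imp_r_bound)
           (auto simp: tvs_bounded_def topspace_OM_topology)
    next
      fix B :: "(real ^ 'n \<Rightarrow> complex) set" assume B: "tvs_bounded (S_topology \<omega>) B"
      then show "tvs_equicontinuous (OM_topology \<omega>) (S_topology \<omega>) ((\<lambda>g f. f * g) ` B)"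
        by (intro equicontinuous_mult_right bounded_S_imp_q_bound)
           (auto simp: tvs_bounded_def topspace_S_topology)
    qed
  qed
qed

end
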